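(* Let $\mathcal{C}$ be a path-connected covering symmetric operad with a good basepoint $\{e_k\}_{k\ge0}$. Then for every $l>1$, $\pi_l(\mathcal{C}/\mathcal{S})=\{\pi_l(\mathcal{C}(k)/S_k,S_ke_k)\}_{k\ge0}$ is a $\pi_1(\mathcal{C}/\mathcal{S})$-operad, with the composition and the action described in the context.
   Context: All spaces are compactly generated Hausdorff. A (nonsymmetric) topological operad $\mathcal{C}$ consists of spaces $\mathcal{C}(n)$, $n\ge 0$, with $\mathcal{C}(0)=*$, continuous maps $\gamma:\mathcal{C}(k)\times\mathcal{C}(m_1)\times\cdots\times\mathcal{C}(m_k)\to\mathcal{C}(m_1+\cdots+m_k)$ ($k\ge1$, $m_i\ge0$) and a unit $1\in\mathcal{C}(1)$, such that $\gamma(\gamma(a;b_1,\ldots,b_k);c_1,\ldots,c_m)=\gamma(a;\gamma(b_1;c_1,\ldots,c_{m_1}),\ldots,\gamma(b_k;c_{m_1+\cdots+m_{k-1}+1},\ldots,c_m))$, $\gamma(1;a)=a$, $\gamma(a;1,\ldots,1)=a$. Morphisms preserve $\gamma$ and the unit. An operad of sets is a discrete topological operad. In $S_n$ the product is $(\sigma\tau)(i)=\tau(\sigma(i))$. The symmetric groups operad $\mathcal{S}=\{S_n\}_{n\ge0}$ has $\gamma(\sigma;\tau_1,\ldots,\tau_k)$ sending $m_1+\cdots+m_{i-1}+j$ ($1\le j\le m_i$) to $\sum_{l:\sigma(l)<\sigma(i)}m_l+\tau_i(j)$. A group operad is an operad of sets $\mathcal{G}=\{G_n\}_{n\ge0}$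 with a morphism of operads $\pi:\mathcal{G}\to\mathcal{S}$ such that each $G_n$ is a group and $\pi:G_n\to S_n$ a homomorphism, the identity of $G_1$ is the operad unit, and $\gamma(aa';b_1b_1',\ldots,b_kb_k')=\gamma(a;b_1,\ldots,b_k)\gamma(a';b'_{a^{-1}(1)},\ldots,b'_{a^{-1}(k)})$, where $a(i)=\pi(a)(i)$. A $\mathcal{G}$-operad is an operad $\mathcal{D}$ with left actions of $G_n$ on $\mathcal{D}(n)$ such that $\gamma(\sigma a;\tau_1b_1,\ldots,\tau_kb_k)=\gamma(\sigma;\tau_1,\ldots,\tau_k)\gamma(a;b_{\sigma^{-1}(1)},\ldots,b_{\sigma^{-1}(k)})$. A symmetric operad is an $\mathcal{S}$-operad; it is covering if each action of $S_n$ on $\mathcal{C}(n)$ is a covering action (every point has a neighbourhood $U$ with $gU\cap U=\emptyset$ for $g\neq1$), and path-connected if each $\mathcal{C}(k)$ is. Good basepoint: $\mathcal{C}_1$ is the little intervals operad: $\mathcal{C}_1(k)$ is the space of $k$-tuples of increasing affine embeddings $[0,1]\to[0,1]$ with images having pairwise disjoint interiors, $\mathcal{C}_1(0)=*$, unit the identity, $\gamma(c;d^1,\ldots,d^k)$ the tuple of all composites $c_i\circ d^i_j$ in lexicographic order. Let $c_0=*$, $c_k=([0,\frac1k],\ldots,[\frac{k-1}k,1])$ and let $\mathcal{C}_1(k)_0$ be the path component of $c_k$; $(\mathcal{C}_1)_0=\{\mathcal{C}_1(k)_0\}$ is a nonsymmetric operad. A good basepoint of $\mathcal{C}$ is $\{e_k=\eta(c_k)\}$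 for a chosen morphism of nonsymmetric operads $\eta:(\mathcal{C}_1)_0\to\mathcal{C}$. For $u,v\in\mathcal{C}_1(k)_0$ the path $t\mapsto\eta((1-t)u+tv)$ is the linear path from $\eta(u)$ to $\eta(v)$; the linear path from $e_m$ to $\gamma(e_k;e_{n_1},\ldots,e_{n_k})$ uses $u=c_m$, $v=\gamma(c_k;c_{n_1},\ldots,c_{n_k})$. The group operad $\pi_1(\mathcal{C}/\mathcal{S})$: identify $\pi_1(\mathcal{C}(k)/S_k,S_ke_k)$ by path lifting with the set of homotopy classes rel endpoints of paths in $\mathcal{C}(k)$ from $e_k$ to points of $S_ke_k$; $\pi[f]=\pi f\in S_k$ is determined by $f(1)=(\pi f)e_k$; the product is $[f]*[g]=[f\cdot(\pi f)g]$ (left-to-right composition of paths); and for $m=\sum m_i$, $\gamma([f];[g_1],\ldots,[g_k])=[\delta_1\cdot\gamma(f;g_1,\ldots,g_k)\cdot\gamma(\pi f;\pi g_1,\ldots,\pi g_k)\delta_2^{-1}]$, where $\delta_1$, $\delta_2$ are the linear paths from $e_m$ to $\gamma(e_k;e_{m_1},\ldots,e_{m_k})$ and to $\gamma(e_k;e_{m_{(\pi f)^{-1}(1)}},\ldots,e_{m_{(\pi f)^{-1}(k)}})$ respectively. Structure on $\pi_l(\mathcal{C}/\mathcal{S})$, $l>1$: identify $\pi_l(\mathcal{C}(k)/S_k,S_ke_k)$ with $\pi_l(\mathcal{C}(k),e_k)$ via the covering projection. For a path $u$ from $x$ to $y$, let $u_*:\pi_l(X,y)\to\pi_l(X,x)$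 be the change-of-basepoint isomorphism. The composition is $\gamma([f];[g_1],\ldots,[g_k])=(\delta_1)_*[\gamma(f;g_1,\ldots,g_k)]$ with $\gamma(f;g_1,\ldots,g_k)(z)=\gamma(f(z);g_1(z),\ldots,g_k(z))$. The action of $[a]\in\pi_1(\mathcal{C}(k)/S_k,S_ke_k)$ (represented by a path $a$ from $e_k$ to $(\pi a)e_k$) on $[f]\in\pi_l(\mathcal{C}(k),e_k)$ is $[a]\star[f]=a_*[(\pi a)f]$, where $(\pi a)f$ is the translate of $f$ by $\pi a$. *)

theory Defs
  imports "HOL-Analysis.Analysis" "HOL-Algebra.Group_Action"
begin

section \<open>Operads\<close>

text \<open>
  All indices are shifted to start at \<open>0\<close>; in particular \<open>S\<^sub>n\<close> permutes \<open>{..<n}\<close>.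
  The arity profile \<open>[m\<^sub>1, \<dots>, m\<^sub>k]\<close> is an explicit argument of the composition, because elements
  of the common carrier type do not determine their arity.
\<close>

record 'a operad =
  op_space :: "nat \<Rightarrow> 'a topology"
  op_comp :: "nat list \<Rightarrow> 'a \<Rightarrow> 'a list \<Rightarrow> 'a"
  op_unit :: 'a

abbreviation op_pts :: "('a, 'z) operad_scheme \<Rightarrow> nat \<Rightarrow> 'a set"
  where "op_pts D n \<equiv> topspace (op_space D n)"

definition op_tuples :: "('a, 'z) operad_scheme \<Rightarrow> nat list \<Rightarrow> 'a list set"
  where "op_tuples D ms = listset (map (op_pts D) ms)"

fun split_blocks :: "nat list \<Rightarrow> 'b list \<Rightarrow> 'b list list"
  where
    "split_blocks [] xs = []"
  | "split_blocks (m # ms) xs = take m xs # split_blocks ms (drop m xs)"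

text \<open>
  Products of spaces are products of compactly generated spaces, hence the \<^const>\<open>kification\<close>.
  The empty profile is allowed: it only gives the identity of the one-point space of arity \<open>0\<close>,
  which is how associativity has to be read when some \<open>m\<^sub>i = 0\<close>.
\<close>

definition is_operad :: "('a, 'z) operad_scheme \<Rightarrow> bool"
  where "is_operad D \<longleftrightarrow>
    (\<forall>n. Hausdorff_space (op_space D n) \<and> k_space (op_space D n)) \<and>
    (\<exists>x. op_pts D 0 = {x}) \<and>
    (\<forall>ms. continuous_map
       (kification (prod_topology (op_space D (length ms))
          (product_topology (\<lambda>i. op_space D (ms ! i)) {..<length ms})))
       (op_space D (sum_list ms))
       (\<lambda>(a, b). op_comp D ms a (map b [0..<length ms]))) \<and>
    op_unit D \<in> op_pts D 1 \<and>
    (\<forall>ms ns a bs cs.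
       length ns = sum_list ms \<and> a \<in> op_pts D (length ms) \<and>
       bs \<in> op_tuples D ms \<and> cs \<in> op_tuples D ns \<longrightarrow>
       op_comp D ns (op_comp D ms a bs) cs =
       op_comp D (map sum_list (split_blocks ms ns)) a
         (map (\<lambda>(ns', b, cs'). op_comp D ns' b cs')
            (zip (split_blocks ms ns) (zip bs (split_blocks ms cs))))) \<and>
    (\<forall>n. \<forall>a\<in>op_pts D n. op_comp D [n] (op_unit D) [a] = a) \<and>
    (\<forall>n. \<forall>a\<in>op_pts D n. op_comp D (replicate n 1) a (replicate n (op_unit D)) = a)"

definition operad_morphism ::
    "('a, 'y) operad_scheme \<Rightarrow> ('b, 'z) operad_scheme \<Rightarrow> (nat \<Rightarrow> 'a \<Rightarrow> 'b) \<Rightarrow> bool"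
  where "operad_morphism D E \<phi> \<longleftrightarrow>
    (\<forall>n. continuous_map (op_space D n) (op_space E n) (\<phi> n)) \<and>
    (\<forall>ms. \<forall>a\<in>op_pts D (length ms). \<forall>bs\<in>op_tuples D ms.
       \<phi> (sum_list ms) (op_comp D ms a bs) = op_comp E ms (\<phi> (length ms) a) (map2 \<phi> ms bs)) \<and>
    \<phi> 1 (op_unit D) = op_unit E"

definition is_set_operad :: "('a, 'z) operad_scheme \<Rightarrow> bool"
  where "is_set_operad D \<longleftrightarrow>
    is_operad D \<and> (\<forall>n. op_space D n = discrete_topology (op_pts D n))"


section \<open>Symmetric groups, group operads, and their actions\<close>

text \<open>The product is \<open>(\<sigma>\<tau>)(i) = \<tau>(\<sigma>(i))\<close>.\<close>

definition symm_group :: "nat \<Rightarrow> (nat \<Rightarrow> nat) monoid"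
  where "symm_group n =
    \<lparr>carrier = {\<sigma>. \<sigma> permutes {..<n}}, mult = (\<lambda>\<sigma> \<tau>. \<tau> \<circ> \<sigma>), one = id\<rparr>"

text \<open>The pair \<open>(i, j)\<close> stands at position \<open>m\<^sub>0 + \<dots> + m\<^sub>i\<^sub>-\<^sub>1 + j\<close> of this list.\<close>

definition lex_pairs :: "nat list \<Rightarrow> (nat \<times> nat) list"
  where "lex_pairs ms = [(i, j). i \<leftarrow> [0..<length ms], j \<leftarrow> [0..<ms ! i]]"

definition symm_comp :: "nat list \<Rightarrow> (nat \<Rightarrow> nat) \<Rightarrow> (nat \<Rightarrow> nat) list \<Rightarrow> nat \<Rightarrow> nat"
  where "symm_comp ms \<sigma> \<tau>s p =
    (if p < sum_list ms
     then case lex_pairs ms ! p of (i, j) \<Rightarrow>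
       (\<Sum>l | l < length ms \<and> \<sigma> l < \<sigma> i. ms ! l) + (\<tau>s ! i) j
     else p)"

definition symm_operad :: "(nat \<Rightarrow> nat) operad"
  where "symm_operad =
    \<lparr>op_space = (\<lambda>n. discrete_topology (carrier (symm_group n))),
     op_comp = symm_comp, op_unit = id\<rparr>"

record 'g group_operad = "'g operad" +
  go_group :: "nat \<Rightarrow> 'g monoid"
  go_perm :: "nat \<Rightarrow> 'g \<Rightarrow> nat \<Rightarrow> nat"

text \<open>The tuple \<open>(x\<^bsub>\<sigma>\<inverse>(0)\<^esub>, x\<^bsub>\<sigma>\<inverse>(1)\<^esub>, \<dots>)\<close>.\<close>

definition permute_by :: "(nat \<Rightarrow> nat) \<Rightarrow> 'b list \<Rightarrow> 'b list"
  where "permute_by \<sigma> xs = permute_list (inv_into UNIV \<sigma>) xs"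

definition is_group_operad :: "('g, 'z) group_operad_scheme \<Rightarrow> bool"
  where "is_group_operad G \<longleftrightarrow>
    is_set_operad G \<and>
    operad_morphism G symm_operad (go_perm G) \<and>
    (\<forall>n. group (go_group G n) \<and> carrier (go_group G n) = op_pts G n \<and>
         go_perm G n \<in> hom (go_group G n) (symm_group n)) \<and>
    one (go_group G 1) = op_unit G \<and>
    (\<forall>ms. \<forall>a\<in>op_pts G (length ms). \<forall>a'\<in>op_pts G (length ms).
       \<forall>bs\<in>op_tuples G ms. \<forall>bs'\<in>op_tuples G ms.
       op_comp G ms (mult (go_group G (length ms)) a a')
         (map (\<lambda>(m, b, b'). mult (go_group G m) b b') (zip ms (zip bs bs'))) =
       mult (go_group G (sum_list ms)) (op_comp G ms a bs)
         (let \<sigma> = go_perm G (length ms) a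
          in op_comp G (permute_by \<sigma> ms) a' (permute_by \<sigma> bs')))"

definition symm_group_operad :: "(nat \<Rightarrow> nat) group_operad"
  where "symm_group_operad =
    operad.extend symm_operad \<lparr>go_group = symm_group, go_perm = (\<lambda>n \<sigma>. \<sigma>)\<rparr>"

text \<open>
  The maps of a library \<^locale>\<open>group_action\<close> are extensional; the action maps of an operad are
  only relevant on the respective space, so they are restricted to it.
\<close>

definition is_operad_over ::
    "('g, 'y) group_operad_scheme \<Rightarrow> ('a, 'z) operad_scheme \<Rightarrow> (nat \<Rightarrow> 'g \<Rightarrow> 'a \<Rightarrow> 'a) \<Rightarrow> bool"
  where "is_operad_over G D act \<longleftrightarrow>
    is_group_operad G \<and> is_operad D \<and>
    (\<forall>n. group_action (go_group G n) (op_pts D n) (\<lambda>g. restrict (act n g) (op_pts D n))) \<and>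
    (\<forall>n. \<forall>g\<in>op_pts G n. continuous_map (op_space D n) (op_space D n) (act n g)) \<and>
    (\<forall>ms. \<forall>s\<in>op_pts G (length ms). \<forall>ts\<in>op_tuples G ms.
       \<forall>a\<in>op_pts D (length ms). \<forall>bs\<in>op_tuples D ms.
       op_comp D ms (act (length ms) s a)
         (map (\<lambda>(m, t, b). act m t b) (zip ms (zip ts bs))) =
       act (sum_list ms) (op_comp G ms s ts)
         (let \<sigma> = go_perm G (length ms) s
          in op_comp D (permute_by \<sigma> ms) a (permute_by \<sigma> bs)))"

definition symmetric_operad :: "'a operad \<Rightarrow> (nat \<Rightarrow> (nat \<Rightarrow> nat) \<Rightarrow> 'a \<Rightarrow> 'a) \<Rightarrow> bool"
  where "symmetric_operad C act \<longleftrightarrow> is_operad_over symm_group_operad C act"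

definition covering_action :: "'g monoid \<Rightarrow> 'a topology \<Rightarrow> ('g \<Rightarrow> 'a \<Rightarrow> 'a) \<Rightarrow> bool"
  where "covering_action G X \<phi> \<longleftrightarrow>
    (\<forall>x\<in>topspace X. \<exists>U. openin X U \<and> x \<in> U \<and>
       (\<forall>g\<in>carrier G. g \<noteq> one G \<longrightarrow> \<phi> g ` U \<inter> U = {}))"

definition covering_symmetric_operad ::
    "'a operad \<Rightarrow> (nat \<Rightarrow> (nat \<Rightarrow> nat) \<Rightarrow> 'a \<Rightarrow> 'a) \<Rightarrow> bool"
  where "covering_symmetric_operad C act \<longleftrightarrow>
    symmetric_operad C act \<and> (\<forall>n. covering_action (symm_group n) (op_space C n) (act n))"

definition path_connected_operad :: "('a, 'z) operad_scheme \<Rightarrow> bool"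
  where "path_connected_operad C \<longleftrightarrow> (\<forall>n. path_connected_space (op_space C n))"


section \<open>Little intervals and good basepoints\<close>

text \<open>
  An increasing affine embedding of \<open>[0,1]\<close> into itself is encoded by its values \<open>(x, y)\<close> at
  \<open>0\<close> and \<open>1\<close>; the \<open>k\<close>-tuples are topologized as a subspace of \<open>(\<real>\<^sup>2)\<^sup>k\<close>.
\<close>

definition little_intervals :: "nat \<Rightarrow> (nat \<Rightarrow> real \<times> real) topology"
  where "little_intervals k =
    subtopology (product_topology (\<lambda>_. euclidean) {..<k})
      {c. (\<forall>i<k. 0 \<le> fst (c i) \<and> fst (c i) < snd (c i) \<and> snd (c i) \<le> 1) \<and>
          (\<forall>i<k. \<forall>j<k. i \<noteq> j \<longrightarrow>
             {fst (c i)<..<snd (c i)} \<inter> {fst (c j)<..<snd (c j)} = {})}"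

definition affine_of :: "real \<times> real \<Rightarrow> real \<Rightarrow> real"
  where "affine_of c t = (1 - t) * fst c + t * snd c"

definition little_intervals_comp ::
    "nat list \<Rightarrow> (nat \<Rightarrow> real \<times> real) \<Rightarrow> (nat \<Rightarrow> real \<times> real) list \<Rightarrow> nat \<Rightarrow> real \<times> real"
  where "little_intervals_comp ms c ds =
    (\<lambda>p\<in>{..<sum_list ms}. case lex_pairs ms ! p of (i, j) \<Rightarrow>
       (affine_of (c i) (fst ((ds ! i) j)), affine_of (c i) (snd ((ds ! i) j))))"

definition little_intervals_operad :: "(nat \<Rightarrow> real \<times> real) operad"
  where "little_intervals_operad =
    \<lparr>op_space = little_intervals, op_comp = little_intervals_comp,
     op_unit = (\<lambda>i\<in>{..<1}. (0, 1))\<rparr>"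

definition even_intervals :: "nat \<Rightarrow> nat \<Rightarrow> real \<times> real"
  where "even_intervals k = (\<lambda>i\<in>{..<k}. (real i / real k, (real i + 1) / real k))"

definition ordered_intervals_operad :: "(nat \<Rightarrow> real \<times> real) operad"
  where "ordered_intervals_operad = little_intervals_operad
    \<lparr>op_space := (\<lambda>k. subtopology (little_intervals k)
                     (path_component_of_set (little_intervals k) (even_intervals k)))\<rparr>"

text \<open>
  A good basepoint is given by the morphism \<open>\<eta>\<close>, on which the linear paths depend; the
  basepoints themselves are \<open>e\<^sub>k = basepoint \<eta> k\<close>.
\<close>

definition good_basepoint ::
    "('a, 'z) operad_scheme \<Rightarrow> (nat \<Rightarrow> (nat \<Rightarrow> real \<times> real) \<Rightarrow> 'a) \<Rightarrow> bool"
  where "good_basepoint C \<eta> \<longleftrightarrow> operad_morphism ordered_intervals_operad C \<eta>"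

definition basepoint :: "(nat \<Rightarrow> (nat \<Rightarrow> real \<times> real) \<Rightarrow> 'a) \<Rightarrow> nat \<Rightarrow> 'a"
  where "basepoint \<eta> k = \<eta> k (even_intervals k)"

definition linear_path ::
    "(nat \<Rightarrow> (nat \<Rightarrow> real \<times> real) \<Rightarrow> 'a) \<Rightarrow> nat \<Rightarrow>
     (nat \<Rightarrow> real \<times> real) \<Rightarrow> (nat \<Rightarrow> real \<times> real) \<Rightarrow> real \<Rightarrow> 'a"
  where "linear_path \<eta> k u v t = \<eta> k (\<lambda>i\<in>{..<k}. (1 - t) *\<^sub>R u i + t *\<^sub>R v i)"

text \<open>The linear path from \<open>e\<^sub>m\<close> to \<open>\<gamma>(e\<^sub>k; e\<^bsub>m\<^sub>1\<^esub>, \<dots>, e\<^bsub>m\<^sub>k\<^esub>)\<close>, where \<open>m = m\<^sub>1 + \<dots> + m\<^sub>k\<close>.\<close>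

definition base_path :: "(nat \<Rightarrow> (nat \<Rightarrow> real \<times> real) \<Rightarrow> 'a) \<Rightarrow> nat list \<Rightarrow> real \<Rightarrow> 'a"
  where "base_path \<eta> ms =
    linear_path \<eta> (sum_list ms) (even_intervals (sum_list ms))
      (little_intervals_comp ms (even_intervals (length ms)) (map even_intervals ms))"


section \<open>Paths, homotopy groups and orbit spaces\<close>

text \<open>
  The library's \<^const>\<open>joinpaths\<close> and \<^const>\<open>reversepath\<close> ask for a type of class
  \<^class>\<open>topological_space\<close>; here a type carries many topologies.
\<close>

definition path_join :: "(real \<Rightarrow> 'a) \<Rightarrow> (real \<Rightarrow> 'a) \<Rightarrow> real \<Rightarrow> 'a"
  where "path_join f g = (\<lambda>t. if t \<le> 1/2 then f (2 * t) else g (2 * t - 1))"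

definition path_rev :: "(real \<Rightarrow> 'a) \<Rightarrow> real \<Rightarrow> 'a"
  where "path_rev f = (\<lambda>t. f (1 - t))"

definition path_class :: "'a topology \<Rightarrow> (real \<Rightarrow> 'a) \<Rightarrow> (real \<Rightarrow> 'a) set"
  where "path_class X f =
    {g. homotopic_with (\<lambda>h. h 0 = f 0 \<and> h 1 = f 1) (top_of_set {0..1}) X f g}"

definition fundamental_group_set :: "'a topology \<Rightarrow> 'a \<Rightarrow> (real \<Rightarrow> 'a) set set"
  where "fundamental_group_set X x = {path_class X f | f. pathin X f \<and> f 0 = x \<and> f 1 = x}"

text \<open>Elements of \<open>\<pi>\<^sub>l(X, x)\<close> are classes of maps of the cube \<open>[0,1]\<^sup>l\<close>, where \<open>l = CARD('l)\<close>.\<close>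

definition spheroid :: "'a topology \<Rightarrow> 'a \<Rightarrow> (real ^ 'l \<Rightarrow> 'a) \<Rightarrow> bool"
  where "spheroid X x f \<longleftrightarrow>
    continuous_map (top_of_set (cbox 0 1)) X f \<and> (\<forall>s\<in>cbox 0 1 - box 0 1. f s = x)"

definition spheroid_class ::
    "'a topology \<Rightarrow> 'a \<Rightarrow> (real ^ 'l \<Rightarrow> 'a) \<Rightarrow> (real ^ 'l \<Rightarrow> 'a) set"
  where "spheroid_class X x f =
    {g. homotopic_with (\<lambda>h. \<forall>s\<in>cbox 0 1 - box 0 1. h s = x) (top_of_set (cbox 0 1)) X f g}"

definition homotopy_group_set :: "'a topology \<Rightarrow> 'a \<Rightarrow> (real ^ 'l \<Rightarrow> 'a) set set"
  where "homotopy_group_set X x = {spheroid_class X x f | f. spheroid X x f}"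

text \<open>
  For a path \<open>u\<close> from \<open>x\<close> to \<open>y\<close> and \<open>f\<close> based at \<open>y\<close>, this represents \<open>u\<^sub>*[f]\<close>, based at \<open>x\<close>:
  \<open>f\<close> is shrunk to the concentric cube of side \<open>1/2\<close>, and each radial segment from the boundary
  of the small cube to the boundary of the large one runs through \<open>u\<close> backwards.
\<close>

definition change_base :: "(real \<Rightarrow> 'a) \<Rightarrow> (real ^ 'l \<Rightarrow> 'a) \<Rightarrow> real ^ 'l \<Rightarrow> 'a"
  where "change_base u f = (\<lambda>s. let r = infnorm (2 *\<^sub>R s - 1) in
    if r \<le> 1/2 then f (2 *\<^sub>R s - (1/2) *\<^sub>R 1) else u (2 * (1 - r)))"

definition orbit_topology :: "'g monoid \<Rightarrow> 'a topology \<Rightarrow> ('g \<Rightarrow> 'a \<Rightarrow> 'a) \<Rightarrow> 'a set topology"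
  where "orbit_topology G X \<phi> = topology (\<lambda>U. U \<subseteq> orbits G (topspace X) \<phi> \<and>
    openin X {x \<in> topspace X. orbit G \<phi> x \<in> U})"

lemma openin_orbit_topology:
  "openin (orbit_topology G X \<phi>) U \<longleftrightarrow>
    U \<subseteq> orbits G (topspace X) \<phi> \<and> openin X {x \<in> topspace X. orbit G \<phi> x \<in> U}"
proof -
  have "istopology (\<lambda>U. U \<subseteq> orbits G (topspace X) \<phi> \<and>
          openin X {x \<in> topspace X. orbit G \<phi> x \<in> U})"
    unfolding istopology_def
  proof (intro conjI strip)
    fix S T
    assume "S \<subseteq> orbits G (topspace X) \<phi> \<and> openin X {x \<in> topspace X. orbit G \<phi> x \<in> S}"
      and "T \<subseteq> orbits G (topspace X) \<phi> \<and> openin X {x \<in> topspace X. orbit G \<phi> x \<in> T}"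
    moreover have "{x \<in> topspace X. orbit G \<phi> x \<in> S \<inter> T} =
        {x \<in> topspace X. orbit G \<phi> x \<in> S} \<inter> {x \<in> topspace X. orbit G \<phi> x \<in> T}"
      by blast
    ultimately show "S \<inter> T \<subseteq> orbits G (topspace X) \<phi>"
      and "openin X {x \<in> topspace X. orbit G \<phi> x \<in> S \<inter> T}"
      by auto
  next
    fix K
    assume K: "\<forall>U\<in>K. U \<subseteq> orbits G (topspace X) \<phi> \<and> openin X {x \<in> topspace X. orbit G \<phi> x \<in> U}"
    then show "\<Union>K \<subseteq> orbits G (topspace X) \<phi>" by blast
    have "{x \<in> topspace X. orbit G \<phi> x \<in> \<Union>K} = (\<Union>U\<in>K. {x \<in> topspace X. orbit G \<phi> x \<in> U})"
      by blast
    with K show "openin X {x \<in> topspace X. orbit G \<phi> x \<in> \<Union>K}"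
      by auto
  qed
  then show ?thesis
    by (simp add: orbit_topology_def topology_inverse')
qed

lemma topspace_orbit_topology: "topspace (orbit_topology G X \<phi>) = orbits G (topspace X) \<phi>"
proof -
  have "{x \<in> topspace X. orbit G \<phi> x \<in> orbits G (topspace X) \<phi>} = topspace X"
    by (auto simp: orbits_def)
  then have "openin (orbit_topology G X \<phi>) (orbits G (topspace X) \<phi>)"
    by (simp add: openin_orbit_topology)
  then show ?thesis
    by (metis openin_orbit_topology openin_subset openin_topspace subset_antisym)
qed

lemma quotient_map_orbit: "quotient_map X (orbit_topology G X \<phi>) (orbit G \<phi>)"
  by (auto simp: quotient_map_def topspace_orbit_topology openin_orbit_topology orbits_def)


section \<open>The operads of homotopy groups of the orbit spaces\<close>

context
  fixes C :: "'a operad"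
    and act :: "nat \<Rightarrow> (nat \<Rightarrow> nat) \<Rightarrow> 'a \<Rightarrow> 'a"
    and \<eta> :: "nat \<Rightarrow> (nat \<Rightarrow> real \<times> real) \<Rightarrow> 'a"
begin

definition orbit_map :: "nat \<Rightarrow> 'a \<Rightarrow> 'a set"
  where "orbit_map k = orbit (symm_group k) (act k)"

definition orbit_space :: "nat \<Rightarrow> 'a set topology"
  where "orbit_space k = orbit_topology (symm_group k) (op_space C k) (act k)"

definition orbit_base :: "nat \<Rightarrow> 'a set"
  where "orbit_base k = orbit_map k (basepoint \<eta> k)"

text \<open>
  The identification by path lifting: an element \<open>x\<close> of \<open>\<pi>\<^sub>1(C(k)/S\<^sub>k, S\<^sub>k e\<^sub>k)\<close> corresponds to the
  paths in \<open>C(k)\<close> from \<open>e\<^sub>k\<close> to points of \<open>S\<^sub>k e\<^sub>k\<close> whose projections represent \<open>x\<close>.  The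
  operations are given on representatives; as usual for operations on classes, the union over
  all representatives is a class only if the result does not depend on them.
\<close>

definition proj_path_class :: "nat \<Rightarrow> (real \<Rightarrow> 'a) \<Rightarrow> (real \<Rightarrow> 'a set) set"
  where "proj_path_class k f = path_class (orbit_space k) (orbit_map k \<circ> f)"

definition lifted_paths :: "nat \<Rightarrow> (real \<Rightarrow> 'a set) set \<Rightarrow> (real \<Rightarrow> 'a) set"
  where "lifted_paths k x =
    {f. pathin (op_space C k) f \<and> f 0 = basepoint \<eta> k \<and> f 1 \<in> orbit_base k \<and>
        proj_path_class k f = x}"

definition end_perm :: "nat \<Rightarrow> (real \<Rightarrow> 'a) \<Rightarrow> nat \<Rightarrow> nat"
  where "end_perm k f =
    (THE \<sigma>. \<sigma> \<in> carrier (symm_group k) \<and> f 1 = act k \<sigma> (basepoint \<eta> k))"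

definition pi1_perm :: "nat \<Rightarrow> (real \<Rightarrow> 'a set) set \<Rightarrow> nat \<Rightarrow> nat"
  where "pi1_perm k x = (THE \<sigma>. \<exists>f\<in>lifted_paths k x. \<sigma> = end_perm k f)"

definition pi1_mult ::
    "nat \<Rightarrow> (real \<Rightarrow> 'a set) set \<Rightarrow> (real \<Rightarrow> 'a set) set \<Rightarrow> (real \<Rightarrow> 'a set) set"
  where "pi1_mult k x y =
    (\<Union>f\<in>lifted_paths k x. \<Union>g\<in>lifted_paths k y.
       proj_path_class k (path_join f (\<lambda>t. act k (end_perm k f) (g t))))"

definition pi1_one :: "nat \<Rightarrow> (real \<Rightarrow> 'a set) set"
  where "pi1_one k = proj_path_class k (\<lambda>t. basepoint \<eta> k)"

definition pi1_comp ::
    "nat list \<Rightarrow> (real \<Rightarrow> 'a set) set \<Rightarrow> (real \<Rightarrow> 'a set) set list \<Rightarrow> (real \<Rightarrow> 'a set) set"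
  where "pi1_comp ms x ys =
    (\<Union>f\<in>lifted_paths (length ms) x. \<Union>gs\<in>listset (map2 lifted_paths ms ys).
       let \<sigma> = end_perm (length ms) f;
           \<rho> = symm_comp ms \<sigma> (map2 end_perm ms gs)
       in proj_path_class (sum_list ms)
            (path_join (base_path \<eta> ms)
              (path_join (\<lambda>t. op_comp C ms (f t) (map (\<lambda>g. g t) gs))
                (\<lambda>t. act (sum_list ms) \<rho> (path_rev (base_path \<eta> (permute_by \<sigma> ms)) t)))))"

definition pi1_operad :: "(real \<Rightarrow> 'a set) set group_operad"
  where "pi1_operad =
    \<lparr>op_space = (\<lambda>k. discrete_topology (fundamental_group_set (orbit_space k) (orbit_base k))),
     op_comp = pi1_comp,
     op_unit = pi1_one 1,
     go_group = (\<lambda>k. \<lparr>carrier = fundamental_group_set (orbit_space k) (orbit_base k),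
                      mult = pi1_mult k, one = pi1_one k\<rparr>),
     go_perm = pi1_perm\<rparr>"

text \<open>
  Similarly, an element \<open>x\<close> of \<open>\<pi>\<^sub>l(C(k)/S\<^sub>k, S\<^sub>k e\<^sub>k)\<close> corresponds to the class in
  \<open>\<pi>\<^sub>l(C(k), e\<^sub>k)\<close> that the covering projection sends to \<open>x\<close>.
\<close>

definition proj_spheroid_class :: "nat \<Rightarrow> (real ^ 'l \<Rightarrow> 'a) \<Rightarrow> (real ^ 'l \<Rightarrow> 'a set) set"
  where "proj_spheroid_class k f =
    spheroid_class (orbit_space k) (orbit_base k) (orbit_map k \<circ> f)"

definition lifted_spheroids :: "nat \<Rightarrow> (real ^ 'l \<Rightarrow> 'a set) set \<Rightarrow> (real ^ 'l \<Rightarrow> 'a) set"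
  where "lifted_spheroids k x =
    {f. spheroid (op_space C k) (basepoint \<eta> k) f \<and> proj_spheroid_class k f = x}"

definition pi_comp ::
    "nat list \<Rightarrow> (real ^ 'l \<Rightarrow> 'a set) set \<Rightarrow> (real ^ 'l \<Rightarrow> 'a set) set list \<Rightarrow>
     (real ^ 'l \<Rightarrow> 'a set) set"
  where "pi_comp ms x ys =
    (\<Union>f\<in>lifted_spheroids (length ms) x. \<Union>gs\<in>listset (map2 lifted_spheroids ms ys).
       proj_spheroid_class (sum_list ms)
         (change_base (base_path \<eta> ms) (\<lambda>z. op_comp C ms (f z) (map (\<lambda>g. g z) gs))))"

definition pi_act ::
    "nat \<Rightarrow> (real \<Rightarrow> 'a set) set \<Rightarrow> (real ^ 'l \<Rightarrow> 'a set) set \<Rightarrow> (real ^ 'l \<Rightarrow> 'a set) set"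
  where "pi_act k x y =
    (\<Union>a\<in>lifted_paths k x. \<Union>f\<in>lifted_spheroids k y.
       proj_spheroid_class k (change_base a (\<lambda>z. act k (end_perm k a) (f z))))"

text \<open>The operad \<open>\<pi>\<^sub>l(C/S)\<close> with \<open>l = CARD('l)\<close>.\<close>

definition pi_operad :: "(real ^ 'l \<Rightarrow> 'a set) set operad"
  where "pi_operad =
    \<lparr>op_space = (\<lambda>k. discrete_topology (homotopy_group_set (orbit_space k) (orbit_base k))),
     op_comp = pi_comp,
     op_unit = proj_spheroid_class 1 (\<lambda>z. basepoint \<eta> 1)\<rparr>"

end

end

theory Submission
  imports Defs
begin

text \<open>
  The orbit map \<open>C(k) \<rightarrow> C(k)/S\<^sub>k\<close> is a covering.  Hence an element of \<open>\<pi>\<^sub>1(C(k)/S\<^sub>k)\<close> is a path of \<open>C(k)\<close>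
  from \<open>e\<^sub>k\<close> to some translate \<open>\<sigma>e\<^sub>k\<close>, up to homotopy rel endpoints, and an element of
  \<open>\<pi>\<^sub>l(C(k)/S\<^sub>k)\<close> is a spheroid of \<open>C(k)\<close> at \<open>e\<^sub>k\<close>, up to homotopy rel boundary.  Composing with the
  operad pointwise, translating by permutations, concatenating paths and dragging a spheroid along
  a path commute with each other on the nose.  All axioms would therefore hold already for
  representatives if the composition preserved base points.  It does not: \<open>\<gamma>(e\<^sub>k; e\<^bsub>m\<^sub>1\<^esub>, \<dots>)\<close> is
  only joined to \<open>e\<^sub>m\<close> by a linear path, and the work consists in showing that these linear paths
  do no harm.

  The idea is to let the base points move.  Call a path from \<open>\<eta>(u)\<close> to \<open>\<sigma>\<eta>(v)\<close> an arrow, where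
  \<open>u\<close> and \<open>v\<close> are arbitrary configurations of intervals in increasing order.  Such configurations
  form a convex set, so a path in their image under \<open>\<eta>\<close> is determined by its end configurations up
  to homotopy (\<open>eta_path_unique\<close>).  Closing up an arrow by such paths gives it a well-defined class
  in \<open>\<pi>\<^sub>1\<close>, and in the same way every spheroid at a point \<open>\<eta>(u)\<close> has a class in \<open>\<pi>\<^sub>l\<close>.  The
  central statements say that classes are compatible with all structure:
  the operad composition of arrows and of spheroids represents the composition of their classes
  (\<open>arrow_class_comp\<close>, \<open>sph_class_comp\<close>), concatenation represents the product
  (\<open>arrow_class_mult\<close>), and change of base point along an arrow represents the action
  (\<open>sph_class_act\<close>).  With them each axiom compares two representatives whose paths or spheroids
  agree pointwise by the corresponding axiom for \<open>C\<close>, and whose marks \<open>u\<close>, \<open>\<sigma>\<close>, \<open>v\<close> agree by the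
  corresponding identity for little intervals and for permutations.

  Three ingredients are independent of operads: maps of cubes lift along the orbit map, uniquely
  and compatibly with homotopies (\<open>lifts_over_cbox\<close>, \<open>lift_homotopic_rel\<close>); change of base
  point turns concatenation of paths into composition of operations (\<open>change_base_join\<close>); and
  permuting a list by a block permutation permutes its blocks and, separately, the entries of each
  block (\<open>permute_by_symm_comp\<close>).
\<close>

section \<open>Homotopy relative to a subset of a Euclidean domain\<close>

text \<open>
  With \<open>Z = [0,1]\<close> and \<open>A = {0, 1}\<close> this is homotopy of paths, with the unit cube and its boundary
  it is homotopy of spheroids; lifting, translation and composition are treated for both at once.
\<close>

definition homotopic_rel ::
    "'e::euclidean_space set \<Rightarrow> 'e set \<Rightarrow> 'a topology \<Rightarrow> ('e \<Rightarrow> 'a) \<Rightarrow> ('e \<Rightarrow> 'a) \<Rightarrow> bool"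
  where "homotopic_rel Z A X f g \<longleftrightarrow>
    homotopic_with (\<lambda>h. \<forall>s\<in>A. h s = f s) (top_of_set Z) X f g"

lemma homotopic_relI:
  fixes f :: "'e::euclidean_space \<Rightarrow> 'a" and H :: "real \<times> 'e \<Rightarrow> 'a"
  assumes "A \<subseteq> Z" and "continuous_map (top_of_set ({0..1} \<times> Z)) X H"
    and "\<And>s. s \<in> Z \<Longrightarrow> H (0, s) = f s" and "\<And>s. s \<in> Z \<Longrightarrow> H (1, s) = g s"
    and "\<And>t s. t \<in> {0..1} \<Longrightarrow> s \<in> A \<Longrightarrow> H (t, s) = f s"
  shows "homotopic_rel Z A X f g"
proof -
  have "(\<And>x. x \<in> topspace (top_of_set Z) \<Longrightarrow> h x = k x) \<Longrightarrow> (\<forall>s\<in>A. h s = f s) \<longleftrightarrow> (\<forall>s\<in>A. k s = f s)"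
    for h k :: "'e \<Rightarrow> 'a"
    using assms(1) by force
  note * = this
  show ?thesis
    unfolding homotopic_rel_def
    by (subst homotopic_with, rule *, simp)
       (use assms in \<open>auto simp: prod_topology_subtopology_eu intro!: exI[of _ H]\<close>)
qed

lemma homotopic_relE:
  assumes "homotopic_rel Z A X f g"
  obtains H :: "real \<times> 'e::euclidean_space \<Rightarrow> 'a" where "continuous_map (top_of_set ({0..1} \<times> Z)) X H"
    and "\<And>s. H (0, s) = f s" and "\<And>s. H (1, s) = g s"
    and "\<And>t s. t \<in> {0..1} \<Longrightarrow> s \<in> A \<Longrightarrow> H (t, s) = f s"
  using assms that unfolding homotopic_rel_def homotopic_with_def prod_topology_subtopology_eu
  by metis

lemma homotopic_rel_imp_continuous:
  assumes "homotopic_rel Z A X f g"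
  shows "continuous_map (top_of_set Z) X f" "continuous_map (top_of_set Z) X g"
  using homotopic_with_imp_continuous_maps assms unfolding homotopic_rel_def by blast+

lemma homotopic_rel_imp_eq:
  assumes "homotopic_rel Z A X f g" "s \<in> A"
  shows "g s = f s"
  using homotopic_with_imp_property assms unfolding homotopic_rel_def by blast

lemma homotopic_rel_refl: "continuous_map (top_of_set Z) X f \<Longrightarrow> homotopic_rel Z A X f f"
  by (simp add: homotopic_rel_def)

lemma homotopic_rel_sym:
  assumes "homotopic_rel Z A X f g"
  shows "homotopic_rel Z A X g f"
  using assms homotopic_with_symD homotopic_rel_imp_eq[OF assms] unfolding homotopic_rel_def by simp

lemma homotopic_rel_trans [trans]:
  assumes "homotopic_rel Z A X f g" "homotopic_rel Z A X g h"
  shows "homotopic_rel Z A X f h"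
proof -
  have "homotopic_with (\<lambda>k. \<forall>s\<in>A. k s = f s) (top_of_set Z) X g h"
    using assms(2) homotopic_rel_imp_eq[OF assms(1)] by (simp add: homotopic_rel_def)
  with assms(1) show ?thesis unfolding homotopic_rel_def by (rule homotopic_with_trans)
qed

lemma homotopic_rel_eq:
  assumes "A \<subseteq> Z" "continuous_map (top_of_set Z) X f" "\<And>s. s \<in> Z \<Longrightarrow> f s = g s"
  shows "homotopic_rel Z A X f g"
  unfolding homotopic_rel_def by (rule homotopic_with_equal) (use assms in auto)

lemma homotopic_rel_compose:
  assumes "homotopic_rel Z A X f g" "continuous_map X Y \<phi>"
  shows "homotopic_rel Z A Y (\<lambda>s. \<phi> (f s)) (\<lambda>s. \<phi> (g s))"
proof -
  have "homotopic_with (\<lambda>h. \<forall>s\<in>A. h s = \<phi> (f s)) (top_of_set Z) Y (\<phi> \<circ> f) (\<phi> \<circ> g)"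
    by (rule homotopic_with_compose_continuous_map_left[OF assms(1)[unfolded homotopic_rel_def] assms(2)]) simp
  then show ?thesis by (simp add: homotopic_rel_def o_def)
qed

lemma continuous_map_glue_closed:
  fixes S T :: "'e::topological_space set"
  assumes "closed S" "closed T" and f: "continuous_map (top_of_set S) X f"
    and g: "continuous_map (top_of_set T) X g"
    and eq: "\<And>s. s \<in> S \<inter> T \<Longrightarrow> f s = g s" and W: "W = S \<union> T"
  shows "continuous_map (top_of_set W) X (\<lambda>s. if s \<in> S then f s else g s)"
proof -
  let ?f = "\<lambda>s. if s \<in> S then f s else g s"
  have 1: "continuous_map (top_of_set S) X ?f"
    using f by (auto elim: continuous_map_eq)
  have 2: "continuous_map (top_of_set T) X ?f"
    using g by (rule continuous_map_eq) (use eq in auto)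
  show ?thesis
    unfolding continuous_map_closedin
  proof (intro conjI allI impI)
    show "?f \<in> topspace (top_of_set W) \<rightarrow> topspace X" using f g W by (auto simp: continuous_map_def)
    fix C assume C: "closedin X C"
    have "closed {s \<in> S. ?f s \<in> C}"
      using closedin_closed_trans[OF closedin_continuous_map_preimage[OF 1 C]] assms(1) by simp
    moreover have "closed {s \<in> T. ?f s \<in> C}"
      using closedin_closed_trans[OF closedin_continuous_map_preimage[OF 2 C]] assms(2) by simp
    ultimately have "closed ({s \<in> S. ?f s \<in> C} \<union> {s \<in> T. ?f s \<in> C})" by (rule closed_Un)
    moreover have "{s \<in> S. ?f s \<in> C} \<union> {s \<in> T. ?f s \<in> C} = {s \<in> topspace (top_of_set W). ?f s \<in> C}"
      using W by auto
    ultimately show "closedin (top_of_set W) {s \<in> topspace (top_of_set W). ?f s \<in> C}"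
      by (simp add: closed_subset subset_iff)
  qed
qed

definition homotopy_class_rel where
  "homotopy_class_rel Z A X f = {g. homotopic_rel Z A X f g}"

lemma homotopy_class_rel_eqI:
  "homotopic_rel Z A X f g \<Longrightarrow> homotopy_class_rel Z A X f = homotopy_class_rel Z A X g"
  unfolding homotopy_class_rel_def by (blast intro: homotopic_rel_sym homotopic_rel_trans)

lemma homotopy_class_rel_eqD:
  "homotopy_class_rel Z A X f = homotopy_class_rel Z A X g \<Longrightarrow> continuous_map (top_of_set Z) X g \<Longrightarrow> homotopic_rel Z A X f g"
  unfolding homotopy_class_rel_def using homotopic_rel_refl by blast

section \<open>Lifting along the orbit map of a covering action\<close>

locale free_covering =
  fixes G :: "'g monoid" and X :: "'a topology" and \<phi> :: "'g \<Rightarrow> 'a \<Rightarrow> 'a"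
  assumes action: "group_action G (topspace X) (\<lambda>g. restrict (\<phi> g) (topspace X))"
    and continuous_act: "g \<in> carrier G \<Longrightarrow> continuous_map X X (\<phi> g)"
    and covering: "covering_action G X \<phi>"
begin

abbreviation "quot \<equiv> orbit_topology G X \<phi>"
abbreviation "proj \<equiv> orbit G \<phi>"

lemma group: "group G"
  using action group_action.group_hom group_hom.axioms(1) by blast

lemma act_closed: "g \<in> carrier G \<Longrightarrow> x \<in> topspace X \<Longrightarrow> \<phi> g x \<in> topspace X"
  using continuous_act continuous_map_def by (metis PiE)

lemma act_one: "x \<in> topspace X \<Longrightarrow> \<phi> (one G) x = x"
  using group_action.id_eq_one[OF action] by (metis restrict_apply')

lemma act_mult:
  "g \<in> carrier G \<Longrightarrow> h \<in> carrier G \<Longrightarrow> x \<in> topspace X \<Longrightarrow> \<phi> (g \<otimes>\<^bsub>G\<^esub> h) x = \<phi> g (\<phi> h x)"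
  using group_action.composition_rule[OF action, of x g h] act_closed by simp

lemma act_inv:
  assumes "g \<in> carrier G" "x \<in> topspace X"
  shows "\<phi> (inv\<^bsub>G\<^esub> g) (\<phi> g x) = x" "\<phi> g (\<phi> (inv\<^bsub>G\<^esub> g) x) = x"
  using assms act_mult[of "inv\<^bsub>G\<^esub> g" g x] act_mult[of g "inv\<^bsub>G\<^esub> g" x] group act_one
  by (simp_all add: group.l_inv group.r_inv)

lemma act_free:
  assumes "g \<in> carrier G" "h \<in> carrier G" "x \<in> topspace X" "\<phi> g x = \<phi> h x"
  shows "g = h"
proof -
  interpret group G by (rule group)
  let ?k = "inv\<^bsub>G\<^esub> h \<otimes>\<^bsub>G\<^esub> g"
  have k: "?k \<in> carrier G" "\<phi> ?k x = x"
    using assms act_mult[of "inv\<^bsub>G\<^esub> h" g x] act_inv[of h x] by simp_all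
  obtain U where U: "x \<in> U" "\<forall>g\<in>carrier G. g \<noteq> \<one>\<^bsub>G\<^esub> \<longrightarrow> \<phi> g ` U \<inter> U = {}"
    using covering assms(3) unfolding covering_action_def by meson
  have "x \<in> \<phi> ?k ` U \<inter> U" using U(1) k(2) by (metis IntI imageI)
  then have "?k = \<one>\<^bsub>G\<^esub>" using U(2) k(1) by blast
  then show ?thesis using assms(1,2) by (metis inv_equality inv_inv inv_closed)
qed

lemma proj_eq_iff:
  assumes "x \<in> topspace X" "y \<in> topspace X"
  shows "proj x = proj y \<longleftrightarrow> (\<exists>g\<in>carrier G. y = \<phi> g x)"
proof
  assume "proj x = proj y"
  moreover have "y \<in> proj y"
    using act_one[OF assms(2)] group.is_monoid[OF group] by (force simp: orbit_def)
  ultimately show "\<exists>g\<in>carrier G. y = \<phi> g x" by (auto simp: orbit_def)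
next
  interpret group G by (rule group)
  assume "\<exists>g\<in>carrier G. y = \<phi> g x"
  then obtain g where g: "g \<in> carrier G" "y = \<phi> g x" by blast
  have "\<phi> h y \<in> proj x" if "h \<in> carrier G" for h
    using that g assms act_mult[of h g x] unfolding orbit_def by (auto intro!: exI[of _ "h \<otimes>\<^bsub>G\<^esub> g"])
  moreover have "\<phi> h x \<in> proj y" if "h \<in> carrier G" for h
  proof -
    have "\<phi> h x = \<phi> (h \<otimes>\<^bsub>G\<^esub> inv\<^bsub>G\<^esub> g) y"
      using that g assms act_mult[of h "inv\<^bsub>G\<^esub> g" y] act_inv(1)[of g x] by simp
    then show ?thesis using that g unfolding orbit_def by blast
  qed
  ultimately show "proj x = proj y" by (auto simp: orbit_def)
qed

lemma proj_act: "g \<in> carrier G \<Longrightarrow> x \<in> topspace X \<Longrightarrow> proj (\<phi> g x) = proj x"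
  using proj_eq_iff act_closed by metis

lemma continuous_proj: "continuous_map X quot proj"
  by (rule quotient_imp_continuous_map) (rule quotient_map_orbit)

lemma openin_act_image:
  assumes "openin X U" "g \<in> carrier G"
  shows "openin X (\<phi> g ` U)"
proof -
  have U: "U \<subseteq> topspace X" using assms(1) openin_subset by blast
  have "\<phi> g ` U = {x \<in> topspace X. \<phi> (inv\<^bsub>G\<^esub> g) x \<in> U}"
    using U assms(2) act_inv[of g] act_closed[of g] by (force simp: image_iff)
  then show ?thesis
    using continuous_act[of "inv\<^bsub>G\<^esub> g"] assms group
    by (simp add: group.inv_closed openin_continuous_map_preimage)
qed

lemma openin_proj_image:
  assumes "openin X U"
  shows "openin quot (proj ` U)"
proof -
  have U: "U \<subseteq> topspace X" using assms openin_subset by blast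
  have "{x \<in> topspace X. proj x \<in> proj ` U} = (\<Union>g\<in>carrier G. \<phi> g ` U)"
  proof (intro equalityI subsetI)
    fix x assume "x \<in> {x \<in> topspace X. proj x \<in> proj ` U}"
    then obtain y where "x \<in> topspace X" "y \<in> U" "proj y = proj x" by auto
    then show "x \<in> (\<Union>g\<in>carrier G. \<phi> g ` U)" using proj_eq_iff[of y x] U by blast
  next
    fix x assume "x \<in> (\<Union>g\<in>carrier G. \<phi> g ` U)"
    then obtain g y where "g \<in> carrier G" "y \<in> U" "x = \<phi> g y" by blast
    then show "x \<in> {x \<in> topspace X. proj x \<in> proj ` U}" using U act_closed[of g y] proj_act[of g y] by auto
  qed
  moreover have "proj ` U \<subseteq> orbits G (topspace X) \<phi>"
    using U by (auto simp: orbits_def)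
  ultimately show ?thesis
    using openin_act_image[OF assms] by (auto simp: openin_orbit_topology)
qed

text \<open>
  Near any parameter \<open>f\<close> stays in a sheet \<open>U\<close> and \<open>f'\<close> in a translate \<open>gU\<close> of it, so the two agree
  either throughout a neighbourhood or nowhere in it: the set where they agree is open and closed.
\<close>

lemma lift_unique:
  fixes f f' :: "'e::topological_space \<Rightarrow> 'a"
  assumes S: "connected S" "s0 \<in> S" and f: "continuous_map (top_of_set S) X f"
    and f': "continuous_map (top_of_set S) X f'"
    and eq: "\<And>s. s \<in> S \<Longrightarrow> proj (f s) = proj (f' s)" and s0: "f s0 = f' s0" and "s \<in> S"
  shows "f s = f' s"
proof -
  let ?E = "{s \<in> S. f s = f' s}"
  have inX: "f s \<in> topspace X" "f' s \<in> topspace X" if "s \<in> S" for s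
    using f f' that by (auto simp: continuous_map_def)
  have pre: "openin (top_of_set S) {s \<in> S. f s \<in> U \<and> f' s \<in> V}" if "openin X U" "openin X V" for U V
  proof -
    have "openin (top_of_set S) ({s \<in> S. f s \<in> U} \<inter> {s \<in> S. f' s \<in> V})"
      using f f' that by (intro openin_Int) (auto dest: openin_continuous_map_preimage)
    then show ?thesis by (rule back_subst[of "openin _"]) auto
  qed
  have nbhd: "\<exists>T. openin (top_of_set S) T \<and> x \<in> T \<and>
      (\<forall>y\<in>T. f y = f' y \<longleftrightarrow> f x = f' x)" if x: "x \<in> S" for x
  proof -
    obtain U where U: "openin X U" "f x \<in> U"
      and disj: "\<And>g. g \<in> carrier G \<Longrightarrow> g \<noteq> \<one>\<^bsub>G\<^esub> \<Longrightarrow> \<phi> g ` U \<inter> U = {}"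
      using covering inX[OF x] unfolding covering_action_def by meson
    obtain g where g: "g \<in> carrier G" "f' x = \<phi> g (f x)"
      using eq[OF x] inX[OF x] proj_eq_iff by metis
    have dj: "h = g" if h: "h \<in> carrier G" and z: "z \<in> U" and hz: "\<phi> h z \<in> \<phi> g ` U" for h z
    proof -
      interpret group G by (rule group)
      have zX: "z \<in> topspace X" using z U(1) openin_subset by blast
      obtain w where w: "w \<in> U" "\<phi> h z = \<phi> g w" using hz by blast
      have wX: "w \<in> topspace X" using w(1) U(1) openin_subset by blast
      have "\<phi> (inv\<^bsub>G\<^esub> g \<otimes>\<^bsub>G\<^esub> h) z = w"
        using w wX zX h g act_mult[of "inv\<^bsub>G\<^esub> g" h z] act_inv(1)[of g w] by simp
      then have "inv\<^bsub>G\<^esub> g \<otimes>\<^bsub>G\<^esub> h = \<one>\<^bsub>G\<^esub>"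
        using disj[of "inv\<^bsub>G\<^esub> g \<otimes>\<^bsub>G\<^esub> h"] h z g w by blast
      then show ?thesis using h g by (metis inv_equality inv_inv inv_closed)
    qed
    let ?T = "{s \<in> S. f s \<in> U \<and> f' s \<in> \<phi> g ` U}"
    have "f' y = \<phi> g (f y)" if y: "y \<in> ?T" for y
    proof -
      obtain h where "h \<in> carrier G" "f' y = \<phi> h (f y)"
        using y eq[of y] inX[of y] proj_eq_iff[of "f y" "f' y"] by blast
      then show ?thesis using dj[of h "f y"] y by auto
    qed
    moreover have "(\<phi> g z = z) = (g = \<one>\<^bsub>G\<^esub>)" if "z \<in> topspace X" for z
      using act_one[OF that] act_free[OF g(1) _ that, of "\<one>\<^bsub>G\<^esub>"] group.is_monoid[OF group]
      by (metis monoid.one_closed)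
    ultimately have "\<forall>y\<in>?T. f y = f' y \<longleftrightarrow> f x = f' x"
      using g(2) inX x by (metis (mono_tags, lifting) mem_Collect_eq)
    then show ?thesis
      using pre[OF U(1) openin_act_image[OF U(1) g(1)]] x U(2) g(2) by blast
  qed
  have E: "openin (top_of_set S) {s \<in> S. (f s = f' s) = b}" for b
  proof (subst openin_subopen, rule ballI)
    fix x assume x: "x \<in> {s \<in> S. (f s = f' s) = b}"
    then have "x \<in> S" by simp
    from nbhd[OF this] obtain T
      where T: "openin (top_of_set S) T" "x \<in> T" "\<forall>y\<in>T. (f y = f' y) = (f x = f' x)" by blast
    have "y \<in> S \<and> (f y = f' y) = b" if "y \<in> T" for y
      using openin_imp_subset[OF T(1)] T(3) x that by blast
    then have "T \<subseteq> {s \<in> S. (f s = f' s) = b}" by blast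
    with T show "\<exists>T. openin (top_of_set S) T \<and> x \<in> T \<and> T \<subseteq> {s \<in> S. (f s = f' s) = b}" by blast
  qed
  have "openin (top_of_set S) ?E" using E[of True] by simp
  moreover have "S - ?E = {s \<in> S. (f s = f' s) = False}" by auto
  then have "openin (top_of_set S) (S - ?E)" using E[of False] by simp
  then have "closedin (top_of_set S) ?E"
    by (simp add: closedin_def)
  ultimately have "?E = {} \<or> ?E = S"
    using S(1) by (auto simp: connected_clopen)
  then show ?thesis using S(2) s0 \<open>s \<in> S\<close> by auto
qed

definition lifts_over :: "'e::topological_space set \<Rightarrow> ('e \<Rightarrow> 'a set) \<Rightarrow> bool"
  where "lifts_over S g \<longleftrightarrow>
    (\<exists>f. continuous_map (top_of_set S) X f \<and> (\<forall>s\<in>S. proj (f s) = g s))"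

lemma lifts_over_subset: "lifts_over S g \<Longrightarrow> T \<subseteq> S \<Longrightarrow> lifts_over T g"
  unfolding lifts_over_def by (meson continuous_map_from_subtopology_mono subsetD)

lemma lift_through:
  assumes "continuous_map (top_of_set S) X f" "\<forall>s\<in>S. proj (f s) = g s" "s0 \<in> S"
    and "x \<in> topspace X" "proj x = g s0"
  obtains f' where "continuous_map (top_of_set S) X f'" "\<forall>s\<in>S. proj (f' s) = g s" "f' s0 = x"
proof -
  have fX: "f s \<in> topspace X" if "s \<in> S" for s
    using assms(1) that by (auto simp: continuous_map_def)
  obtain h where h: "h \<in> carrier G" "x = \<phi> h (f s0)"
    using assms fX proj_eq_iff by metis
  show ?thesis
  proof
    show "continuous_map (top_of_set S) X (\<lambda>s. \<phi> h (f s))"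
      using continuous_map_compose[OF assms(1) continuous_act[OF h(1)]] by (simp add: o_def)
  qed (use h fX assms proj_act in auto)
qed

text \<open>
  Acting by a group element makes two partial lifts agree at one point of the overlap; uniqueness
  then makes them agree on all of it, since it is connected.
\<close>

lemma lifts_over_Un:
  fixes S T :: "'e::topological_space set"
  assumes "lifts_over S g" "lifts_over T g" "closed S" "closed T"
    and "connected (S \<inter> T)" "S \<inter> T \<noteq> {}"
  shows "lifts_over (S \<union> T) g"
proof -
  obtain f where f: "continuous_map (top_of_set S) X f" "\<forall>s\<in>S. proj (f s) = g s"
    using assms(1) unfolding lifts_over_def by blast
  obtain s0 where s0: "s0 \<in> S" "s0 \<in> T" using assms(6) by blast
  have fX: "f s0 \<in> topspace X" using f s0 by (auto simp: continuous_map_def)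
  obtain f' where f': "continuous_map (top_of_set T) X f'" "\<forall>s\<in>T. proj (f' s) = g s" "f' s0 = f s0"
    using assms(2) lift_through[of T _ g s0 "f s0"] s0 f(2) fX unfolding lifts_over_def by metis
  have eq: "f s = f' s" if "s \<in> S \<inter> T" for s
  proof (rule lift_unique[OF assms(5), of s0])
    show "continuous_map (top_of_set (S \<inter> T)) X f" "continuous_map (top_of_set (S \<inter> T)) X f'"
      using f(1) f'(1) by (auto elim: continuous_map_from_subtopology_mono)
  qed (use s0 f f' that in auto)
  let ?f = "\<lambda>s. if s \<in> S then f s else f' s"
  have "continuous_map (top_of_set (S \<union> T)) X ?f"
    by (rule continuous_map_glue_closed[OF assms(3,4) f(1) f'(1)]) (use eq in auto)
  then show ?thesis
    unfolding lifts_over_def using f(2) f'(2) by (intro exI[of _ ?f]) auto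
qed

text \<open>
  A sheet \<open>U\<close> is mapped injectively and openly to the orbit space, so the inverse of the orbit map
  on the image of \<open>U\<close> is a continuous local section.
\<close>

lemma lifts_over_nhd:
  fixes S :: "'e::topological_space set"
  assumes g: "continuous_map (top_of_set S) quot g" and s: "s \<in> S"
  obtains T where "openin (top_of_set S) T" "s \<in> T" "lifts_over T g"
proof -
  have gX: "g t \<in> orbits G (topspace X) \<phi>" if "t \<in> S" for t
    using g that by (auto simp: continuous_map_def topspace_orbit_topology)
  obtain x where x: "x \<in> topspace X" "proj x = g s" using gX[OF s] by (auto simp: orbits_def)
  obtain U where U: "openin X U" "x \<in> U"
    and disj: "\<And>g. g \<in> carrier G \<Longrightarrow> g \<noteq> \<one>\<^bsub>G\<^esub> \<Longrightarrow> \<phi> g ` U \<inter> U = {}"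
    using covering x(1) unfolding covering_action_def by meson
  have UX: "U \<subseteq> topspace X" using U(1) openin_subset by blast
  have inj: "inj_on proj U"
  proof (rule inj_onI)
    fix y z assume "y \<in> U" "z \<in> U" "proj y = proj z"
    then obtain h where h: "h \<in> carrier G" "z = \<phi> h y" using UX proj_eq_iff[of y z] by blast
    then have "\<phi> h ` U \<inter> U \<noteq> {}" using \<open>y \<in> U\<close> \<open>z \<in> U\<close> by blast
    then have "h = \<one>\<^bsub>G\<^esub>" using disj h(1) by blast
    then show "y = z" using h(2) act_one UX \<open>y \<in> U\<close> by auto
  qed
  let ?T = "{t \<in> S. g t \<in> proj ` U}"
  let ?f = "\<lambda>t. inv_into U proj (g t)"
  have f: "?f t \<in> U" "proj (?f t) = g t" if "t \<in> ?T" for t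
    using that by (auto simp: inv_into_into f_inv_into_f)
  have "continuous_map (top_of_set ?T) X ?f"
    unfolding continuous_map_def
  proof (intro conjI allI impI)
    show "?f \<in> topspace (top_of_set ?T) \<rightarrow> topspace X" using f(1) UX by auto
    fix W assume W: "openin X W"
    have "{t \<in> topspace (top_of_set ?T). ?f t \<in> W} = ?T \<inter> {t \<in> S. g t \<in> proj ` (W \<inter> U)}"
      using f inj UX by (auto simp: inv_into_f_f)
    moreover have "openin (top_of_set S) {t \<in> S. g t \<in> proj ` (W \<inter> U)}"
      using openin_continuous_map_preimage[OF g openin_proj_image[of "W \<inter> U"]] W U(1) by auto
    then obtain O' where "open O'" "{t \<in> S. g t \<in> proj ` (W \<inter> U)} = S \<inter> O'" by (auto simp: openin_open)
    ultimately have "{t \<in> topspace (top_of_set ?T). ?f t \<in> W} = ?T \<inter> O'" by auto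
    with \<open>open O'\<close> show "openin (top_of_set ?T) {t \<in> topspace (top_of_set ?T). ?f t \<in> W}"
      by (simp only: openin_open) blast
  qed
  then have "lifts_over ?T g" unfolding lifts_over_def using f(2) by blast
  moreover have "openin (top_of_set S) ?T"
    using openin_continuous_map_preimage[OF g openin_proj_image[OF U(1)]] by simp
  moreover have "s \<in> ?T" using s x U by auto
  ultimately show ?thesis using that by blast
qed

text \<open>
  Lifts over the two halves of a bisected box glue along the common face.  So having a lift is
  additive under bisection, and it passes from the small boxes of a fine division to the whole box.
\<close>

lemma lifts_over_cbox:
  fixes a b :: "'e::euclidean_space"
  assumes g: "continuous_map (top_of_set (cbox a b)) quot g" and ne: "box a b \<noteq> {}"
  shows "lifts_over (cbox a b) g"
proof -
  \<comment> \<open>An additive property of boxes holds for all flat boxes, so these have to count as lifted.\<close>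
  let ?P = "\<lambda>S. interior S = {} \<or> lifts_over (S \<inter> cbox a b) g"
  interpret operative "HOL.conj" True ?P
  proof (intro operative.intro operative_axioms.intro comm_monoid_set_and)
    fix c d k :: 'e and r assume k: "k \<in> Basis"
    let ?L = "cbox c d \<inter> {x. x \<bullet> k \<le> r}" and ?R = "cbox c d \<inter> {x. r \<le> x \<bullet> k}"
    have Un: "cbox c d = ?L \<union> ?R" by auto
    show "?P (cbox c d) = (?P ?L \<and> ?P ?R)"
    proof
      assume P: "?P (cbox c d)"
      have "?P S" if "S \<subseteq> cbox c d" for S
        using P interior_mono[OF that] lifts_over_subset[of "cbox c d \<inter> cbox a b" g "S \<inter> cbox a b"] that
        by auto
      then show "?P ?L \<and> ?P ?R" by (meson inf_le1)
    next
      assume LR: "?P ?L \<and> ?P ?R"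
      show "?P (cbox c d)"
      proof (cases "box c d = {}")
        case False
        have k0: "k \<noteq> 0" using k nonzero_Basis by blast
        have cd: "c \<bullet> i < d \<bullet> i" if "i \<in> Basis" for i using False that by (auto simp: box_ne_empty)
        have mid: "\<exists>x\<in>box c d. x \<bullet> k = v" if "c \<bullet> k < v" "v < d \<bullet> k" for v
        proof -
          let ?m = "(1/2) *\<^sub>R (c + d)"
          let ?x = "?m + (v - ?m \<bullet> k) *\<^sub>R k"
          have "?x \<bullet> i = (if i = k then v else ?m \<bullet> i)" if "i \<in> Basis" for i
            using that k by (simp add: inner_add_left inner_diff_left inner_Basis)
          then have "?x \<in> box c d" "?x \<bullet> k = v"
            using that cd k by (auto simp: mem_box inner_add_left)
          then show ?thesis by blast
        qed
        have iL: "interior ?L = box c d \<inter> {x. x \<bullet> k < r}"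
          using interior_halfspace_le[OF k0, of r] by (simp add: inner_commute interior_Int)
        have iR: "interior ?R = box c d \<inter> {x. r < x \<bullet> k}"
          using interior_halfspace_ge[OF k0, of r] by (simp add: inner_commute interior_Int)
        consider "r \<le> c \<bullet> k" | "d \<bullet> k \<le> r" | "c \<bullet> k < r" "r < d \<bullet> k" by linarith
        then show ?thesis
        proof cases
          case 1
          then have "?R = cbox c d" using k by (force simp: mem_box)
          then show ?thesis using LR by simp
        next
          case 2
          then have "?L = cbox c d" using k by (force simp: mem_box)
          then show ?thesis using LR by simp
        next
          case 3
          obtain v w where "c \<bullet> k < v" "v < r" "r < w" "w < d \<bullet> k" using 3 dense by metis
          then have "interior ?L \<noteq> {}" "interior ?R \<noteq> {}"
            unfolding iL iR using mid[of v] mid[of w] by fastforce+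
          then have l: "lifts_over (?L \<inter> cbox a b) g" "lifts_over (?R \<inter> cbox a b) g" using LR by blast+
          let ?K = "cbox c d \<inter> cbox a b"
          have K: "?K = (?L \<inter> cbox a b) \<union> (?R \<inter> cbox a b)" by auto
          have I: "(?L \<inter> cbox a b) \<inter> (?R \<inter> cbox a b) = ?K \<inter> {x. k \<bullet> x = r}" by (auto simp: inner_commute)
          have cl: "closed (?L \<inter> cbox a b)" "closed (?R \<inter> cbox a b)"
            using closed_halfspace_le[of k r] closed_halfspace_ge[of r k] by (auto simp: inner_commute intro!: closed_Int)
          have conv: "convex ?K" by (intro convex_Int convex_box)
          show ?thesis
          proof (cases "?L \<inter> cbox a b = {} \<or> ?R \<inter> cbox a b = {}")
            case True
            then have "?K = ?L \<inter> cbox a b \<or> ?K = ?R \<inter> cbox a b" using K by blast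
            then show ?thesis using l by metis
          next
            case False
            then obtain x y where "x \<in> ?K" "y \<in> ?K" "k \<bullet> x \<le> r" "r \<le> k \<bullet> y" by (auto simp: inner_commute)
            then have "?K \<inter> {x. k \<bullet> x = r} \<noteq> {}"
              using connected_ivt_hyperplane[OF convex_connected[OF conv], of x y k r] by blast
            moreover have "connected (?K \<inter> {x. k \<bullet> x = r})"
              by (intro convex_connected convex_Int conv convex_hyperplane)
            ultimately show ?thesis using lifts_over_Un[OF l cl] unfolding I K[symmetric] by simp
          qed
        qed
      qed (auto simp: interior_cbox)
    qed
  qed auto
  have "\<exists>e>0. \<forall>S. S \<subseteq> ball x e \<longrightarrow> lifts_over (S \<inter> cbox a b) g" for x
  proof (cases "x \<in> cbox a b")
    case True
    obtain T where T: "openin (top_of_set (cbox a b)) T" "x \<in> T" "lifts_over T g"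
      using lifts_over_nhd[OF g True] by blast
    then obtain e where e: "e > 0" "ball x e \<inter> cbox a b \<subseteq> T"
      by (meson openin_contains_ball)
    have "lifts_over (S \<inter> cbox a b) g" if "S \<subseteq> ball x e" for S
      by (rule lifts_over_subset[OF T(3)]) (use that e(2) in blast)
    then show ?thesis using e(1) by blast
  next
    case False
    then obtain e where "e > 0" "ball x e \<inter> cbox a b = {}"
      using closed_cbox[of a b] unfolding closed_def open_contains_ball by blast
    moreover have "lifts_over {} g" by (auto simp: lifts_over_def continuous_map_def)
    ultimately show ?thesis by (metis Int_mono lifts_over_subset subset_refl)
  qed
  then obtain e where e: "\<And>x. e x > 0" "\<And>x S. S \<subseteq> ball x (e x) \<Longrightarrow> lifts_over (S \<inter> cbox a b) g"
    by metis
  obtain D where D: "D tagged_division_of cbox a b" "(\<lambda>x. ball x (e x)) fine D"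
    using fine_division_exists[OF gauge_ball_dependent[of e]] e(1) by blast
  have PD: "?P K" if "K \<in> snd ` D" for K
    using that D(2) e(2) by (auto simp: fine_def)
  have "F ?P (snd ` D) = True" by (rule neutral) (use PD in simp)
  moreover have "F ?P (snd ` D) = ?P (cbox a b)"
    by (rule division[OF division_of_tagged_division[OF D(1)]])
  ultimately have "?P (cbox a b)" by simp
  then show ?thesis using ne by (simp add: interior_cbox)
qed

text \<open>
  The lifted homotopy is stationary on \<open>A\<close> because it lifts a constant path over each point of \<open>A\<close>.
  At time \<open>1\<close> it is a lift of the same map as \<open>f'\<close>, and both agree at \<open>s0\<close>.
\<close>

lemma lift_homotopic_rel:
  fixes a b :: "'e::euclidean_space"
  assumes ne: "box a b \<noteq> {}" and f: "continuous_map (top_of_set (cbox a b)) X f"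
    and f': "continuous_map (top_of_set (cbox a b)) X f'"
    and hom: "homotopic_rel (cbox a b) A quot (\<lambda>s. proj (f s)) (\<lambda>s. proj (f' s))"
    and A: "A \<subseteq> cbox a b" "s0 \<in> A" and s0: "f s0 = f' s0"
  shows "homotopic_rel (cbox a b) A X f f'"
proof -
  let ?Z = "cbox a b" and ?W = "{0..1::real} \<times> cbox a b"
  obtain H where H: "continuous_map (top_of_set ?W) quot H"
    "\<And>s. H (0, s) = proj (f s)" "\<And>s. H (1, s) = proj (f' s)"
    "\<And>t s. t \<in> {0..1} \<Longrightarrow> s \<in> A \<Longrightarrow> H (t, s) = proj (f s)"
    using homotopic_relE[OF hom] by blast
  have W: "?W = cbox (0, a) (1, b)" by (simp add: cbox_Pair_eq)
  have "box (0::real, a) (1, b) \<noteq> {}" using ne by (auto simp: box_ne_empty Basis_prod_def)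
  then have "lifts_over ?W H"
    using lifts_over_cbox[of "(0, a)" "(1, b)" H] H(1) unfolding W by blast
  moreover have s0Z: "s0 \<in> ?Z" using A by blast
  moreover have fX: "f s \<in> topspace X" if "s \<in> ?Z" for s
    using f that by (auto simp: continuous_map_def)
  ultimately obtain K where K: "continuous_map (top_of_set ?W) X K"
    "\<forall>s\<in>?W. proj (K s) = H s" "K (0, s0) = f s0"
    using lift_through[of ?W _ H "(0, s0)" "f s0"] H(2) unfolding lifts_over_def by auto
  have Kt: "continuous_map (top_of_set ?Z) X (\<lambda>s. K (t, s))" if "t \<in> {0..1}" for t
  proof -
    have "continuous_map (top_of_set ?Z) (top_of_set ?W) (\<lambda>s. (t, s))"
      using that by (auto intro!: continuous_intros)
    from continuous_map_compose[OF this K(1)] show ?thesis by (simp add: o_def)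
  qed
  have K0: "K (0, s) = f s" if "s \<in> ?Z" for s
    by (rule lift_unique[OF convex_connected[OF convex_box(1)] s0Z Kt f, of 0]) (use that K H s0Z in auto)
  have KA: "K (t, s) = f s" if "t \<in> {0..1}" "s \<in> A" for t s
  proof (rule lift_unique[of "{0..1}" 0 "\<lambda>t. K (t, s)"])
    have "continuous_map (top_of_set {0..1}) (top_of_set ?W) (\<lambda>t. (t, s))"
      using that A by (auto intro!: continuous_intros)
    from continuous_map_compose[OF this K(1)]
    show "continuous_map (top_of_set {0..1}) X (\<lambda>t. K (t, s))" by (simp add: o_def)
  qed (use that A K0 K(2) H(4) fX in auto)
  have K1: "K (1, s) = f' s" if "s \<in> ?Z" for s
    by (rule lift_unique[OF convex_connected[OF convex_box(1)] s0Z Kt f', of 1])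
       (use that K H s0Z KA[of 1 s0] A s0 in auto)
  show ?thesis
    by (rule homotopic_relI[OF A(1) K(1)]) (use K0 K1 KA in auto)
qed

lemma lift_map_cbox:
  fixes a b :: "'e::euclidean_space"
  assumes "continuous_map (top_of_set (cbox a b)) quot g" "box a b \<noteq> {}"
    and "s0 \<in> cbox a b" "x \<in> topspace X" "proj x = g s0"
  obtains f where "continuous_map (top_of_set (cbox a b)) X f"
    "\<forall>s\<in>cbox a b. proj (f s) = g s" "f s0 = x"
  using lifts_over_cbox[OF assms(1,2)] lift_through[of "cbox a b" _ g s0 x] assms(3-5)
  unfolding lifts_over_def by metis

end

section \<open>Concatenation of paths\<close>

text \<open>
  The parameters \<open>p\<close> and \<open>q\<close> are joined by the straight-line homotopy inside \<open>K\<close>.  Associativity,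
  units and inverses for concatenation are reparametrizations of this kind.
\<close>

lemma homotopic_rel_convex:
  fixes p q :: "'e::euclidean_space \<Rightarrow> 'f::real_normed_vector"
  assumes K: "convex K" and F: "continuous_map (top_of_set K) X F"
    and p: "continuous_on Z p" "p ` Z \<subseteq> K" and q: "continuous_on Z q" "q ` Z \<subseteq> K"
    and A: "A \<subseteq> Z" "\<And>s. s \<in> A \<Longrightarrow> p s = q s"
  shows "homotopic_rel Z A X (\<lambda>s. F (p s)) (\<lambda>s. F (q s))"
proof -
  let ?h = "\<lambda>x. (1 - fst x) *\<^sub>R p (snd x) + fst x *\<^sub>R q (snd x)"
  have "continuous_on ({0..1} \<times> Z) ?h"
    using p(1) q(1) by (auto intro!: continuous_intros elim: continuous_on_compose2)
  moreover have "?h ` ({0..1} \<times> Z) \<subseteq> K"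
    using p(2) q(2) K by (auto simp: convex_alt image_subset_iff)
  ultimately have "continuous_map (top_of_set ({0..1} \<times> Z)) (top_of_set K) ?h"
    by (auto simp: image_subset_iff_funcset)
  from continuous_map_compose[OF this F]
  have "continuous_map (top_of_set ({0..1} \<times> Z)) X (\<lambda>x. F (?h x))" by (simp add: o_def)
  then show ?thesis
    by (rule homotopic_relI[OF A(1)]) (use A(2) in \<open>auto simp flip: scaleR_left_distrib\<close>)
qed

abbreviation path_homotopic :: "'a topology \<Rightarrow> (real \<Rightarrow> 'a) \<Rightarrow> (real \<Rightarrow> 'a) \<Rightarrow> bool"
  where "path_homotopic \<equiv> homotopic_rel {0..1} {0, 1}"

lemma continuous_map_compose_on:
  assumes "continuous_map (top_of_set K) X F" "continuous_on S p" "p ` S \<subseteq> K"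
  shows "continuous_map (top_of_set S) X (\<lambda>s. F (p s))"
proof -
  have "continuous_map (top_of_set S) (top_of_set K) p" using assms by (auto simp: image_subset_iff_funcset)
  from continuous_map_compose[OF this assms(1)] show ?thesis by (simp add: o_def)
qed

lemma path_join_homotopic:
  assumes f: "path_homotopic X f f'" and g: "path_homotopic X g g'" and fg: "f 1 = g 0"
  shows "path_homotopic X (path_join f g) (path_join f' g')"
proof -
  obtain F where F: "continuous_map (top_of_set ({0..1::real} \<times> {0..1::real})) X F"
    "\<And>s. F (0, s) = f s" "\<And>s. F (1, s) = f' s" "\<And>t s. t \<in> {0..1} \<Longrightarrow> s \<in> {0, 1} \<Longrightarrow> F (t, s) = f s"
    using homotopic_relE[OF f] by blast
  obtain G where G: "continuous_map (top_of_set ({0..1::real} \<times> {0..1::real})) X G"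
    "\<And>s. G (0, s) = g s" "\<And>s. G (1, s) = g' s" "\<And>t s. t \<in> {0..1} \<Longrightarrow> s \<in> {0, 1} \<Longrightarrow> G (t, s) = g s"
    using homotopic_relE[OF g] by blast
  let ?S = "{0..1::real} \<times> {0..1/2::real}" and ?T = "{0..1::real} \<times> {1/2..1::real}"
  let ?H = "\<lambda>x. if x \<in> ?S then F (fst x, 2 * snd x) else G (fst x, 2 * snd x - 1)"
  have "continuous_map (top_of_set ({0..1} \<times> {0..1})) X ?H"
  proof (rule continuous_map_glue_closed[where T = ?T])
    show "continuous_map (top_of_set ?S) X (\<lambda>x. F (fst x, 2 * snd x))"
      by (rule continuous_map_compose_on[OF F(1)]) (auto intro!: continuous_intros)
    show "continuous_map (top_of_set ?T) X (\<lambda>x. G (fst x, 2 * snd x - 1))"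
      by (rule continuous_map_compose_on[OF G(1)]) (auto intro!: continuous_intros)
    show "F (fst s, 2 * snd s) = G (fst s, 2 * snd s - 1)" if sT: "s \<in> ?S \<inter> ?T" for s
    proof -
      obtain t where "s = (t, 1/2)" "t \<in> {0..1}" using sT by (cases s) auto
      then show ?thesis using F(4)[of t 1] G(4)[of t 0] fg by simp
    qed
  qed (auto simp: closed_Times)
  then show ?thesis
  proof (rule homotopic_relI[rotated])
    show "?H (t, s) = path_join f g s" if "t \<in> {0..1}" "s \<in> {0, 1}" for t s
      using that F(4)[of t 0] G(4)[of t 1] by (auto simp: path_join_def)
  qed (auto simp: path_join_def F G)
qed

lemma pathin_path_join:
  assumes "pathin X f" "pathin X g" "f 1 = g 0"
  shows "pathin X (path_join f g)"
  using path_join_homotopic[OF homotopic_rel_refl homotopic_rel_refl] assms homotopic_rel_imp_continuous(1)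
  unfolding pathin_def by metis

lemma path_join_0 [simp]: "path_join f g 0 = f 0"
  and path_join_1 [simp]: "path_join f g 1 = g 1"
  by (simp_all add: path_join_def)

lemma path_rev_0 [simp]: "path_rev f 0 = f 1"
  and path_rev_1 [simp]: "path_rev f 1 = f 0"
  by (simp_all add: path_rev_def)

lemma path_rev_rev [simp]: "path_rev (path_rev f) = f"
  by (simp add: path_rev_def)

lemma pathin_path_rev:
  assumes "pathin X f" shows "pathin X (path_rev f)"
  unfolding pathin_def path_rev_def
  by (rule continuous_map_compose_on[OF assms[unfolded pathin_def]]) (auto intro!: continuous_intros)

lemma path_homotopic_convex:
  fixes p q :: "real \<Rightarrow> real"
  assumes F: "continuous_map (top_of_set {c..d}) X F"
    and "continuous_on {0..1} p" "p ` {0..1} \<subseteq> {c..d}" "continuous_on {0..1} q" "q ` {0..1} \<subseteq> {c..d}"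
    and "p 0 = q 0" "p 1 = q 1" and "\<And>s. s \<in> {0..1} \<Longrightarrow> f s = F (p s)" "\<And>s. s \<in> {0..1} \<Longrightarrow> g s = F (q s)"
  shows "path_homotopic X f g"
proof -
  have "path_homotopic X (\<lambda>s. F (p s)) (\<lambda>s. F (q s))"
    by (rule homotopic_rel_convex[OF _ F]) (use assms in auto)
  moreover have "path_homotopic X (\<lambda>s. F (p s)) f" "path_homotopic X (\<lambda>s. F (q s)) g"
    using continuous_map_compose_on[OF F] assms by (auto intro!: homotopic_rel_eq)
  ultimately show ?thesis using homotopic_rel_trans homotopic_rel_sym by blast
qed

text \<open>
  Both sides run through the path on \<open>[0,3]\<close> that consists of \<open>f\<close>, \<open>g\<close> and \<open>h\<close>.
\<close>

lemma path_join_assoc: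
  assumes "pathin X f" "pathin X g" "pathin X h" "f 1 = g 0" "g 1 = h 0"
  shows "path_homotopic X (path_join (path_join f g) h) (path_join f (path_join g h))"
proof -
  let ?F = "\<lambda>x. if x \<in> {0..1} then f x else (\<lambda>x. if x \<in> {1..2} then g (x - 1) else h (x - 2)) x"
  have "continuous_map (top_of_set {1..3}) X (\<lambda>x. if x \<in> {1..2} then g (x - 1) else h (x - 2))"
  proof (rule continuous_map_glue_closed[where T = "{2..3}"])
    show "continuous_map (top_of_set {1..2}) X (\<lambda>x. g (x - 1))"
      by (rule continuous_map_compose_on[OF assms(2)[unfolded pathin_def]]) (auto intro!: continuous_intros)
    show "continuous_map (top_of_set {2..3}) X (\<lambda>x. h (x - 2))"
      by (rule continuous_map_compose_on[OF assms(3)[unfolded pathin_def]]) (auto intro!: continuous_intros)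
  qed (use assms in auto)
  then have F: "continuous_map (top_of_set {0..3}) X ?F"
  proof (rule continuous_map_glue_closed[where T = "{1..3}", rotated 3])
    show "continuous_map (top_of_set {0..1}) X f" using assms(1) by (simp add: pathin_def)
  qed (use assms in auto)
  show ?thesis
  proof (rule path_homotopic_convex[OF F])
    show "continuous_on {0..1} (\<lambda>s::real. min (4 * s) (2 * s + 1))"
      and "continuous_on {0..1} (\<lambda>s::real. max (2 * s) (4 * s - 1))" by (intro continuous_intros)+
    fix s :: real assume s: "s \<in> {0..1}"
    consider "s < 1/4" | "s = 1/4" | "1/4 < s" "s < 1/2" | "s = 1/2" | "1/2 < s" by linarith
    then show "path_join (path_join f g) h s = ?F (min (4 * s) (2 * s + 1))"
      by cases (use s assms(4,5) in \<open>auto simp: path_join_def min_def simp del: eq_divide_eq_numeral1\<close>)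
    consider "s < 1/2" | "s = 1/2" | "1/2 < s" "s < 3/4" | "s = 3/4" | "3/4 < s" by linarith
    then show "path_join f (path_join g h) s = ?F (max (2 * s) (4 * s - 1))"
      by cases (use s assms(4,5) in \<open>auto simp: path_join_def max_def simp del: eq_divide_eq_numeral1\<close>)
  qed auto
qed

lemma path_join_const_left:
  assumes "pathin X f" "f 0 = x"
  shows "path_homotopic X (path_join (\<lambda>_. x) f) f"
proof (rule path_homotopic_convex[OF assms(1)[unfolded pathin_def]])
  show "continuous_on {0..1} (\<lambda>s::real. max 0 (2 * s - 1))" by (intro continuous_intros)
  show "path_join (\<lambda>_. x) f s = f (max 0 (2 * s - 1))" for s
    using assms(2) by (cases "s = 1/2") (auto simp: path_join_def max_def simp del: eq_divide_eq_numeral1)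
qed auto

lemma path_join_const_right:
  assumes "pathin X f" "f 1 = x"
  shows "path_homotopic X (path_join f (\<lambda>_. x)) f"
proof (rule path_homotopic_convex[OF assms(1)[unfolded pathin_def]])
  show "continuous_on {0..1} (\<lambda>s::real. min 1 (2 * s))" by (intro continuous_intros)
  show "path_join f (\<lambda>_. x) s = f (min 1 (2 * s))" for s
    using assms(2) by (cases "s = 1/2") (auto simp: path_join_def min_def simp del: eq_divide_eq_numeral1)
qed auto

lemma path_join_rev_right:
  assumes "pathin X f"
  shows "path_homotopic X (path_join f (path_rev f)) (\<lambda>_. f 0)"
proof (rule path_homotopic_convex[OF assms[unfolded pathin_def]])
  show "continuous_on {0..1} (\<lambda>s::real. min (2 * s) (2 - 2 * s))" by (intro continuous_intros)
  show "path_join f (path_rev f) s = f (min (2 * s) (2 - 2 * s))" for s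
    by (auto simp: path_join_def path_rev_def min_def algebra_simps)
qed auto

lemma path_join_rev_left:
  assumes "pathin X f"
  shows "path_homotopic X (path_join (path_rev f) f) (\<lambda>_. f 1)"
  using path_join_rev_right[OF pathin_path_rev[OF assms]] by simp

lemma path_homotopic_refl: "pathin X f \<Longrightarrow> path_homotopic X f f"
  by (simp add: pathin_def homotopic_rel_refl)

lemma path_join_homotopic_left:
  "path_homotopic X f f' \<Longrightarrow> pathin X g \<Longrightarrow> f 1 = g 0 \<Longrightarrow> path_homotopic X (path_join f g) (path_join f' g)"
  by (simp add: path_join_homotopic path_homotopic_refl)

lemma path_join_homotopic_right:
  "path_homotopic X g g' \<Longrightarrow> pathin X f \<Longrightarrow> f 1 = g 0 \<Longrightarrow> path_homotopic X (path_join f g) (path_join f g')"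
  by (simp add: path_join_homotopic path_homotopic_refl)

lemma path_cancel:
  assumes "pathin X f" "pathin X b" "pathin X b'" "pathin X h"
    and "f 1 = b 0" "b 1 = b' 0" "b' 1 = h 0" and bb: "path_homotopic X (path_join b b') (\<lambda>_. b 0)"
  shows "path_homotopic X (path_join (path_join f b) (path_join b' h)) (path_join f h)"
proof -
  have h0: "h 0 = b 0" using homotopic_rel_imp_eq[OF bb, of 1] assms by simp
  have "path_homotopic X (path_join (path_join f b) (path_join b' h)) (path_join f (path_join b (path_join b' h)))"
    by (rule path_join_assoc) (use assms in \<open>simp_all add: pathin_path_join\<close>)
  also have "path_homotopic X \<dots> (path_join f (path_join (path_join b b') h))"
    by (rule path_join_homotopic_right, rule homotopic_rel_sym, rule path_join_assoc)
       (use assms in \<open>simp_all add: pathin_path_join\<close>)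
  also have "path_homotopic X \<dots> (path_join f (path_join (\<lambda>_. b 0) h))"
    by (rule path_join_homotopic_right, rule path_join_homotopic_left[OF bb])
       (use assms in \<open>simp_all add: pathin_path_join\<close>)
  also have "path_homotopic X \<dots> (path_join f h)"
    by (rule path_join_homotopic_right, rule path_join_const_left) (use assms h0 in simp_all)
  finally show ?thesis .
qed

lemma path_cancel_middle:
  assumes "pathin X a" "pathin X f" "pathin X b" "pathin X b'" "pathin X g" "pathin X d"
    and "a 1 = f 0" "f 1 = b 0" "b 1 = b' 0" "b' 1 = g 0" "g 1 = d 0"
    and bb: "path_homotopic X (path_join b b') (\<lambda>_. b 0)"
  shows "path_homotopic X (path_join (path_join a (path_join f b)) (path_join b' (path_join g d)))
    (path_join a (path_join (path_join f g) d))"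
proof -
  have g0: "g 0 = b 0" using homotopic_rel_imp_eq[OF bb, of 1] assms by simp
  have "path_homotopic X (path_join (path_join a (path_join f b)) (path_join b' (path_join g d)))
    (path_join a (path_join (path_join f b) (path_join b' (path_join g d))))"
    by (rule path_join_assoc) (use assms in \<open>simp_all add: pathin_path_join\<close>)
  also have "path_homotopic X \<dots> (path_join a (path_join f (path_join g d)))"
    by (rule path_join_homotopic_right, rule path_cancel) (use assms in \<open>simp_all add: pathin_path_join\<close>)
  also have "path_homotopic X \<dots> (path_join a (path_join (path_join f g) d))"
    by (rule path_join_homotopic_right, rule homotopic_rel_sym, rule path_join_assoc)
       (use assms g0 in \<open>simp_all add: pathin_path_join\<close>)
  finally show ?thesis .
qed

lemma path_cancel_right:
  assumes "pathin X a" "pathin X f" "pathin X b" "pathin X b'"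
    and "a 1 = f 0" "f 1 = b 0" "b 1 = b' 0"
    and bb: "path_homotopic X (path_join b b') (\<lambda>_. b 0)"
  shows "path_homotopic X (path_join (path_join a (path_join f b)) b') (path_join a f)"
proof -
  have "path_homotopic X (path_join (path_join a (path_join f b)) b') (path_join a (path_join (path_join f b) b'))"
    by (rule path_join_assoc) (use assms in \<open>simp_all add: pathin_path_join\<close>)
  also have "path_homotopic X \<dots> (path_join a (path_join f (path_join b b')))"
    by (rule path_join_homotopic_right, rule path_join_assoc) (use assms in \<open>simp_all add: pathin_path_join\<close>)
  also have "path_homotopic X \<dots> (path_join a (path_join f (\<lambda>_. b 0)))"
    by (rule path_join_homotopic_right, rule path_join_homotopic_right[OF bb])
       (use assms in \<open>simp_all add: pathin_path_join\<close>)
  also have "path_homotopic X \<dots> (path_join a f)"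
    by (rule path_join_homotopic_right, rule path_join_const_right) (use assms in simp_all)
  finally show ?thesis .
qed

lemma path_regroup:
  assumes "pathin X p" "pathin X a" "pathin X m" "pathin X b" "pathin X d"
    and "p 1 = a 0" "a 1 = m 0" "m 1 = b 0" "b 1 = d 0"
  shows "path_homotopic X (path_join p (path_join (path_join a (path_join m b)) d))
    (path_join (path_join p a) (path_join m (path_join b d)))"
proof -
  have "path_homotopic X (path_join p (path_join (path_join a (path_join m b)) d))
    (path_join p (path_join a (path_join (path_join m b) d)))"
    by (rule path_join_homotopic_right, rule path_join_assoc) (use assms in \<open>simp_all add: pathin_path_join\<close>)
  also have "path_homotopic X \<dots> (path_join p (path_join a (path_join m (path_join b d))))"
    by (rule path_join_homotopic_right, rule path_join_homotopic_right, rule path_join_assoc)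
       (use assms in \<open>simp_all add: pathin_path_join\<close>)
  also have "path_homotopic X \<dots> (path_join (path_join p a) (path_join m (path_join b d)))"
    by (rule homotopic_rel_sym, rule path_join_assoc) (use assms in \<open>simp_all add: pathin_path_join\<close>)
  finally show ?thesis .
qed

lemma path_class_eq: "path_class X f = homotopy_class_rel {0..1} {0, 1} X f"
  by (simp add: path_class_def homotopy_class_rel_def homotopic_rel_def)

section \<open>Change of base point for spheroids\<close>

abbreviation cube :: "(real ^ 'l) set" where "cube \<equiv> cbox 0 1"
abbreviation cube_boundary :: "(real ^ 'l) set" where "cube_boundary \<equiv> cbox 0 1 - box 0 1"
abbreviation radius :: "real ^ 'l \<Rightarrow> real" where "radius s \<equiv> infnorm (2 *\<^sub>R s - 1)"

abbreviation cube_homotopic ::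
    "'a topology \<Rightarrow> (real ^ 'l \<Rightarrow> 'a) \<Rightarrow> (real ^ 'l \<Rightarrow> 'a) \<Rightarrow> bool"
  where "cube_homotopic \<equiv> homotopic_rel cube cube_boundary"

lemma one_inner_Basis: "i \<in> Basis \<Longrightarrow> (1 :: real ^ 'l) \<bullet> i = 1"
  by (auto simp: Basis_vec_def inner_axis)

lemma mem_cube_iff: "s \<in> cube \<longleftrightarrow> radius s \<le> 1"
  and mem_box_iff: "s \<in> box (0 :: real ^ 'l) 1 \<longleftrightarrow> radius s < 1"
proof -
  have *: "infnorm (2 *\<^sub>R s - 1) = Max ((\<lambda>i. \<bar>(2 *\<^sub>R s - 1) \<bullet> i\<bar>) ` Basis)" by (rule infnorm_Max)
  show "s \<in> cube \<longleftrightarrow> radius s \<le> 1"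
    unfolding * by (subst Max_le_iff) (auto simp: mem_box inner_diff_left one_inner_Basis abs_le_iff)
  show "s \<in> box (0 :: real ^ 'l) 1 \<longleftrightarrow> radius s < 1"
    unfolding * by (subst Max_less_iff) (auto simp: mem_box inner_diff_left one_inner_Basis abs_less_iff)
qed

lemma mem_cube_boundary_iff: "s \<in> cube_boundary \<longleftrightarrow> radius s = 1"
  using mem_cube_iff[of s] mem_box_iff[of s] by auto

lemma spheroid_iff:
  "spheroid X x f \<longleftrightarrow> continuous_map (top_of_set cube) X f \<and> (\<forall>s\<in>cube_boundary. f s = x)"
  by (simp add: spheroid_def)

lemma radius_scaled: "0 < a \<Longrightarrow> radius ((1/2) *\<^sub>R ((1/a) *\<^sub>R (2 *\<^sub>R s - 1) + 1)) = radius s / a"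
  by (simp add: infnorm_mul)

text \<open>
  The common form of all homotopies between changes of base point: at time \<open>t\<close> the concentric cube
  of radius \<open>a t\<close> carries a rescaled copy of \<open>F (t, _)\<close>, and the shell around it is mapped radially
  by \<open>W (t, _)\<close>.  Continuity and behaviour on the boundary are checked here once.
\<close>

lemma change_base_homotopy:
  fixes F :: "real \<times> (real ^ 'l) \<Rightarrow> 'a" and W :: "real \<times> real \<Rightarrow> 'a"
  defines "G \<equiv> \<lambda>a t s. if radius s \<le> a t
    then F (t, (1/2) *\<^sub>R ((1 / a t) *\<^sub>R (2 *\<^sub>R s - 1) + 1)) else W (t, radius s)"
  assumes a: "continuous_on {0..1} a" "\<And>t. t \<in> {0..1} \<Longrightarrow> 0 < a t \<and> a t \<le> 1"
    and F: "continuous_map (top_of_set ({0..1} \<times> cube)) X F"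
    and W: "continuous_map (top_of_set {(t, r). t \<in> {0..1} \<and> a t \<le> r \<and> r \<le> 1}) X W"
    and FW: "\<And>t s. t \<in> {0..1} \<Longrightarrow> s \<in> cube_boundary \<Longrightarrow> F (t, s) = W (t, a t)"
    and W1: "\<And>t. t \<in> {0..1} \<Longrightarrow> W (t, 1) = x"
  shows "cube_homotopic X (G a 0) (G a 1)"
proof -
  let ?D = "{0..1::real} \<times> (cube :: (real ^ 'l) set)"
  have rc: "continuous_on UNIV (\<lambda>s :: real ^ 'l. radius s)"
    by (intro continuous_intros)
  have clD: "closed ?D" by (intro closed_Times) auto
  have ac: "continuous_on ?D (\<lambda>x. a (fst x))"
    by (rule continuous_on_compose2[OF a(1)]) (auto intro!: continuous_intros)
  have rcD: "continuous_on ?D (\<lambda>x. radius (snd x))" by (intro continuous_intros)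
  let ?S = "{x \<in> ?D. radius (snd x) \<le> a (fst x)}" and ?T = "{x \<in> ?D. a (fst x) \<le> radius (snd x)}"
  have S: "closed ?S" and T: "closed ?T"
    using continuous_closed_preimage[OF continuous_on_diff[OF ac rcD] clD, of "{0..}"]
      continuous_closed_preimage[OF continuous_on_diff[OF rcD ac] clD, of "{0..}"]
    by (auto simp: vimage_def Collect_conj_eq[symmetric] Int_def)
  let ?c = "\<lambda>x. (1/2) *\<^sub>R ((1 / a (fst x)) *\<^sub>R (2 *\<^sub>R snd x - 1) + 1) :: real ^ 'l"
  let ?H = "\<lambda>x. if x \<in> ?S then F (fst x, ?c x) else W (fst x, radius (snd x))"
  have c: "(fst x, ?c x) \<in> ?D" if x: "x \<in> ?S" for x
  proof -
    have "0 < a (fst x)" "radius (snd x) \<le> a (fst x)" using a(2)[of "fst x"] x by auto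
    then have "?c x \<in> cube" using radius_scaled[of "a (fst x)" "snd x"] unfolding mem_cube_iff by simp
    then show ?thesis using x by auto
  qed
  have H: "continuous_map (top_of_set ?D) X ?H"
  proof (rule continuous_map_glue_closed[OF S T])
    show "continuous_map (top_of_set ?S) X (\<lambda>x. F (fst x, ?c x))"
    proof (rule continuous_map_compose_on[OF F])
      have "continuous_on ?S (\<lambda>x. a (fst x))" by (rule continuous_on_subset[OF ac]) auto
      moreover have "a (fst x) \<noteq> 0" if "x \<in> ?S" for x using a(2)[of "fst x"] that by auto
      ultimately show "continuous_on ?S (\<lambda>x. (fst x, ?c x))" by (intro continuous_intros) auto
      show "(\<lambda>x. (fst x, ?c x)) ` ?S \<subseteq> ?D"
        using c by blast
    qed
    show "continuous_map (top_of_set ?T) X (\<lambda>x. W (fst x, radius (snd x)))"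
      by (rule continuous_map_compose_on[OF W]) (auto simp: mem_cube_iff intro!: continuous_intros)
    fix x :: "real \<times> (real ^ 'l)" assume x: "x \<in> ?S \<inter> ?T"
    then have r: "radius (snd x) = a (fst x)" "fst x \<in> {0..1}" by auto
    then have "0 < a (fst x)" using a(2) by simp
    then have "radius (?c x) = 1" using radius_scaled[of "a (fst x)" "snd x"] r by simp
    then show "F (fst x, ?c x) = W (fst x, radius (snd x))"
      using FW[OF r(2)] r(1) mem_cube_boundary_iff by metis
  qed auto
  have G: "?H (t, s) = G a t s" if "t \<in> {0..1}" "s \<in> cube" for t s
    using that unfolding G_def by auto
  have bd: "G a t s = x" if "t \<in> {0..1}" "s \<in> cube_boundary" for t s
  proof -
    have r: "radius s = 1" using that mem_cube_boundary_iff by blast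
    show ?thesis
    proof (cases "a t = 1")
      case True
      then have "(1/2) *\<^sub>R ((1 / a t) *\<^sub>R (2 *\<^sub>R s - 1) + 1) = s" by (simp add: algebra_simps)
      then show ?thesis using FW[OF that] W1[OF that(1)] True r unfolding G_def by simp
    next
      case False
      then show ?thesis using a(2)[OF that(1)] W1[OF that(1)] r unfolding G_def by simp
    qed
  qed
  show ?thesis
  proof (rule homotopic_relI[OF _ H])
    show "?H (t, s) = G a 0 s" if "t \<in> {0..1}" "s \<in> cube_boundary" for t s
      using G[of t s] that bd[of t s] bd[of 0 s] by auto
  qed (use G in auto)
qed

lemma change_base_eq:
  fixes f :: "real ^ 'l \<Rightarrow> 'a"
  shows "change_base u f s = (if radius s \<le> 1/2 then f ((1/2) *\<^sub>R ((1 / (1/2)) *\<^sub>R (2 *\<^sub>R s - 1) + 1)) else u (2 * (1 - radius s)))"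
proof -
  have "(1/2) *\<^sub>R ((1 / (1/2)) *\<^sub>R (2 *\<^sub>R s - 1) + 1) = 2 *\<^sub>R s - (1/2) *\<^sub>R (1::real ^ 'l)"
    by (simp add: vec_eq_iff)
  then show ?thesis by (simp only: change_base_def Let_def)
qed

lemma change_base_homotopic:
  assumes u: "path_homotopic X u u'" and f: "cube_homotopic X f f'"
    and bd: "\<And>s. s \<in> cube_boundary \<Longrightarrow> f s = u 1"
  shows "cube_homotopic X (change_base u f) (change_base u' f')"
proof -
  obtain F where F: "continuous_map (top_of_set ({0..1::real} \<times> cube)) X F"
    "\<And>s. F (0, s) = f s" "\<And>s. F (1, s) = f' s" "\<And>t s. t \<in> {0..1} \<Longrightarrow> s \<in> cube_boundary \<Longrightarrow> F (t, s) = f s"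
    using homotopic_relE[OF f] by blast
  obtain U where U: "continuous_map (top_of_set ({0..1::real} \<times> {0..1::real})) X U"
    "\<And>s. U (0, s) = u s" "\<And>s. U (1, s) = u' s" "\<And>t s. t \<in> {0..1} \<Longrightarrow> s \<in> {0, 1} \<Longrightarrow> U (t, s) = u s"
    using homotopic_relE[OF u] by blast
  let ?W = "\<lambda>x. U (fst x, 2 * (1 - snd x))"
  have W: "continuous_map (top_of_set {(t, r). t \<in> {0..1} \<and> (1/2::real) \<le> r \<and> r \<le> 1}) X ?W"
    by (rule continuous_map_compose_on[OF U(1)]) (auto intro!: continuous_intros)
  show ?thesis
    using change_base_homotopy[of "\<lambda>_. 1/2", OF _ _ F(1) W, where x = "u 0"] F U bd
    unfolding change_base_eq[abs_def] by (simp cong: if_cong)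
qed

lemma spheroid_change_base:
  assumes "pathin X u" "spheroid X (u 1) f"
  shows "spheroid X (u 0) (change_base u f)"
proof -
  have "cube_homotopic X (change_base u f) (change_base u f)"
    by (rule change_base_homotopic) (use assms in \<open>auto simp: spheroid_iff pathin_def intro: homotopic_rel_refl\<close>)
  moreover have "change_base u f s = u 0" if "s \<in> cube_boundary" for s
    using that[unfolded mem_cube_boundary_iff] by (simp add: change_base_eq)
  ultimately show ?thesis
    using homotopic_rel_imp_continuous(1) unfolding spheroid_iff by blast
qed

text \<open>
  The inner copy of \<open>f\<close> grows from radius \<open>1/2\<close> until it fills the cube.
\<close>

lemma change_base_const:
  fixes f :: "real ^ 'l \<Rightarrow> 'a"
  assumes "spheroid X x f"
  shows "cube_homotopic X (change_base (\<lambda>_. x) f) f"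
proof -
  let ?a = "\<lambda>t::real. 1/2 + t/2"
  have f: "continuous_map (top_of_set cube) X f" using assms by (simp add: spheroid_iff)
  have xX: "x \<in> topspace X"
  proof -
    have "1 \<in> (cube_boundary :: (real ^ 'l) set)"
      using nonempty_Basis by (auto simp: mem_box one_inner_Basis)
    then have "f 1 = x" "f 1 \<in> topspace X" using assms f unfolding spheroid_iff continuous_map_def by auto
    then show ?thesis by simp
  qed
  have F: "continuous_map (top_of_set ({0..1::real} \<times> cube)) X (\<lambda>x. f (snd x))"
    by (rule continuous_map_compose_on[OF f]) (auto intro!: continuous_intros)
  have W: "continuous_map (top_of_set {(t, r). t \<in> {0..1} \<and> ?a t \<le> r \<and> r \<le> 1}) X (\<lambda>_. x)"
    using xX by simp
  have *: "cube_homotopic X (\<lambda>s. if radius s \<le> ?a 0 then f (snd (0::real, (1/2) *\<^sub>R ((1 / ?a 0) *\<^sub>R (2 *\<^sub>R s - 1) + 1))) else x)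
     (\<lambda>s. if radius s \<le> ?a 1 then f (snd (1::real, (1/2) *\<^sub>R ((1 / ?a 1) *\<^sub>R (2 *\<^sub>R s - 1) + 1))) else x)"
    by (rule change_base_homotopy[OF _ _ F W]) (use assms in \<open>auto simp: spheroid_iff intro!: continuous_intros\<close>)
  moreover have "(1/2) *\<^sub>R ((1 / ?a 1) *\<^sub>R (2 *\<^sub>R s - 1) + 1) = s" for s :: "real ^ 'l"
    by (simp add: algebra_simps)
  ultimately have "cube_homotopic X (change_base (\<lambda>_. x) f) (\<lambda>s. if radius s \<le> 1 then f s else x)"
    unfolding change_base_eq[abs_def] by (simp cong: if_cong)
  moreover have "cube_homotopic X (\<lambda>s. if radius s \<le> 1 then f s else x) f"
    by (rule homotopic_rel_sym, rule homotopic_rel_eq[OF _ f]) (auto simp: mem_cube_iff)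
  ultimately show ?thesis by (rule homotopic_rel_trans)
qed

text \<open>
  Both sides are a concentric copy of \<open>f\<close> with radial tails running through \<open>v\<close> and \<open>u\<close>.  They differ
  in the radius of the copy, \<open>1/4\<close> on the left and \<open>1/2\<close> on the right, and in the speed of the tails.
\<close>

lemma change_base_join:
  fixes f :: "real ^ 'l \<Rightarrow> 'a"
  assumes u: "pathin X u" and v: "pathin X v" and uv: "u 1 = v 0" and f: "spheroid X (v 1) f"
  shows "cube_homotopic X (change_base u (change_base v f)) (change_base (path_join u v) f)"
proof -
  let ?a = "\<lambda>t::real. (1 + t) / 4"
  \<comment> \<open>The parameter on the joined path at time \<open>t\<close> and radius \<open>r\<close>: piecewise linear in \<open>r\<close> for \<open>t = 0\<close>,
    equal to \<open>2(1 - r)\<close> for \<open>t = 1\<close>, and always \<open>1\<close> on the inner cube \<open>r = a t\<close>.\<close>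
  let ?\<theta> = "\<lambda>x::real\<times>real. max ((1 - snd x) * (1 + fst x)) (3/2 - 2 * snd x + fst x / 2)"
  let ?w = "path_join u v"
  have fc: "continuous_map (top_of_set cube) X f" using f by (simp add: spheroid_iff)
  have w: "continuous_map (top_of_set {0..1}) X ?w"
    using pathin_path_join[OF u v uv] by (simp add: pathin_def)
  have F: "continuous_map (top_of_set ({0..1::real} \<times> cube)) X (\<lambda>x. f (snd x))"
    by (rule continuous_map_compose_on[OF fc]) (auto intro!: continuous_intros)
  have th: "?\<theta> (t, r) \<in> {0..1}" if "t \<in> {0..1}" "?a t \<le> r" "r \<le> 1" for t r
  proof -
    have "(1 - r) * (1 + t) \<le> (1 - ?a t) * (1 + t)" using that by (intro mult_right_mono) auto
    also have "\<dots> \<le> 1"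
    proof -
      have "0 \<le> (1 - t) * (1 - t)" by simp
      then show ?thesis by (simp add: field_simps)
    qed
    finally have "(1 - r) * (1 + t) \<le> 1" .
    moreover have "0 \<le> (1 - r) * (1 + t)" using that by simp
    ultimately show ?thesis using that by (simp add: le_max_iff_disj)
  qed
  have th1: "?\<theta> (t, ?a t) = 1" if "t \<in> {0..1}" for t
  proof -
    have "0 \<le> (1 - t) * (1 - t)" by simp
    then have "(1 - ?a t) * (1 + t) \<le> 1" by (simp add: field_simps)
    then show ?thesis by (simp add: max_def field_simps)
  qed
  have W: "continuous_map (top_of_set {(t, r). t \<in> {0..1} \<and> ?a t \<le> r \<and> r \<le> 1}) X (\<lambda>x. ?w (?\<theta> x))"
    by (rule continuous_map_compose_on[OF w]) (use th in \<open>fastforce intro!: continuous_intros\<close>)+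
  have *: "cube_homotopic X
     (\<lambda>s. if radius s \<le> ?a 0 then f (snd (0::real, (1/2) *\<^sub>R ((1 / ?a 0) *\<^sub>R (2 *\<^sub>R s - 1) + 1))) else ?w (?\<theta> (0, radius s)))
     (\<lambda>s. if radius s \<le> ?a 1 then f (snd (1::real, (1/2) *\<^sub>R ((1 / ?a 1) *\<^sub>R (2 *\<^sub>R s - 1) + 1))) else ?w (?\<theta> (1, radius s)))"
  proof (rule change_base_homotopy[OF _ _ F W, where x = "u 0"])
    show "f (snd (t, s)) = ?w (?\<theta> (t, ?a t))" if "t \<in> {0..1}" "s \<in> cube_boundary" for t s
      using f that th1[OF that(1)] by (simp add: spheroid_iff)
    show "?w (?\<theta> (t, 1)) = u 0" if "t \<in> {0..1}" for t
      using that by (cases "t = 1") (auto simp: max_def)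
  qed (auto intro!: continuous_intros)
  moreover have "(\<lambda>s. if radius s \<le> ?a 1 then f (snd (1::real, (1/2) *\<^sub>R ((1 / ?a 1) *\<^sub>R (2 *\<^sub>R s - 1) + 1))) else ?w (?\<theta> (1, radius s))) = change_base ?w f"
    unfolding change_base_eq[abs_def] by (intro ext) (simp add: algebra_simps)
  moreover have "(\<lambda>s. if radius s \<le> ?a 0 then f (snd (0::real, (1/2) *\<^sub>R ((1 / ?a 0) *\<^sub>R (2 *\<^sub>R s - 1) + 1))) else ?w (?\<theta> (0, radius s))) = change_base u (change_base v f)"
  proof (rule ext)
    fix s :: "real ^ 'l"
    let ?c = "(1/2) *\<^sub>R ((1 / (1/2)) *\<^sub>R (2 *\<^sub>R s - 1) + 1)"
    have "radius ?c = 2 * radius s" using radius_scaled[of "1/2" s] by simp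
    moreover have "(1/2) *\<^sub>R ((1 / (1/2)) *\<^sub>R (2 *\<^sub>R ?c - 1) + 1) = (1/2) *\<^sub>R ((1 / ?a 0) *\<^sub>R (2 *\<^sub>R s - 1) + 1)"
      by (simp add: vec_eq_iff)
    ultimately have "change_base u (change_base v f) s =
      (if radius s \<le> 1/2 then (if 2 * radius s \<le> 1/2 then f ((1/2) *\<^sub>R ((1 / ?a 0) *\<^sub>R (2 *\<^sub>R s - 1) + 1))
         else v (2 * (1 - 2 * radius s))) else u (2 * (1 - radius s)))"
      unfolding change_base_eq[of u] change_base_eq[of v _ ?c] by simp
    then show "(if radius s \<le> ?a 0 then f (snd (0::real, (1/2) *\<^sub>R ((1 / ?a 0) *\<^sub>R (2 *\<^sub>R s - 1) + 1))) else ?w (?\<theta> (0, radius s))) = change_base u (change_base v f) s"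
      using uv by (cases "radius s = 1/2") (auto simp: path_join_def max_def simp del: eq_divide_eq_numeral1)
  qed
  ultimately show ?thesis by simp
qed

text \<open>
  The only place where \<open>l > 1\<close> enters: a lift of a spheroid has to be constant on the boundary.
\<close>

lemma connected_cube_boundary:
  assumes "CARD('l::finite) > 1"
  shows "connected (cube_boundary :: (real ^ 'l) set)"
proof -
  have ne: "interior (cube :: (real ^ 'l) set) \<noteq> {}"
    by (simp add: interior_cbox box_ne_empty one_inner_Basis)
  have "rel_frontier (cube :: (real ^ 'l) set) = cube_boundary"
    using rel_interior_nonempty_interior[OF ne] by (simp add: rel_frontier_def interior_cbox)
  moreover have "aff_dim (cube :: (real ^ 'l) set) \<noteq> 1"
    using aff_dim_nonempty_interior[OF ne] assms by simp
  ultimately show ?thesis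
    using connected_sphere_gen[of "cube :: (real ^ 'l) set"] by (simp add: convex_box)
qed

lemma zero_in_cube_boundary: "0 \<in> (cube_boundary :: (real ^ 'l) set)"
  using nonempty_Basis by (auto simp: mem_box one_inner_Basis)

lemma box_unit_cube_ne: "box (0 :: real ^ 'l) 1 \<noteq> {}"
  by (simp add: box_ne_empty one_inner_Basis)

lemma spheroid_class_eq:
  "(\<And>s. s \<in> cube_boundary \<Longrightarrow> f s = x) \<Longrightarrow> spheroid_class X x f = homotopy_class_rel cube cube_boundary X f"
  unfolding spheroid_class_def homotopy_class_rel_def homotopic_rel_def by simp

section \<open>Block permutations\<close>

text \<open>
  The position of the pair \<open>(i, j)\<close> in the enumeration \<^const>\<open>lex_pairs\<close>.
\<close>

definition block_pos :: "nat list \<Rightarrow> nat \<Rightarrow> nat \<Rightarrow> nat"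
  where "block_pos ms i j = sum_list (take i ms) + j"

lemma nth_concat_block_pos:
  "i < length xss \<Longrightarrow> j < length (xss ! i) \<Longrightarrow> concat xss ! block_pos (map length xss) i j = xss ! i ! j"
proof (induction xss arbitrary: i)
  case (Cons xs xss)
  then show ?case
    by (cases i) (auto simp: block_pos_def nth_append add.assoc)
qed simp

lemma block_pos_less:
  "i < length ms \<Longrightarrow> j < ms ! i \<Longrightarrow> block_pos ms i j < sum_list ms"
proof (induction ms arbitrary: i)
  case (Cons m ms)
  then show ?case
    by (cases i) (auto simp: block_pos_def add.assoc)
qed simp

lemma block_pos_cases:
  assumes "p < sum_list ms"
  obtains i j where "i < length ms" "j < ms ! i" "p = block_pos ms i j"
proof -
  have "\<exists>i j. i < length ms \<and> j < ms ! i \<and> p = block_pos ms i j"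
    using assms
  proof (induction ms arbitrary: p)
    case (Cons m ms)
    show ?case
    proof (cases "p < m")
      case True
      then show ?thesis by (intro exI[of _ 0] exI[of _ p]) (simp add: block_pos_def)
    next
      case False
      then have "p - m < sum_list ms" using Cons.prems by auto
      then obtain i j where "i < length ms" "j < ms ! i" "p - m = block_pos ms i j"
        using Cons.IH by blast
      then show ?thesis using False by (intro exI[of _ "Suc i"] exI[of _ j]) (simp add: block_pos_def)
    qed
  qed simp
  then show ?thesis using that by blast
qed

lemma lex_pairs_nth:
  assumes "i < length ms" "j < ms ! i"
  shows "lex_pairs ms ! block_pos ms i j = (i, j)"
proof -
  let ?xss = "map (\<lambda>i. map (Pair i) [0..<ms ! i]) [0..<length ms]"
  have "map length ?xss = ms" by (simp add: o_def map_nth)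
  moreover have "lex_pairs ms = concat ?xss" by (simp add: lex_pairs_def map_concat o_def)
  ultimately show ?thesis using nth_concat_block_pos[of i ?xss j] assms by simp
qed

lemma block_pos_less_cases:
  assumes "block_pos ms i j < block_pos ms i' j'" "i < length ms" "i' < length ms" "j < ms ! i" "j' < ms ! i'"
  shows "i < i' \<or> (i = i' \<and> j < j')"
proof -
  have "block_pos ms i' j' < block_pos ms i j" if "i' < i"
  proof -
    have "block_pos ms i' j' < sum_list (take (Suc i') ms)"
      using assms by (simp add: block_pos_def take_Suc_conv_app_nth)
    also have "\<dots> \<le> sum_list (take i ms)"
    proof -
      have "take i ms = take (Suc i') ms @ take (i - Suc i') (drop (Suc i') ms)"
        using that by (metis Suc_leI le_add_diff_inverse take_add)
      then show ?thesis by (metis le_add1 sum_list_append)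
    qed
    finally show ?thesis by (simp add: block_pos_def)
  qed
  then show ?thesis using assms(1) by (cases "i < i'"; cases "i = i'") (auto simp: block_pos_def)
qed

lemma take_concat_block_pos:
  "i < length xss \<Longrightarrow> j \<le> length (xss ! i) \<Longrightarrow>
    take (block_pos (map length xss) i j) (concat xss) = concat (take i xss) @ take j (xss ! i)"
proof (induction xss arbitrary: i)
  case (Cons xs xss)
  then show ?case
    by (cases i) (auto simp: block_pos_def add.assoc)
qed simp

lemma block_pos_assoc:
  assumes "i < length nss" "j < length (nss ! i)"
  shows "block_pos (concat nss) (block_pos (map length nss) i j) b =
    block_pos (map sum_list nss) i (block_pos (nss ! i) j b)"
proof -
  have "sum_list (concat (take i nss)) = sum_list (map sum_list (take i nss))"
    by (induction nss arbitrary: i) (auto simp: take_Cons split: nat.split)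
  then show ?thesis
    using take_concat_block_pos[of i nss j] assms by (simp add: block_pos_def take_map)
qed

lemma length_permute_by [simp]: "length (permute_by \<sigma> xs) = length xs"
  by (simp add: permute_by_def)

lemma permute_by_nth: "i < length xs \<Longrightarrow> permute_by \<sigma> xs ! i = xs ! inv_into UNIV \<sigma> i"
  by (simp add: permute_by_def permute_list_def)

lemma permute_by_nth_perm:
  assumes "\<sigma> permutes {..<length xs}" "i < length xs"
  shows "permute_by \<sigma> xs ! \<sigma> i = xs ! i"
proof -
  have "\<sigma> i < length xs" using permutes_in_image[OF assms(1)] assms(2) by auto
  then show ?thesis using permutes_inverses(2)[OF assms(1)] by (simp add: permute_by_nth)
qed

lemma permute_by_eqI:
  assumes "\<sigma> permutes {..<length xs}" "length ys = length xs"
    and "\<And>i. i < length xs \<Longrightarrow> ys ! \<sigma> i = xs ! i"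
  shows "permute_by \<sigma> xs = ys"
proof (rule nth_equalityI)
  fix i assume "i < length (permute_by \<sigma> xs)"
  then have i: "i < length xs" by simp
  have "inv_into UNIV \<sigma> i < length xs"
    using permutes_in_image[OF permutes_inv[OF assms(1)]] i by auto
  then show "permute_by \<sigma> xs ! i = ys ! i"
    using assms(3)[of "inv_into UNIV \<sigma> i"] permutes_inverses(1)[OF assms(1)] i by (simp add: permute_by_nth)
qed (simp add: assms)

lemma permute_by_comp:
  assumes "\<sigma> permutes {..<length xs}" "\<tau> permutes {..<length xs}"
  shows "permute_by (\<tau> \<circ> \<sigma>) xs = permute_by \<tau> (permute_by \<sigma> xs)"
proof (rule permute_by_eqI)
  show "\<tau> \<circ> \<sigma> permutes {..<length xs}" using assms by (rule permutes_compose)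
  show "permute_by \<tau> (permute_by \<sigma> xs) ! (\<tau> \<circ> \<sigma>) i = xs ! i" if "i < length xs" for i
  proof -
    have "\<sigma> i < length xs" using permutes_in_image[OF assms(1)] that by auto
    then show ?thesis using assms that by (simp add: permute_by_nth_perm)
  qed
qed simp

lemma permute_by_id [simp]: "permute_by id xs = xs"
  by (rule permute_by_eqI) (auto simp: permutes_id)

lemma permute_by_map:
  assumes "\<sigma> permutes {..<length xs}"
  shows "permute_by \<sigma> (map f xs) = map f (permute_by \<sigma> xs)"
proof (rule permute_by_eqI)
  show "map f (permute_by \<sigma> xs) ! \<sigma> i = map f xs ! i" if "i < length (map f xs)" for i
  proof -
    have i: "i < length xs" using that by simp
    have "\<sigma> i < length xs" using permutes_in_image[OF assms(1)] i by auto
    then show ?thesis using permute_by_nth_perm[OF assms i] i by simp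
  qed
qed (use assms in auto)

lemma sum_list_permute_by:
  fixes ms :: "nat list"
  assumes "\<sigma> permutes {..<length ms}"
  shows "sum_list (permute_by \<sigma> ms) = sum_list ms"
proof -
  have "mset (permute_by \<sigma> ms) = mset ms"
    unfolding permute_by_def by (rule mset_permute_list) (rule permutes_inv[OF assms])
  then show ?thesis by (metis sum_mset_sum_list)
qed

lemma list_all2_permute_by:
  assumes "\<sigma> permutes {..<length xs}" "list_all2 P xs ys"
  shows "list_all2 P (permute_by \<sigma> xs) (permute_by \<sigma> ys)"
proof -
  have "inv_into UNIV \<sigma> i < length xs" if "i < length xs" for i
    using permutes_in_image[OF permutes_inv[OF assms(1)]] that by auto
  then show ?thesis using assms(2) by (auto simp: list_all2_conv_all_nth permute_by_nth)
qed

text \<open>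
  In block coordinates the composition of permutations acts on the two coordinates separately: the
  sum in its definition is the total length of the blocks that \<open>\<sigma>\<close> puts in front of block \<open>i\<close>.
\<close>

lemma symm_comp_block_pos:
  assumes \<sigma>: "\<sigma> permutes {..<length ms}" and ij: "i < length ms" "j < ms ! i"
  shows "symm_comp ms \<sigma> \<tau>s (block_pos ms i j) = block_pos (permute_by \<sigma> ms) (\<sigma> i) ((\<tau>s ! i) j)"
proof -
  have si: "\<sigma> i < length ms" using permutes_in_image[OF \<sigma>] ij by auto
  have "sum_list (take (\<sigma> i) (permute_by \<sigma> ms)) = (\<Sum>a<\<sigma> i. permute_by \<sigma> ms ! a)"
    using si by (simp add: sum_list_sum_nth atLeast0LessThan)
  also have "\<dots> = (\<Sum>l | l < length ms \<and> \<sigma> l < \<sigma> i. ms ! l)"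
  proof (rule sum.reindex_bij_betw[symmetric, THEN trans])
    show "bij_betw \<sigma> {l. l < length ms \<and> \<sigma> l < \<sigma> i} {..<\<sigma> i}"
    proof (rule bij_betw_imageI)
      show "inj_on \<sigma> {l. l < length ms \<and> \<sigma> l < \<sigma> i}"
        using permutes_inj[OF \<sigma>] by (rule inj_on_subset) auto
      show "\<sigma> ` {l. l < length ms \<and> \<sigma> l < \<sigma> i} = {..<\<sigma> i}"
      proof (intro equalityI subsetI)
        fix a assume "a \<in> {..<\<sigma> i}"
        then have "a < length ms" "a < \<sigma> i" using si by auto
        moreover obtain l where l: "a = \<sigma> l" using permutes_surj[OF \<sigma>] by blast
        ultimately show "a \<in> \<sigma> ` {l. l < length ms \<and> \<sigma> l < \<sigma> i}"
          using permutes_in_image[OF \<sigma>, of l] by auto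
      qed auto
    qed
    show "(\<Sum>x\<in>{l. l < length ms \<and> \<sigma> l < \<sigma> i}. permute_by \<sigma> ms ! \<sigma> x) =
        (\<Sum>l | l < length ms \<and> \<sigma> l < \<sigma> i. ms ! l)"
      by (rule sum.cong) (use permute_by_nth_perm[OF \<sigma>] in auto)
  qed
  finally show ?thesis
    using ij block_pos_less[OF ij] by (simp add: symm_comp_def lex_pairs_nth block_pos_def[of "permute_by \<sigma> ms"])
qed

text \<open>
  Iterated compositions permute the innermost configurations, in one bracketing as a flat list and
  in the other one block by block; this lemma identifies the two.
\<close>

lemma permute_by_symm_comp:
  fixes xss :: "'b list list"
  assumes ms: "map length xss = ms" and \<sigma>: "\<sigma> permutes {..<length ms}"
    and \<tau>: "list_all2 (\<lambda>m \<tau>. \<tau> permutes {..<m}) ms \<tau>s"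
    and \<rho>: "symm_comp ms \<sigma> \<tau>s permutes {..<sum_list ms}"
  shows "permute_by (symm_comp ms \<sigma> \<tau>s) (concat xss) = concat (permute_by \<sigma> (map2 permute_by \<tau>s xss))"
proof (rule permute_by_eqI)
  let ?yss = "map2 permute_by \<tau>s xss"
  have len: "length xss = length ms" "length \<tau>s = length ms" "length ?yss = length ms"
    using ms list_all2_lengthD[OF \<tau>] by auto
  have ylen: "map length ?yss = ms"
    using len ms by (intro nth_equalityI) auto
  have sum: "length (concat xss) = sum_list ms" using ms by (simp add: length_concat)
  show "symm_comp ms \<sigma> \<tau>s permutes {..<length (concat xss)}" using \<rho> sum by simp
  have plen: "map length (permute_by \<sigma> ?yss) = permute_by \<sigma> ms"
    using permute_by_map[of \<sigma> ?yss length] \<sigma> len(3) ylen by simp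
  then have "length (concat (permute_by \<sigma> ?yss)) = sum_list (permute_by \<sigma> ms)"
    by (simp add: length_concat)
  then show "length (concat (permute_by \<sigma> ?yss)) = length (concat xss)"
    using sum sum_list_permute_by[OF \<sigma>] by simp
  fix p assume "p < length (concat xss)"
  then obtain i j where ij: "i < length ms" "j < ms ! i" "p = block_pos ms i j"
    using block_pos_cases[of p ms] sum by auto
  have ti: "\<tau>s ! i permutes {..<ms ! i}" using \<tau> ij(1) by (simp add: list_all2_conv_all_nth)
  have tj: "(\<tau>s ! i) j < ms ! i" using permutes_in_image[OF ti] ij by auto
  have si: "\<sigma> i < length ms" using permutes_in_image[OF \<sigma>] ij by auto
  have xi: "length (xss ! i) = ms ! i" using ms ij(1) len by (metis nth_map)
  have yi: "permute_by \<sigma> ?yss ! \<sigma> i = permute_by (\<tau>s ! i) (xss ! i)"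
    using permute_by_nth_perm[of \<sigma> ?yss i] \<sigma> len ij(1) by simp
  have "concat (permute_by \<sigma> ?yss) ! symm_comp ms \<sigma> \<tau>s p = permute_by (\<tau>s ! i) (xss ! i) ! (\<tau>s ! i) j"
    using nth_concat_block_pos[of "\<sigma> i" "permute_by \<sigma> ?yss" "(\<tau>s ! i) j"]
      symm_comp_block_pos[OF \<sigma> ij(1,2)] ij(3) plen yi si tj len xi by simp
  also have "\<dots> = xss ! i ! j" using permute_by_nth_perm[of "\<tau>s ! i" "xss ! i" j] ti xi ij(2) by simp
  also have "\<dots> = concat xss ! p" using nth_concat_block_pos[of i xss j] ms ij xi len by simp
  finally show "concat (permute_by \<sigma> ?yss) ! symm_comp ms \<sigma> \<tau>s p = concat xss ! p" .
qed

lemma permute_by_map_index: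
  assumes "\<sigma> permutes {..<k}" "length xs = k" "length ys = k"
  shows "permute_by \<sigma> (map (\<lambda>i. f (xs ! i) (ys ! i)) [0..<k]) =
    map (\<lambda>i. f (permute_by \<sigma> xs ! i) (permute_by \<sigma> ys ! i)) [0..<k]"
proof -
  have "inv_into UNIV \<sigma> i < k" if "i < k" for i
    using permutes_in_image[OF permutes_inv[OF assms(1)]] that by auto
  then show ?thesis using assms by (intro nth_equalityI) (auto simp: permute_by_nth)
qed

lemma sum_list_concat_blocks: "sum_list (concat nss) = sum_list (map sum_list nss)" for nss :: "nat list list"
  by (induction nss) auto

lemma permute_by_map_index3:
  assumes "\<sigma> permutes {..<k}" "length xs = k" "length ys = k" "length zs = k"
  shows "permute_by \<sigma> (map (\<lambda>i. f (xs ! i) (ys ! i) (zs ! i)) [0..<k]) =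
    map (\<lambda>i. f (permute_by \<sigma> xs ! i) (permute_by \<sigma> ys ! i) (permute_by \<sigma> zs ! i)) [0..<k]"
proof -
  have "inv_into UNIV \<sigma> i < k" if "i < k" for i
    using permutes_in_image[OF permutes_inv[OF assms(1)]] that by auto
  then show ?thesis using assms by (intro nth_equalityI) (auto simp: permute_by_nth)
qed

lemma permute_by_replicate: "\<sigma> permutes {..<n} \<Longrightarrow> permute_by \<sigma> (replicate n a) = replicate n a"
  by (rule permute_by_eqI) (auto simp: permutes_in_image[of \<sigma> "{..<n}", simplified])

section \<open>Operads in block form and operads of classes\<close>

lemma op_tuples_iff: "bs \<in> op_tuples D ms \<longleftrightarrow> list_all2 (\<lambda>m b. b \<in> op_pts D m) ms bs"
  unfolding op_tuples_def
  by (induction ms arbitrary: bs) (auto simp: set_Cons_def list_all2_Cons1)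

lemma split_blocks_concat: "split_blocks (map length xss) (concat xss) = xss"
  by (induction xss) auto

lemma split_blocks_props:
  "length xs = sum_list ms \<Longrightarrow> concat (split_blocks ms xs) = xs \<and> map length (split_blocks ms xs) = ms"
  by (induction ms xs rule: split_blocks.induct) auto

lemma list_all2_concat: "list_all2 (list_all2 P) xss yss \<Longrightarrow> list_all2 P (concat xss) (concat yss)"
  by (induction rule: list_all2_induct) (auto intro: list_all2_appendI)

lemma list_all2_split_blocks:
  "list_all2 P xs ys \<Longrightarrow> list_all2 (list_all2 P) (split_blocks ms xs) (split_blocks ms ys)"
  by (induction ms xs arbitrary: ys rule: split_blocks.induct) auto

lemma operad_comp_closed:
  assumes "is_operad D" "a \<in> op_pts D (length ms)" "list_all2 (\<lambda>m b. b \<in> op_pts D m) ms bs"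
  shows "op_comp D ms a bs \<in> op_pts D (sum_list ms)"
proof -
  let ?b = "\<lambda>i\<in>{..<length ms}. bs ! i"
  have "continuous_map
       (kification (prod_topology (op_space D (length ms))
          (product_topology (\<lambda>i. op_space D (ms ! i)) {..<length ms})))
       (op_space D (sum_list ms))
       (\<lambda>(a, b). op_comp D ms a (map b [0..<length ms]))"
    using assms(1) unfolding is_operad_def by blast
  moreover have "(a, ?b) \<in> topspace (kification (prod_topology (op_space D (length ms))
          (product_topology (\<lambda>i. op_space D (ms ! i)) {..<length ms})))"
    using assms(2,3) by (auto simp: list_all2_conv_all_nth)
  ultimately have "(\<lambda>(a, b). op_comp D ms a (map b [0..<length ms])) (a, ?b) \<in> op_pts D (sum_list ms)"
    unfolding continuous_map_def by blast
  moreover have "map ?b [0..<length ms] = bs"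
    using list_all2_lengthD[OF assms(3)] by (intro nth_equalityI) auto
  ultimately show ?thesis by simp
qed

text \<open>
  A profile that is given as a list of blocks need not be split.
\<close>

lemma operad_assoc:
  assumes "is_operad D" "a \<in> op_pts D (length nss)"
    and bs: "list_all2 (\<lambda>ns b. b \<in> op_pts D (length ns)) nss bs"
    and css: "list_all2 (list_all2 (\<lambda>n c. c \<in> op_pts D n)) nss css"
  shows "op_comp D (concat nss) (op_comp D (map length nss) a bs) (concat css) =
    op_comp D (map sum_list nss) a (map (\<lambda>i. op_comp D (nss ! i) (bs ! i) (css ! i)) [0..<length nss])"
proof -
  have len: "length bs = length nss" "length css = length nss"
    using bs css by (auto dest: list_all2_lengthD)
  have "map length css = map length nss"
    using css by (intro nth_equalityI) (auto simp: list_all2_conv_all_nth)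
  then have split: "split_blocks (map length nss) (concat nss) = nss"
    "split_blocks (map length nss) (concat css) = css"
    using split_blocks_concat by metis+
  have *: "\<forall>ms ns a bs cs.
       length ns = sum_list ms \<and> a \<in> op_pts D (length ms) \<and>
       bs \<in> op_tuples D ms \<and> cs \<in> op_tuples D ns \<longrightarrow>
       op_comp D ns (op_comp D ms a bs) cs =
       op_comp D (map sum_list (split_blocks ms ns)) a
         (map (\<lambda>(ns', b, cs'). op_comp D ns' b cs')
            (zip (split_blocks ms ns) (zip bs (split_blocks ms cs))))"
    using assms(1) unfolding is_operad_def by (elim conjE) assumption
  have h: "length (concat nss) = sum_list (map length nss)" "a \<in> op_pts D (length (map length nss))"
    "bs \<in> op_tuples D (map length nss)" "concat css \<in> op_tuples D (concat nss)"
    using assms list_all2_concat[OF css] by (auto simp: length_concat op_tuples_iff list_all2_map1)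
  have "op_comp D (concat nss) (op_comp D (map length nss) a bs) (concat css) =
    op_comp D (map sum_list nss) a
         (map (\<lambda>(ns', b, cs'). op_comp D ns' b cs') (zip nss (zip bs css)))"
    using *[rule_format, OF conjI[OF h(1) conjI[OF h(2) conjI[OF h(3,4)]]]] unfolding split .
  moreover have "map (\<lambda>(ns', b, cs'). op_comp D ns' b cs') (zip nss (zip bs css)) =
      map (\<lambda>i. op_comp D (nss ! i) (bs ! i) (css ! i)) [0..<length nss]"
    using len by (intro nth_equalityI) auto
  ultimately show ?thesis by simp
qed

lemma operad_unit:
  assumes "is_operad D"
  shows "op_unit D \<in> op_pts D 1"
    and "a \<in> op_pts D n \<Longrightarrow> op_comp D [n] (op_unit D) [a] = a"
    and "a \<in> op_pts D n \<Longrightarrow> op_comp D (replicate n 1) a (replicate n (op_unit D)) = a"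
proof -
  have *: "op_unit D \<in> op_pts D 1 \<and> (\<forall>n. \<forall>a\<in>op_pts D n. op_comp D [n] (op_unit D) [a] = a) \<and>
    (\<forall>n. \<forall>a\<in>op_pts D n. op_comp D (replicate n 1) a (replicate n (op_unit D)) = a)"
    using assms unfolding is_operad_def by (elim conjE) (intro conjI; assumption)
  show "op_unit D \<in> op_pts D 1"
    and "a \<in> op_pts D n \<Longrightarrow> op_comp D [n] (op_unit D) [a] = a"
    and "a \<in> op_pts D n \<Longrightarrow> op_comp D (replicate n 1) a (replicate n (op_unit D)) = a"
    using * by blast+
qed

text \<open>
  The composition is continuous on the compactly generated product only.  The domain \<open>Z\<close> is metrizable,
  hence compactly generated, so a map from \<open>Z\<close> to the product is continuous for either topology.
\<close>

lemma continuous_map_op_comp: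
  fixes Z :: "'e::metric_space set"
  assumes D: "is_operad D" and f: "continuous_map (top_of_set Z) (op_space D (length ms)) f"
    and gs: "list_all2 (\<lambda>m g. continuous_map (top_of_set Z) (op_space D m) g) ms gs"
  shows "continuous_map (top_of_set Z) (op_space D (sum_list ms))
    (\<lambda>z. op_comp D ms (f z) (map (\<lambda>g. g z) gs))"
proof -
  let ?P = "prod_topology (op_space D (length ms)) (product_topology (\<lambda>i. op_space D (ms ! i)) {..<length ms})"
  let ?h = "\<lambda>z. (f z, \<lambda>i\<in>{..<length ms}. (gs ! i) z)"
  have len: "length gs = length ms" using list_all2_lengthD[OF gs] by simp
  have g: "continuous_map (top_of_set Z) (op_space D (ms ! i)) (gs ! i)" if "i < length ms" for i
    using gs that by (simp add: list_all2_conv_all_nth)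
  have "continuous_map (top_of_set Z) (product_topology (\<lambda>i. op_space D (ms ! i)) {..<length ms})
      (\<lambda>z. \<lambda>i\<in>{..<length ms}. (gs ! i) z)"
    unfolding continuous_map_componentwise using g by (auto simp: eta_contract_eq)
  then have "continuous_map (top_of_set Z) ?P ?h"
    using f by (simp add: continuous_map_pairwise o_def)
  moreover have "k_space (top_of_set Z)"
    by (intro metrizable_imp_k_space metrizable_space_subtopology metrizable_space_euclidean)
  ultimately have "continuous_map (top_of_set Z) (kification ?P) ?h"
    by (simp add: continuous_map_into_kification)
  moreover have "continuous_map (kification ?P) (op_space D (sum_list ms))
      (\<lambda>(a, b). op_comp D ms a (map b [0..<length ms]))"
    using D unfolding is_operad_def by blast
  ultimately have "continuous_map (top_of_set Z) (op_space D (sum_list ms))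
      ((\<lambda>(a, b). op_comp D ms a (map b [0..<length ms])) \<circ> ?h)"
    by (rule continuous_map_compose)
  moreover have "map (\<lambda>i\<in>{..<length ms}. (gs ! i) z) [0..<length ms] = map (\<lambda>g. g z) gs" for z
    using len by (intro nth_equalityI) auto
  ultimately show ?thesis by (simp add: o_def)
qed

lemma openin_product_discrete:
  assumes "finite I" "S \<subseteq> PiE I B"
  shows "openin (product_topology (\<lambda>i. discrete_topology (B i)) I) S"
proof -
  have "openin (product_topology (\<lambda>i. discrete_topology (B i)) I) (PiE I (\<lambda>i. {x i}))" if "x \<in> S" for x
    using assms that by (subst openin_PiE) (auto simp: PiE_iff subset_iff)
  moreover have "S = (\<Union>x\<in>S. PiE I (\<lambda>i. {x i}))"
  proof (intro equalityI subsetI)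
    fix x assume "x \<in> S"
    then show "x \<in> (\<Union>x\<in>S. PiE I (\<lambda>i. {x i}))" using assms(2) by (auto simp: PiE_iff)
  next
    fix y assume "y \<in> (\<Union>x\<in>S. PiE I (\<lambda>i. {x i}))"
    then obtain x where x: "x \<in> S" "y \<in> PiE I (\<lambda>i. {x i})" by blast
    moreover have "x \<in> PiE I B" using x assms(2) by blast
    ultimately have "y = x" by (intro PiE_ext[of y I "\<lambda>i. {x i}" x]) (auto simp: PiE_iff)
    then show "y \<in> S" using x by simp
  qed
  ultimately show ?thesis by (metis (no_types, lifting) openin_clauses(3) imageE)
qed

lemma is_set_operadI:
  assumes space: "\<And>n. op_space D n = discrete_topology (P n)"
    and zero: "\<exists>x. P 0 = {x}"
    and closed: "\<And>ms a bs. a \<in> P (length ms) \<Longrightarrow> list_all2 (\<lambda>m b. b \<in> P m) ms bs \<Longrightarrow>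
      op_comp D ms a bs \<in> P (sum_list ms)"
    and assoc: "\<And>nss a bs css. a \<in> P (length nss) \<Longrightarrow> list_all2 (\<lambda>ns b. b \<in> P (length ns)) nss bs \<Longrightarrow>
      list_all2 (list_all2 (\<lambda>n c. c \<in> P n)) nss css \<Longrightarrow>
      op_comp D (concat nss) (op_comp D (map length nss) a bs) (concat css) =
      op_comp D (map sum_list nss) a (map (\<lambda>i. op_comp D (nss ! i) (bs ! i) (css ! i)) [0..<length nss])"
    and unit: "op_unit D \<in> P 1"
    and unit_left: "\<And>n a. a \<in> P n \<Longrightarrow> op_comp D [n] (op_unit D) [a] = a"
    and unit_right: "\<And>n a. a \<in> P n \<Longrightarrow> op_comp D (replicate n 1) a (replicate n (op_unit D)) = a"
  shows "is_set_operad D"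
proof -
  have pts: "op_pts D n = P n" for n using space by simp
  have cont: "continuous_map
       (kification (prod_topology (op_space D (length ms))
          (product_topology (\<lambda>i. op_space D (ms ! i)) {..<length ms})))
       (op_space D (sum_list ms))
       (\<lambda>(a, b). op_comp D ms a (map b [0..<length ms]))" (is "continuous_map (kification ?X) _ ?f") for ms
  proof (rule continuous_map_from_kification)
    have X: "?X = discrete_topology (P (length ms) \<times> PiE {..<length ms} (\<lambda>i. P (ms ! i)))"
    proof -
      have "product_topology (\<lambda>i. discrete_topology (P (ms ! i))) {..<length ms} =
          discrete_topology (PiE {..<length ms} (\<lambda>i. P (ms ! i)))"
        using openin_product_discrete[of "{..<length ms}" _ "\<lambda>i. P (ms ! i)"]
        by (subst eq_commute, subst discrete_topology_unique) auto
      then show ?thesis by (simp add: space prod_topology_discrete_topology)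
    qed
    have "op_comp D ms a (map b [0..<length ms]) \<in> P (sum_list ms)"
      if "a \<in> P (length ms)" "b \<in> PiE {..<length ms} (\<lambda>i. P (ms ! i))" for a b
      by (rule closed) (use that in \<open>auto simp: list_all2_conv_all_nth\<close>)
    then show "continuous_map ?X (op_space D (sum_list ms)) ?f"
      unfolding X by (auto simp: space)
  qed
  have ass: "op_comp D ns (op_comp D ms a bs) cs =
       op_comp D (map sum_list (split_blocks ms ns)) a
         (map (\<lambda>(ns', b, cs'). op_comp D ns' b cs')
            (zip (split_blocks ms ns) (zip bs (split_blocks ms cs))))"
    if "length ns = sum_list ms" "a \<in> op_pts D (length ms)" "bs \<in> op_tuples D ms" "cs \<in> op_tuples D ns"
    for ms ns a bs cs
  proof -
    let ?nss = "split_blocks ms ns" and ?css = "split_blocks ms cs"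
    have lcs: "length cs = sum_list ms" using that by (auto simp: op_tuples_iff dest: list_all2_lengthD)
    have ns: "concat ?nss = ns" "map length ?nss = ms" using split_blocks_props that by blast+
    have cs: "concat ?css = cs" "map length ?css = ms" using split_blocks_props[OF lcs] by blast+
    have len: "length ?nss = length ms" "length ?css = length ms" using ns(2) cs(2) by (metis length_map)+
    have lb: "length bs = length ms" using that(3) by (auto simp: op_tuples_iff dest: list_all2_lengthD)
    have "list_all2 (\<lambda>ns b. b \<in> P (length ns)) ?nss bs"
      using that(3) ns(2) list_all2_map1[of "\<lambda>m b. b \<in> P m" length ?nss bs]
      by (simp add: op_tuples_iff pts)
    moreover have "list_all2 (list_all2 (\<lambda>n c. c \<in> P n)) ?nss ?css"
      using that(4) by (intro list_all2_split_blocks) (simp add: op_tuples_iff pts)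
    ultimately have "op_comp D ns (op_comp D ms a bs) cs = op_comp D (map sum_list ?nss) a
       (map (\<lambda>i. op_comp D (?nss ! i) (bs ! i) (?css ! i)) [0..<length ?nss])"
      using assoc[of a ?nss bs ?css] that(2) len unfolding ns cs by (simp add: pts)
    moreover have "map (\<lambda>(ns', b, cs'). op_comp D ns' b cs') (zip ?nss (zip bs ?css)) =
      map (\<lambda>i. op_comp D (?nss ! i) (bs ! i) (?css ! i)) [0..<length ?nss]"
      using len lb by (intro nth_equalityI) auto
    ultimately show ?thesis by simp
  qed
  have "is_operad D"
    unfolding is_operad_def
  proof (intro conjI allI impI ballI)
    show "Hausdorff_space (op_space D n)" "k_space (op_space D n)" for n
      by (simp_all add: space k_space_discrete_topology)
    show "\<exists>x. op_pts D 0 = {x}" using zero pts by simp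
    show "op_unit D \<in> op_pts D 1" using unit pts by simp
    show "op_comp D [n] (op_unit D) [a] = a" if "a \<in> op_pts D n" for n a
      using unit_left that pts by simp
    show "op_comp D (replicate n 1) a (replicate n (op_unit D)) = a" if "a \<in> op_pts D n" for n a
      using unit_right that pts by simp
  qed (rule cont, rule ass, simp_all)
  then show ?thesis by (simp add: is_set_operad_def space)
qed

lemma symm_group_simps [simp]:
  "carrier (symm_group n) = {\<sigma>. \<sigma> permutes {..<n}}"
  "\<sigma> \<otimes>\<^bsub>symm_group n\<^esub> \<tau> = \<tau> \<circ> \<sigma>"
  "\<one>\<^bsub>symm_group n\<^esub> = id"
  by (simp_all add: symm_group_def)

lemma symm_group_operad_simps [simp]:
  "op_space symm_group_operad = (\<lambda>n. discrete_topology (carrier (symm_group n)))"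
  "op_comp symm_group_operad = symm_comp"
  "op_unit symm_group_operad = id"
  "go_group symm_group_operad = symm_group"
  "go_perm symm_group_operad = (\<lambda>n \<sigma>. \<sigma>)"
  by (simp_all add: symm_group_operad_def symm_operad_def operad.defs)

lemma map_zip3:
  assumes "length ms = k" "length xs = k" "length ys = k"
  shows "map (\<lambda>(m, x, y). f m x y) (zip ms (zip xs ys)) = map (\<lambda>i. f (ms ! i) (xs ! i) (ys ! i)) [0..<k]"
  using assms by (intro nth_equalityI) auto

lemma map2_nth: "length xs = k \<Longrightarrow> length ys = k \<Longrightarrow> map2 f xs ys = map (\<lambda>i. f (xs ! i) (ys ! i)) [0..<k]"
  by (intro nth_equalityI) auto

lemma listset_iff: "xs \<in> listset As \<longleftrightarrow> list_all2 (\<lambda>A x. x \<in> A) As xs"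
  by (induction As arbitrary: xs) (auto simp: set_Cons_def list_all2_Cons1)

lemma Union_eq_const: "A \<noteq> {} \<Longrightarrow> (\<And>x. x \<in> A \<Longrightarrow> B x = c) \<Longrightarrow> (\<Union>x\<in>A. B x) = c"
  by auto

lemma list_all2_choice:
  "list_all2 (\<lambda>m b. \<exists>d. R m d \<and> b = c m d) ms bs \<Longrightarrow> \<exists>ds. list_all2 R ms ds \<and> bs = map2 c ms ds"
proof (induction rule: list_all2_induct)
  case (Cons m ms b bs)
  then obtain d ds where "R m d" "b = c m d" "list_all2 R ms ds" "bs = map2 c ms ds" by blast
  then show ?case by (intro exI[of _ "d # ds"]) simp
qed simp

lemma map2_concat:
  "list_all2 (list_all2 R) mss dss \<Longrightarrow> map2 c (concat mss) (concat dss) = concat (map2 (map2 c) mss dss)"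
proof (induction rule: list_all2_induct)
  case (Cons ms mss ds dss)
  then show ?case by (simp add: zip_append list_all2_lengthD)
qed simp

text \<open>
  An operad whose elements are classes \<open>c n d\<close> of representatives \<open>d\<close>: if the composition is induced
  by an operation \<open>cm\<close> on representatives, then the axioms only have to be verified for \<open>cm\<close> up to
  passage to classes.  Representatives are chosen for all entries of a nested list simultaneously.
\<close>

lemma is_set_operad_representatives:
  fixes D :: "('p, 'z) operad_scheme" and R :: "nat \<Rightarrow> 'd \<Rightarrow> bool" and c :: "nat \<Rightarrow> 'd \<Rightarrow> 'p"
    and cm :: "nat list \<Rightarrow> 'd \<Rightarrow> 'd list \<Rightarrow> 'd"
  assumes space: "\<And>n. op_space D n = discrete_topology {c n d | d. R n d}"
    and zero: "\<And>d. R 0 d \<Longrightarrow> c 0 d = c 0 d0" "R 0 d0"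
    and R: "\<And>ms d ds. R (length ms) d \<Longrightarrow> list_all2 R ms ds \<Longrightarrow> R (sum_list ms) (cm ms d ds)"
    and comp: "\<And>ms d ds. R (length ms) d \<Longrightarrow> list_all2 R ms ds \<Longrightarrow>
      op_comp D ms (c (length ms) d) (map2 c ms ds) = c (sum_list ms) (cm ms d ds)"
    and assoc: "\<And>nss d ds dss. R (length nss) d \<Longrightarrow> list_all2 (\<lambda>ns. R (length ns)) nss ds \<Longrightarrow>
      list_all2 (list_all2 R) nss dss \<Longrightarrow>
      c (sum_list (concat nss)) (cm (concat nss) (cm (map length nss) d ds) (concat dss)) =
      c (sum_list (concat nss)) (cm (map sum_list nss) d (map (\<lambda>i. cm (nss ! i) (ds ! i) (dss ! i)) [0..<length nss]))"
    and unit: "op_unit D = c 1 e" "R 1 e"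
    and unit_left: "\<And>n d. R n d \<Longrightarrow> c n (cm [n] e [d]) = c n d"
    and unit_right: "\<And>n d. R n d \<Longrightarrow> c n (cm (replicate n 1) d (replicate n e)) = c n d"
  shows "is_set_operad D"
proof (rule is_set_operadI[OF space])
  show "\<exists>x. {c 0 d | d. R 0 d} = {x}" using zero by blast
  show "op_unit D \<in> {c 1 d | d. R 1 d}" using unit by blast
  show "op_comp D ms a bs \<in> {c (sum_list ms) d | d. R (sum_list ms) d}"
    if a: "a \<in> {c (length ms) d | d. R (length ms) d}" and bs: "list_all2 (\<lambda>m b. b \<in> {c m d | d. R m d}) ms bs" for ms a bs
  proof -
    obtain d where d: "a = c (length ms) d" "R (length ms) d" using a by blast
    obtain ds where ds: "list_all2 R ms ds" "bs = map2 c ms ds"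
      using list_all2_choice[of R c ms bs] bs by (auto simp: conj_commute)
    show ?thesis using comp[OF d(2) ds(1)] R[OF d(2) ds(1)] unfolding d(1) ds(2) by blast
  qed
  show "op_comp D [n] (op_unit D) [a] = a" if a: "a \<in> {c n d | d. R n d}" for n a
  proof -
    obtain d where d: "a = c n d" "R n d" using a by blast
    then show ?thesis using comp[of "[n]" e "[d]"] unit unit_left[OF d(2)] by simp
  qed
  show "op_comp D (replicate n 1) a (replicate n (op_unit D)) = a" if a: "a \<in> {c n d | d. R n d}" for n a
  proof -
    obtain d where d: "a = c n d" "R n d" using a by blast
    have "list_all2 R (replicate n 1) (replicate n e)" using unit(2) by (simp add: list_all2_conv_all_nth)
    then show ?thesis
      using comp[of "replicate n 1" d "replicate n e"] d unit(1) unit_right[OF d(2)]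
      by (simp add: zip_replicate sum_list_replicate)
  qed
  fix nss a bs css
  assume a: "a \<in> {c (length nss) d | d. R (length nss) d}"
    and bs: "list_all2 (\<lambda>ns b. b \<in> {c (length ns) d | d. R (length ns) d}) nss bs"
    and css: "list_all2 (list_all2 (\<lambda>n x. x \<in> {c n d | d. R n d})) nss css"
  obtain d where d: "a = c (length nss) d" "R (length nss) d" using a by blast
  obtain ds where ds: "list_all2 (\<lambda>ns. R (length ns)) nss ds" "bs = map2 (\<lambda>ns. c (length ns)) nss ds"
    using list_all2_choice[of "\<lambda>ns. R (length ns)" "\<lambda>ns. c (length ns)" nss bs] bs by (auto simp: conj_commute)
  have "list_all2 (\<lambda>ns xs. \<exists>es. list_all2 R ns es \<and> xs = map2 c ns es) nss css"
    using css by (rule list_all2_mono) (rule list_all2_choice, auto elim!: list_all2_mono)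
  from list_all2_choice[OF this] obtain dss
    where dss: "list_all2 (list_all2 R) nss dss" "css = map2 (map2 c) nss dss" by blast
  have ds': "list_all2 R (map length nss) ds" "bs = map2 c (map length nss) ds"
    using ds by (auto simp: list_all2_map1 zip_map1 split_def)
  have len: "length ds = length nss" "length dss = length nss" using ds dss by (auto dest: list_all2_lengthD)
  have d': "R (length (map length nss)) d" using d(2) by simp
  let ?es = "map (\<lambda>i. cm (nss ! i) (ds ! i) (dss ! i)) [0..<length nss]"
  have i: "op_comp D (nss ! i) (bs ! i) (css ! i) = c (sum_list (nss ! i)) (?es ! i)" "R (sum_list (nss ! i)) (?es ! i)"
    if "i < length nss" for i
    using comp[of "nss ! i" "ds ! i" "dss ! i"] R[of "nss ! i" "ds ! i" "dss ! i"] ds(1) dss(1) len that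
    unfolding ds(2) dss(2) by (simp_all add: list_all2_conv_all_nth[of _ nss])
  have "map (\<lambda>i. op_comp D (nss ! i) (bs ! i) (css ! i)) [0..<length nss] = map2 c (map sum_list nss) ?es"
    using i(1) by (intro nth_equalityI) simp_all
  moreover have "op_comp D (map sum_list nss) a (map2 c (map sum_list nss) ?es) = c (sum_list (map sum_list nss)) (cm (map sum_list nss) d ?es)"
    using comp[of "map sum_list nss" d ?es] d i(2) by (simp add: list_all2_conv_all_nth)
  moreover have "op_comp D (map length nss) a bs = c (length (concat nss)) (cm (map length nss) d ds)"
    unfolding ds'(2) d(1) using comp[OF d' ds'(1)] by (simp add: length_concat)
  moreover have "concat css = map2 c (concat nss) (concat dss)"
    unfolding dss(2) by (rule map2_concat[OF dss(1), symmetric])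
  moreover have "op_comp D (concat nss) (c (length (concat nss)) (cm (map length nss) d ds)) (map2 c (concat nss) (concat dss)) =
      c (sum_list (concat nss)) (cm (concat nss) (cm (map length nss) d ds) (concat dss))"
    using R[OF d' ds'(1)] list_all2_concat[OF dss(1)] by (intro comp) (simp_all add: length_concat)
  ultimately show "op_comp D (concat nss) (op_comp D (map length nss) a bs) (concat css) =
    op_comp D (map sum_list nss) a (map (\<lambda>i. op_comp D (nss ! i) (bs ! i) (css ! i)) [0..<length nss])"
    using assoc[OF d(2) ds(1) dss(1)] by (simp add: sum_list_concat_blocks)
qed

lemma group_actionI:
  assumes G: "group G"
    and closed: "\<And>g x. g \<in> carrier G \<Longrightarrow> x \<in> E \<Longrightarrow> a g x \<in> E"
    and one: "\<And>x. x \<in> E \<Longrightarrow> a \<one>\<^bsub>G\<^esub> x = x"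
    and mult: "\<And>g h x. g \<in> carrier G \<Longrightarrow> h \<in> carrier G \<Longrightarrow> x \<in> E \<Longrightarrow> a (g \<otimes>\<^bsub>G\<^esub> h) x = a g (a h x)"
  shows "group_action G E (\<lambda>g. restrict (a g) E)"
proof -
  interpret group G by (rule G)
  have Bij: "restrict (a g) E \<in> Bij E" if g: "g \<in> carrier G" for g
  proof -
    have "bij_betw (a g) E E"
      by (rule bij_betw_byWitness[of _ "a (inv\<^bsub>G\<^esub> g)"])
         (use g closed one mult[of g "inv\<^bsub>G\<^esub> g"] mult[of "inv\<^bsub>G\<^esub> g" g] in auto)
    then show ?thesis by (simp add: Bij_def)
  qed
  have "(\<lambda>g. restrict (a g) E) \<in> hom G (BijGroup E)"
  proof (rule homI)
    fix g h assume gh: "g \<in> carrier G" "h \<in> carrier G"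
    show "restrict (a (g \<otimes>\<^bsub>G\<^esub> h)) E = restrict (a g) E \<otimes>\<^bsub>BijGroup E\<^esub> restrict (a h) E"
      using gh Bij closed mult by (auto simp: BijGroup_def compose_def fun_eq_iff)
  qed (simp add: Bij BijGroup_def)
  then show ?thesis
    unfolding group_action_def group_hom_def group_hom_axioms_def
    using G group_BijGroup by blast
qed

section \<open>Ordered configurations of little intervals\<close>

text \<open>
  Unlike the space of all configurations this set is convex.  It contains the even configurations,
  so it lies in the path component on which \<open>\<eta>\<close> is defined, and the linear paths stay inside it.
\<close>

definition ordered_intervals :: "nat \<Rightarrow> (nat \<Rightarrow> real \<times> real) set"
  where "ordered_intervals k = {c \<in> extensional {..<k}.
    (\<forall>i<k. 0 \<le> fst (c i) \<and> fst (c i) < snd (c i) \<and> snd (c i) \<le> 1) \<and>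
    (\<forall>i j. i < j \<longrightarrow> j < k \<longrightarrow> snd (c i) \<le> fst (c j))}"

lemma ordered_intervals_subset: "ordered_intervals k \<subseteq> topspace (little_intervals k)"
proof
  fix c assume c: "c \<in> ordered_intervals k"
  have "{fst (c i)<..<snd (c i)} \<inter> {fst (c j)<..<snd (c j)} = {}" if "i < k" "j < k" "i \<noteq> j" for i j
  proof -
    have "snd (c i) \<le> fst (c j) \<or> snd (c j) \<le> fst (c i)"
      using c that unfolding ordered_intervals_def by (cases i j rule: linorder_cases) auto
    then show ?thesis by auto
  qed
  then show "c \<in> topspace (little_intervals k)"
    using c by (auto simp: little_intervals_def ordered_intervals_def PiE_def)
qed

lemma even_intervals_ordered: "even_intervals k \<in> ordered_intervals k"
proof -
  have "real i + 1 \<le> real j" if "i < j" for i j using that by linarith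
  then show ?thesis
    unfolding ordered_intervals_def even_intervals_def by (auto simp: divide_simps)
qed

lemma ordered_intervals_convex:
  assumes c: "c \<in> ordered_intervals k" and d: "d \<in> ordered_intervals k" and t: "t \<in> {0..1}"
  shows "(\<lambda>i\<in>{..<k}. (1 - t) *\<^sub>R c i + t *\<^sub>R d i) \<in> ordered_intervals k"
proof -
  have mono: "(1 - t) * x + t * y \<le> (1 - t) * x' + t * y'" if "x \<le> x'" "y \<le> y'" for x y x' y' :: real
    using that t by (intro add_mono mult_left_mono) auto
  have 0: "0 \<le> (1 - t) * x + t * y" if "0 \<le> x" "0 \<le> y" for x y using mono[OF that] by simp
  have 1: "(1 - t) * x + t * y \<le> 1" if "x \<le> 1" "y \<le> 1" for x y using mono[OF that] by simp
  have strict: "(1 - t) * x + t * y < (1 - t) * x' + t * y'" if "x < x'" "y < y'" for x y x' y' :: real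
  proof (cases "t = 0")
    case False
    then have "t * y < t * y'" using that t by simp
    moreover have "(1 - t) * x \<le> (1 - t) * x'" using that t by (intro mult_left_mono) auto
    ultimately show ?thesis by linarith
  qed (use that in auto)
  show ?thesis
    using c d unfolding ordered_intervals_def by (auto intro!: mono 0 1 strict)
qed

lemma continuous_map_into_ordered_intervals:
  fixes Z :: "'e::topological_space set"
  assumes "\<And>z. z \<in> Z \<Longrightarrow> F z \<in> ordered_intervals k"
    and "\<And>i. i < k \<Longrightarrow> continuous_on Z (\<lambda>z. F z i)"
  shows "continuous_map (top_of_set Z) (little_intervals k) F"
  unfolding little_intervals_def
proof (rule continuous_map_into_subtopology)
  show "continuous_map (top_of_set Z) (product_topology (\<lambda>_. euclidean) {..<k}) F"
    unfolding continuous_map_componentwise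
    using assms by (auto simp: ordered_intervals_def)
  show "F \<in> topspace (top_of_set Z) \<rightarrow>
      {c. (\<forall>i<k. 0 \<le> fst (c i) \<and> fst (c i) < snd (c i) \<and> snd (c i) \<le> 1) \<and>
          (\<forall>i<k. \<forall>j<k. i \<noteq> j \<longrightarrow> {fst (c i)<..<snd (c i)} \<inter> {fst (c j)<..<snd (c j)} = {})}"
    using assms(1) ordered_intervals_subset[of k]
    unfolding little_intervals_def topspace_subtopology topspace_euclidean_subtopology by blast
qed

lemma restrict_ordered_intervals:
  "c \<in> ordered_intervals k \<Longrightarrow> (\<lambda>i\<in>{..<k}. c i) = c"
  by (simp add: ordered_intervals_def extensional_restrict)

lemma ordered_intervals_component:
  "ordered_intervals k \<subseteq> topspace (op_space ordered_intervals_operad k)"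
proof
  fix c assume c: "c \<in> ordered_intervals k"
  let ?Q = "\<lambda>t. \<lambda>i\<in>{..<k}. (1 - t) *\<^sub>R even_intervals k i + t *\<^sub>R c i"
  have "continuous_map (top_of_set {0..1}) (little_intervals k) ?Q"
  proof (rule continuous_map_into_ordered_intervals)
    show "?Q t \<in> ordered_intervals k" if "t \<in> {0..1}" for t
      by (rule ordered_intervals_convex[OF even_intervals_ordered c that])
  qed (auto intro!: continuous_intros)
  moreover have "?Q 0 = even_intervals k" "?Q 1 = c"
    using restrict_ordered_intervals[OF c] restrict_ordered_intervals[OF even_intervals_ordered] by simp_all
  ultimately have "path_component_of (little_intervals k) (even_intervals k) c"
    unfolding path_component_of_def pathin_def by blast
  then show "c \<in> topspace (op_space ordered_intervals_operad k)"
    using c ordered_intervals_subset by (auto simp: ordered_intervals_operad_def)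
qed

lemma affine_of_mono:
  assumes "fst c < snd c"
  shows "x \<le> y \<Longrightarrow> affine_of c x \<le> affine_of c y" "x < y \<Longrightarrow> affine_of c x < affine_of c y"
proof -
  have *: "affine_of c z = fst c + z * (snd c - fst c)" for z
    by (simp add: affine_of_def algebra_simps)
  show "x \<le> y \<Longrightarrow> affine_of c x \<le> affine_of c y" "x < y \<Longrightarrow> affine_of c x < affine_of c y"
    using assms unfolding * by (simp_all add: mult_right_mono)
qed

lemma affine_of_0 [simp]: "affine_of c 0 = fst c" and affine_of_1 [simp]: "affine_of c 1 = snd c"
  by (simp_all add: affine_of_def)

lemma affine_of_affine_of:
  "affine_of (affine_of c x, affine_of c y) t = affine_of c (affine_of (x, y) t)"
  by (simp add: affine_of_def algebra_simps)

lemma little_intervals_comp_nth: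
  assumes "i < length ms" "j < ms ! i"
  shows "little_intervals_comp ms c ds (block_pos ms i j) =
    (affine_of (c i) (fst ((ds ! i) j)), affine_of (c i) (snd ((ds ! i) j)))"
  using block_pos_less[OF assms] by (simp add: little_intervals_comp_def lex_pairs_nth assms)

lemma little_intervals_comp_extensional: "little_intervals_comp ms c ds \<in> extensional {..<sum_list ms}"
  by (simp add: little_intervals_comp_def)

lemma little_intervals_comp_eqI:
  assumes "e \<in> extensional {..<sum_list ms}"
    and "\<And>i j. i < length ms \<Longrightarrow> j < ms ! i \<Longrightarrow>
      e (block_pos ms i j) = (affine_of (c i) (fst ((ds ! i) j)), affine_of (c i) (snd ((ds ! i) j)))"
  shows "little_intervals_comp ms c ds = e"
proof (rule extensionalityI[OF little_intervals_comp_extensional assms(1)])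
  fix p assume "p \<in> {..<sum_list ms}"
  then obtain i j where ij: "i < length ms" "j < ms ! i" "p = block_pos ms i j"
    using block_pos_cases by blast
  then show "little_intervals_comp ms c ds p = e p" using little_intervals_comp_nth assms(2) by simp
qed

lemma little_intervals_comp_ordered:
  assumes c: "c \<in> ordered_intervals (length ms)"
    and ds: "list_all2 (\<lambda>m d. d \<in> ordered_intervals m) ms ds"
  shows "little_intervals_comp ms c ds \<in> ordered_intervals (sum_list ms)"
proof -
  let ?e = "little_intervals_comp ms c ds"
  have d: "0 \<le> fst ((ds ! i) j)" "fst ((ds ! i) j) < snd ((ds ! i) j)" "snd ((ds ! i) j) \<le> 1"
    if "i < length ms" "j < ms ! i" for i j
    using ds that by (auto simp: list_all2_conv_all_nth ordered_intervals_def)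
  have d': "snd ((ds ! i) j) \<le> fst ((ds ! i) j')" if "i < length ms" "j' < ms ! i" "j < j'" for i j j'
    using ds that by (auto simp: list_all2_conv_all_nth ordered_intervals_def)
  have c: "0 \<le> fst (c i)" "fst (c i) < snd (c i)" "snd (c i) \<le> 1" if "i < length ms" for i
    using c that by (auto simp: ordered_intervals_def)
  have c': "snd (c i) \<le> fst (c i')" if "i' < length ms" "i < i'" for i i'
    using assms(1) that by (auto simp: ordered_intervals_def)
  have af: "fst (c i) \<le> affine_of (c i) x" "affine_of (c i) x \<le> snd (c i)"
    if "i < length ms" "0 \<le> x" "x \<le> 1" for i x
    using affine_of_mono(1)[OF c(2)[OF that(1)], of 0 x] affine_of_mono(1)[OF c(2)[OF that(1)], of x 1] that
    by simp_all
  have e1: "0 \<le> fst (?e p) \<and> fst (?e p) < snd (?e p) \<and> snd (?e p) \<le> 1" if p: "p < sum_list ms" for p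
  proof -
    obtain i j where ij: "i < length ms" "j < ms ! i" "p = block_pos ms i j" using block_pos_cases[OF p] .
    have "0 \<le> fst ((ds ! i) j)" "fst ((ds ! i) j) \<le> 1" "0 \<le> snd ((ds ! i) j)" "snd ((ds ! i) j) \<le> 1"
      using d[OF ij(1,2)] by linarith+
    then show ?thesis
      using af[OF ij(1)] c[OF ij(1)] affine_of_mono(2)[OF c(2)[OF ij(1)] d(2)[OF ij(1,2)]] ij
      by (auto simp: little_intervals_comp_nth intro: order_trans)
  qed
  have e2: "snd (?e p) \<le> fst (?e p')" if p: "p < p'" "p' < sum_list ms" for p p'
  proof -
    obtain i' j' where ij': "i' < length ms" "j' < ms ! i'" "p' = block_pos ms i' j'"
      using block_pos_cases[OF p(2)] .
    obtain i j where ij: "i < length ms" "j < ms ! i" "p = block_pos ms i j"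
      using block_pos_cases[of p ms] p by auto
    consider "i < i'" | "i = i'" "j < j'" using block_pos_less_cases[of ms i j i' j'] p(1) ij ij' by auto
    then show ?thesis
    proof cases
      case 1
      have "affine_of (c i) (snd ((ds ! i) j)) \<le> snd (c i)"
        using af(2)[OF ij(1), of "snd ((ds ! i) j)"] d[OF ij(1,2)] by simp
      also have "\<dots> \<le> fst (c i')" using c' 1 ij' by blast
      also have "\<dots> \<le> affine_of (c i') (fst ((ds ! i') j'))"
        using af(1)[OF ij'(1), of "fst ((ds ! i') j')"] d[OF ij'(1,2)] by simp
      finally show ?thesis using ij ij' by (simp add: little_intervals_comp_nth)
    next
      case 2
      then show ?thesis
        using affine_of_mono(1)[OF c(2)[OF ij(1)] d'[OF ij(1)]] ij ij' by (simp add: little_intervals_comp_nth)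
    qed
  qed
  show ?thesis
    unfolding ordered_intervals_def using e1 e2 little_intervals_comp_extensional by blast
qed

lemma little_intervals_comp_assoc:
  assumes "length us = length nss" and "map length uss = map length nss"
  shows "little_intervals_comp (concat nss) (little_intervals_comp (map length nss) u us) (concat uss) =
    little_intervals_comp (map sum_list nss) u
      (map (\<lambda>i. little_intervals_comp (nss ! i) (us ! i) (uss ! i)) [0..<length nss])" (is "?l = ?r")
proof (rule sym, rule little_intervals_comp_eqI)
  have "sum_list (map sum_list nss) = sum_list (concat nss)" by (induction nss) auto
  then show "?l \<in> extensional {..<sum_list (map sum_list nss)}"
    using little_intervals_comp_extensional by simp
  fix i p assume i': "i < length (map sum_list nss)" and p: "p < map sum_list nss ! i"
  then have i: "i < length nss" by simp
  obtain j b where jb: "j < length (nss ! i)" "b < nss ! i ! j" "p = block_pos (nss ! i) j b"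
    using block_pos_cases[of p "nss ! i"] p i by auto
  let ?q = "block_pos (map length nss) i j"
  have q: "?q < length (concat nss)"
    using block_pos_less[of i "map length nss" j] i jb by (simp add: length_concat)
  have cq: "concat nss ! ?q = nss ! i ! j" using nth_concat_block_pos[of i nss j] i jb by simp
  have lu: "length uss = length nss" using assms(2) by (metis length_map)
  have "length (uss ! i) = length (nss ! i)" using assms(2) i lu by (metis nth_map)
  then have uq: "concat uss ! ?q = uss ! i ! j"
    using nth_concat_block_pos[of i uss j] i jb lu assms(2) by simp
  have "?l (block_pos (map sum_list nss) i p) =
    (affine_of (little_intervals_comp (map length nss) u us ?q) (fst ((uss ! i ! j) b)),
     affine_of (little_intervals_comp (map length nss) u us ?q) (snd ((uss ! i ! j) b)))"
    using little_intervals_comp_nth[of ?q "concat nss" b] q cq uq jb block_pos_assoc[OF i jb(1)] by simp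
  also have "little_intervals_comp (map length nss) u us ?q =
    (affine_of (u i) (fst ((us ! i) j)), affine_of (u i) (snd ((us ! i) j)))"
    using little_intervals_comp_nth[of i "map length nss" j] i jb by simp
  finally show "?l (block_pos (map sum_list nss) i p) =
      (affine_of (u i) (fst ((map (\<lambda>i. little_intervals_comp (nss ! i) (us ! i) (uss ! i)) [0..<length nss] ! i) p)),
       affine_of (u i) (snd ((map (\<lambda>i. little_intervals_comp (nss ! i) (us ! i) (uss ! i)) [0..<length nss] ! i) p)))"
    using i jb by (simp add: little_intervals_comp_nth affine_of_affine_of)
qed

lemma little_intervals_comp_unit_left:
  assumes "d \<in> ordered_intervals n"
  shows "little_intervals_comp [n] (even_intervals 1) [d] = d"
  by (rule little_intervals_comp_eqI)
     (use assms in \<open>auto simp: ordered_intervals_def block_pos_def even_intervals_def affine_of_def\<close>)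

lemma little_intervals_comp_unit_right:
  assumes "d \<in> ordered_intervals n"
  shows "little_intervals_comp (replicate n 1) d (replicate n (even_intervals 1)) = d"
  by (rule little_intervals_comp_eqI)
     (use assms in \<open>auto simp: ordered_intervals_def block_pos_def even_intervals_def sum_list_replicate min_def\<close>)

section \<open>Covering symmetric operads with a good base point\<close>

text \<open>
  The data of an arrow as a single object, so that arrows can serve as representatives.
\<close>

datatype 'a marked_path = Marked_Path
  (src: "nat \<Rightarrow> real \<times> real") (prm: "nat \<Rightarrow> nat") (tgt: "nat \<Rightarrow> real \<times> real") (pth: "real \<Rightarrow> 'a")

locale based_covering_operad =
  fixes C :: "'a operad"
    and act :: "nat \<Rightarrow> (nat \<Rightarrow> nat) \<Rightarrow> 'a \<Rightarrow> 'a"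
    and \<eta> :: "nat \<Rightarrow> (nat \<Rightarrow> real \<times> real) \<Rightarrow> 'a"
  assumes covering_operad: "covering_symmetric_operad C act"
    and basepoint_morphism: "good_basepoint C \<eta>"
begin

abbreviation X :: "nat \<Rightarrow> 'a topology" where "X \<equiv> op_space C"
abbreviation c\<^sub>0 :: "nat \<Rightarrow> nat \<Rightarrow> real \<times> real" where "c\<^sub>0 \<equiv> even_intervals"
abbreviation lin :: "nat \<Rightarrow> (nat \<Rightarrow> real \<times> real) \<Rightarrow> (nat \<Rightarrow> real \<times> real) \<Rightarrow> real \<Rightarrow> 'a"
  where "lin \<equiv> linear_path \<eta>"
abbreviation (input) glue :: "nat list \<Rightarrow> ('b \<Rightarrow> 'a) \<Rightarrow> ('b \<Rightarrow> 'a) list \<Rightarrow> 'b \<Rightarrow> 'a"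
  where "glue ms f gs \<equiv> (\<lambda>z. op_comp C ms (f z) (map (\<lambda>g. g z) gs))"
abbreviation (input) translate :: "nat \<Rightarrow> (nat \<Rightarrow> nat) \<Rightarrow> ('b \<Rightarrow> 'a) \<Rightarrow> 'b \<Rightarrow> 'a"
  where "translate k \<sigma> f \<equiv> (\<lambda>z. act k \<sigma> (f z))"

abbreviation "proj_class \<equiv> proj_path_class C act"
abbreviation "proj_sph_class \<equiv> proj_spheroid_class C act \<eta>"
abbreviation "lifts \<equiv> lifted_paths C act \<eta>"
abbreviation "sph_lifts \<equiv> lifted_spheroids C act \<eta>"
abbreviation "mul1 \<equiv> pi1_mult C act \<eta>"
abbreviation "one1 \<equiv> pi1_one C act \<eta>"
abbreviation "comp1 \<equiv> pi1_comp C act \<eta>"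
abbreviation "perm1 \<equiv> pi1_perm C act \<eta>"
abbreviation "compl \<equiv> pi_comp C act \<eta>"
abbreviation "actl \<equiv> pi_act C act \<eta>"
abbreviation "Pi1 \<equiv> pi1_operad C act \<eta>"

lemma symm_op: "is_operad_over symm_group_operad C act"
  using covering_operad by (simp add: covering_symmetric_operad_def symmetric_operad_def)

lemma operad_C: "is_operad C"
  using symm_op unfolding is_operad_over_def by (elim conjE) assumption

lemma group_operad_symm: "is_group_operad symm_group_operad"
  using symm_op unfolding is_operad_over_def by (elim conjE) assumption

sublocale cov: free_covering "symm_group n" "op_space C n" "act n" for n
proof (rule free_covering.intro)
  have 1: "\<forall>n. group_action (go_group symm_group_operad n) (op_pts C n)
      (\<lambda>g. restrict (act n g) (op_pts C n))"
    using symm_op unfolding is_operad_over_def by (elim conjE) assumption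
  have 2: "\<forall>n. \<forall>g\<in>op_pts symm_group_operad n. continuous_map (op_space C n) (op_space C n) (act n g)"
    using symm_op unfolding is_operad_over_def by (elim conjE) assumption
  show "group_action (symm_group n) (op_pts C n) (\<lambda>g. restrict (act n g) (op_pts C n))"
    using 1 by simp
  show "continuous_map (X n) (X n) (act n g)" if "g \<in> carrier (symm_group n)" for g
    using 2 that by simp
  show "covering_action (symm_group n) (X n) (act n)"
    using covering_operad by (simp add: covering_symmetric_operad_def)
qed

lemma act_id [simp]: "x \<in> op_pts C n \<Longrightarrow> act n id x = x"
  using cov.act_one[of x n] by simp

lemma act_comp:
  "\<sigma> permutes {..<n} \<Longrightarrow> \<tau> permutes {..<n} \<Longrightarrow> x \<in> op_pts C n \<Longrightarrow> act n (\<tau> \<circ> \<sigma>) x = act n \<sigma> (act n \<tau> x)"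
  using cov.act_mult[of \<sigma> n \<tau> x] by simp

lemma continuous_act: "\<sigma> permutes {..<n} \<Longrightarrow> continuous_map (X n) (X n) (act n \<sigma>)"
  using cov.continuous_act[of \<sigma> n] by simp

lemma act_closed: "\<sigma> permutes {..<n} \<Longrightarrow> x \<in> op_pts C n \<Longrightarrow> act n \<sigma> x \<in> op_pts C n"
  using cov.act_closed[of \<sigma> n x] by simp

lemma act_free:
  "\<sigma> permutes {..<n} \<Longrightarrow> \<tau> permutes {..<n} \<Longrightarrow> x \<in> op_pts C n \<Longrightarrow> act n \<sigma> x = act n \<tau> x \<Longrightarrow> \<sigma> = \<tau>"
  using cov.act_free[of \<sigma> n \<tau> x] by simp

lemma act_equivariant:
  assumes "\<sigma> permutes {..<length ms}" "list_all2 (\<lambda>m \<tau>. \<tau> permutes {..<m}) ms \<tau>s"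
    and "a \<in> op_pts C (length ms)" "list_all2 (\<lambda>m b. b \<in> op_pts C m) ms bs"
  shows "op_comp C ms (act (length ms) \<sigma> a) (map (\<lambda>i. act (ms ! i) (\<tau>s ! i) (bs ! i)) [0..<length ms]) =
    act (sum_list ms) (symm_comp ms \<sigma> \<tau>s) (op_comp C (permute_by \<sigma> ms) a (permute_by \<sigma> bs))"
proof -
  have *: "\<forall>ms. \<forall>s\<in>op_pts symm_group_operad (length ms). \<forall>ts\<in>op_tuples symm_group_operad ms.
       \<forall>a\<in>op_pts C (length ms). \<forall>bs\<in>op_tuples C ms.
       op_comp C ms (act (length ms) s a)
         (map (\<lambda>(m, t, b). act m t b) (zip ms (zip ts bs))) =
       act (sum_list ms) (op_comp symm_group_operad ms s ts)
         (let \<sigma> = go_perm symm_group_operad (length ms) s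
          in op_comp C (permute_by \<sigma> ms) a (permute_by \<sigma> bs))"
    using symm_op unfolding is_operad_over_def by (elim conjE) assumption
  have "\<sigma> \<in> op_pts symm_group_operad (length ms)" "\<tau>s \<in> op_tuples symm_group_operad ms" "bs \<in> op_tuples C ms"
    using assms by (simp_all add: op_tuples_iff)
  from *[rule_format, OF this(1,2) assms(3) this(3)] show ?thesis
    using assms(2,4)[THEN list_all2_lengthD] by (simp add: map_zip3[of ms "length ms"])
qed

lemma symm_comp_permutes:
  assumes "\<sigma> permutes {..<length ms}" "list_all2 (\<lambda>m \<tau>. \<tau> permutes {..<m}) ms \<tau>s"
  shows "symm_comp ms \<sigma> \<tau>s permutes {..<sum_list ms}"
proof -
  have "is_operad symm_group_operad"
    using group_operad_symm by (simp add: is_group_operad_def is_set_operad_def)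
  from operad_comp_closed[OF this, of \<sigma> ms \<tau>s] show ?thesis using assms by simp
qed

lemma symm_comp_assoc:
  assumes "\<sigma> permutes {..<length nss}" "list_all2 (\<lambda>ns \<tau>. \<tau> permutes {..<length ns}) nss \<tau>s"
    and "list_all2 (list_all2 (\<lambda>n \<kappa>. \<kappa> permutes {..<n})) nss \<kappa>ss"
  shows "symm_comp (concat nss) (symm_comp (map length nss) \<sigma> \<tau>s) (concat \<kappa>ss) =
    symm_comp (map sum_list nss) \<sigma> (map (\<lambda>i. symm_comp (nss ! i) (\<tau>s ! i) (\<kappa>ss ! i)) [0..<length nss])"
proof -
  have "is_operad symm_group_operad"
    using group_operad_symm by (simp add: is_group_operad_def is_set_operad_def)
  from operad_assoc[OF this, of \<sigma> nss \<tau>s \<kappa>ss] show ?thesis using assms by simp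
qed

lemma symm_comp_unit:
  assumes "\<sigma> permutes {..<n}"
  shows "symm_comp [n] id [\<sigma>] = \<sigma>" "symm_comp (replicate n 1) \<sigma> (replicate n id) = \<sigma>"
proof -
  have "is_operad symm_group_operad"
    using group_operad_symm by (simp add: is_group_operad_def is_set_operad_def)
  from operad_unit(2,3)[OF this, of \<sigma> n]
  show "symm_comp [n] id [\<sigma>] = \<sigma>" "symm_comp (replicate n 1) \<sigma> (replicate n id) = \<sigma>"
    using assms by simp_all
qed

lemma symm_comp_mult:
  assumes "\<sigma> permutes {..<length ms}" "\<sigma>' permutes {..<length ms}"
    and \<tau>s: "list_all2 (\<lambda>m \<tau>. \<tau> permutes {..<m}) ms \<tau>s" and \<tau>s': "list_all2 (\<lambda>m \<tau>. \<tau> permutes {..<m}) ms \<tau>s'"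
  shows "symm_comp ms (\<sigma>' \<circ> \<sigma>) (map (\<lambda>i. \<tau>s' ! i \<circ> \<tau>s ! i) [0..<length ms]) =
    symm_comp (permute_by \<sigma> ms) \<sigma>' (permute_by \<sigma> \<tau>s') \<circ> symm_comp ms \<sigma> \<tau>s"
proof -
  let ?G = "symm_group_operad"
  have *: "\<forall>ms. \<forall>a\<in>op_pts ?G (length ms). \<forall>a'\<in>op_pts ?G (length ms).
       \<forall>bs\<in>op_tuples ?G ms. \<forall>bs'\<in>op_tuples ?G ms.
       op_comp ?G ms (mult (go_group ?G (length ms)) a a')
         (map (\<lambda>(m, b, b'). mult (go_group ?G m) b b') (zip ms (zip bs bs'))) =
       mult (go_group ?G (sum_list ms)) (op_comp ?G ms a bs)
         (let \<sigma> = go_perm ?G (length ms) a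
          in op_comp ?G (permute_by \<sigma> ms) a' (permute_by \<sigma> bs'))"
    using group_operad_symm unfolding is_group_operad_def by (elim conjE) assumption
  have "\<sigma> \<in> op_pts ?G (length ms)" "\<sigma>' \<in> op_pts ?G (length ms)"
    "\<tau>s \<in> op_tuples ?G ms" "\<tau>s' \<in> op_tuples ?G ms"
    using assms by (simp_all add: op_tuples_iff)
  note eq = *[rule_format, OF this]
  have "map (\<lambda>(m, b, b'). mult (go_group ?G m) b b') (zip ms (zip \<tau>s \<tau>s')) =
      map (\<lambda>i. \<tau>s' ! i \<circ> \<tau>s ! i) [0..<length ms]"
    using \<tau>s[THEN list_all2_lengthD] \<tau>s'[THEN list_all2_lengthD] by (intro nth_equalityI) auto
  from eq[unfolded this] show ?thesis by simp
qed

section \<open>Paths in the image of the ordered configurations\<close>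

lemma eta_continuous:
  fixes Z :: "'e::topological_space set"
  assumes "\<And>z. z \<in> Z \<Longrightarrow> F z \<in> ordered_intervals k"
    and "\<And>i. i < k \<Longrightarrow> continuous_on Z (\<lambda>z. F z i)"
  shows "continuous_map (top_of_set Z) (X k) (\<lambda>z. \<eta> k (F z))"
proof -
  have "continuous_map (op_space ordered_intervals_operad k) (X k) (\<eta> k)"
    using basepoint_morphism by (simp add: good_basepoint_def operad_morphism_def)
  moreover have "continuous_map (top_of_set Z) (op_space ordered_intervals_operad k) F"
    using continuous_map_into_ordered_intervals[OF assms] assms(1) ordered_intervals_component[of k]
    unfolding ordered_intervals_operad_def by (auto simp: continuous_map_in_subtopology)
  ultimately have "continuous_map (top_of_set Z) (X k) (\<eta> k \<circ> F)"
    by (rule continuous_map_compose[rotated])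
  then show ?thesis by (simp add: o_def)
qed

lemma eta_closed: "u \<in> ordered_intervals k \<Longrightarrow> \<eta> k u \<in> op_pts C k"
  using basepoint_morphism ordered_intervals_component[of k]
  by (auto simp: good_basepoint_def operad_morphism_def continuous_map_def)

lemma eta_comp:
  assumes "u \<in> ordered_intervals (length ms)" "list_all2 (\<lambda>m u. u \<in> ordered_intervals m) ms us"
  shows "\<eta> (sum_list ms) (little_intervals_comp ms u us) =
    op_comp C ms (\<eta> (length ms) u) (map (\<lambda>i. \<eta> (ms ! i) (us ! i)) [0..<length ms])"
proof -
  have *: "\<forall>ms. \<forall>a\<in>op_pts ordered_intervals_operad (length ms). \<forall>bs\<in>op_tuples ordered_intervals_operad ms.
       \<eta> (sum_list ms) (op_comp ordered_intervals_operad ms a bs) = op_comp C ms (\<eta> (length ms) a) (map2 \<eta> ms bs)"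
    using basepoint_morphism unfolding good_basepoint_def operad_morphism_def by (elim conjE) assumption
  have "us \<in> op_tuples ordered_intervals_operad ms"
    using assms(2) ordered_intervals_component unfolding op_tuples_iff by (auto elim!: list_all2_mono)
  moreover have "u \<in> op_pts ordered_intervals_operad (length ms)"
    using assms(1) ordered_intervals_component by blast
  moreover have "op_comp ordered_intervals_operad = little_intervals_comp"
    by (simp add: ordered_intervals_operad_def little_intervals_operad_def)
  ultimately show ?thesis
    using * list_all2_lengthD[OF assms(2)] by (simp add: map2_nth[of ms "length ms"])
qed

lemma eta_unit: "\<eta> 1 (c\<^sub>0 1) = op_unit C"
proof -
  have "op_unit ordered_intervals_operad = c\<^sub>0 1"
    by (auto simp: ordered_intervals_operad_def little_intervals_operad_def even_intervals_def restrict_def)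
  then show ?thesis
    using basepoint_morphism unfolding good_basepoint_def operad_morphism_def by metis
qed

definition eta_path :: "nat \<Rightarrow> (nat \<Rightarrow> real \<times> real) \<Rightarrow> (nat \<Rightarrow> real \<times> real) \<Rightarrow> (real \<Rightarrow> 'a) \<Rightarrow> bool"
  where "eta_path k u v f \<longleftrightarrow> (\<exists>Q. (\<forall>t\<in>{0..1}. Q t \<in> ordered_intervals k) \<and>
    (\<forall>i<k. continuous_on {0..1} (\<lambda>t. Q t i)) \<and> Q 0 = u \<and> Q 1 = v \<and> (\<forall>t\<in>{0..1}. f t = \<eta> k (Q t)))"

lemma eta_path_props:
  assumes "eta_path k u v f"
  shows "pathin (X k) f" "f 0 = \<eta> k u" "f 1 = \<eta> k v" "u \<in> ordered_intervals k" "v \<in> ordered_intervals k"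
proof -
  obtain Q where Q: "\<forall>t\<in>{0..1}. Q t \<in> ordered_intervals k" "\<forall>i<k. continuous_on {0..1} (\<lambda>t. Q t i)"
    "Q 0 = u" "Q 1 = v" "\<forall>t\<in>{0..1::real}. f t = \<eta> k (Q t)"
    using assms unfolding eta_path_def by blast
  have "continuous_map (top_of_set {0..1}) (X k) (\<lambda>t. \<eta> k (Q t))"
    by (rule eta_continuous) (use Q in auto)
  then show "pathin (X k) f"
    unfolding pathin_def by (rule continuous_map_eq) (use Q in auto)
  show "f 0 = \<eta> k u" "f 1 = \<eta> k v" "u \<in> ordered_intervals k" "v \<in> ordered_intervals k"
    using Q by auto
qed

text \<open>
  The straight-line homotopy between the two paths of configurations is carried over by \<open>\<eta>\<close>.  It
  matters that the ends agree as configurations and not only after applying \<open>\<eta>\<close>: the image of a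
  path between configurations with the same image need not be contractible.
\<close>

lemma eta_path_unique:
  assumes "eta_path k u v f" "eta_path k u v g"
  shows "path_homotopic (X k) f g"
proof -
  obtain Q where Q: "\<forall>t\<in>{0..1}. Q t \<in> ordered_intervals k" "\<forall>i<k. continuous_on {0..1} (\<lambda>t. Q t i)"
    "Q 0 = u" "Q 1 = v" "\<forall>t\<in>{0..1::real}. f t = \<eta> k (Q t)"
    using assms unfolding eta_path_def by blast
  obtain R where R: "\<forall>t\<in>{0..1}. R t \<in> ordered_intervals k" "\<forall>i<k. continuous_on {0..1} (\<lambda>t. R t i)"
    "R 0 = u" "R 1 = v" "\<forall>t\<in>{0..1::real}. g t = \<eta> k (R t)"
    using assms unfolding eta_path_def by blast
  let ?H = "\<lambda>x. \<lambda>i\<in>{..<k}. (1 - fst x) *\<^sub>R Q (snd x) i + fst x *\<^sub>R R (snd x) i"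
  have "continuous_map (top_of_set ({0..1::real} \<times> {0..1::real})) (X k) (\<lambda>x. \<eta> k (?H x))"
  proof (rule eta_continuous)
    show "?H x \<in> ordered_intervals k" if "x \<in> {0..1} \<times> {0..1}" for x
      by (rule ordered_intervals_convex) (use Q(1) R(1) that in auto)
    fix i assume i: "i < k"
    have "continuous_on ({0..1::real} \<times> {0..1}) (\<lambda>x. Q (snd x) i)"
      by (rule continuous_on_compose2[of "{0..1}" "\<lambda>t. Q t i"]) (use Q(2) i in \<open>auto intro!: continuous_intros\<close>)
    moreover have "continuous_on ({0..1::real} \<times> {0..1}) (\<lambda>x. R (snd x) i)"
      by (rule continuous_on_compose2[of "{0..1}" "\<lambda>t. R t i"]) (use R(2) i in \<open>auto intro!: continuous_intros\<close>)
    ultimately show "continuous_on ({0..1} \<times> {0..1}) (\<lambda>x. ?H x i)"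
      using i by (auto intro!: continuous_intros)
  qed
  moreover have "(\<lambda>i\<in>{..<k}. Q t i) = Q t" "(\<lambda>i\<in>{..<k}. R t i) = R t" if "t \<in> {0..1}" for t
    using restrict_ordered_intervals Q(1) R(1) that by blast+
  moreover have "(1 - t) *\<^sub>R x + t *\<^sub>R x = x" for t :: real and x :: "real \<times> real"
    by (simp flip: scaleR_left_distrib)
  ultimately show ?thesis
    using Q(3-5) R(3-5) by (intro homotopic_relI) auto
qed

lemma eta_path_linear:
  assumes "u \<in> ordered_intervals k" "v \<in> ordered_intervals k"
  shows "eta_path k u v (lin k u v)"
  unfolding eta_path_def
proof (intro exI conjI ballI allI impI)
  let ?Q = "\<lambda>t. \<lambda>i\<in>{..<k}. (1 - t) *\<^sub>R u i + t *\<^sub>R v i"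
  show "?Q t \<in> ordered_intervals k" if "t \<in> {0..1}" for t
    by (rule ordered_intervals_convex[OF assms that])
  show "continuous_on {0..1} (\<lambda>t. ?Q t i)" if "i < k" for i
    using that by (auto intro!: continuous_intros)
  show "?Q 0 = u" "?Q 1 = v" using assms by (simp_all add: restrict_ordered_intervals)
  show "lin k u v t = \<eta> k (?Q t)" for t by (simp add: linear_path_def)
qed

lemma eta_path_const: "u \<in> ordered_intervals k \<Longrightarrow> eta_path k u u (\<lambda>_. \<eta> k u)"
  unfolding eta_path_def by (intro exI[of _ "\<lambda>_. u"]) auto

lemma eta_path_join:
  assumes "eta_path k u v f" "eta_path k v w g"
  shows "eta_path k u w (path_join f g)"
proof -
  obtain Q where Q: "\<forall>t\<in>{0..1}. Q t \<in> ordered_intervals k" "\<forall>i<k. continuous_on {0..1} (\<lambda>t. Q t i)"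
    "Q 0 = u" "Q 1 = v" "\<forall>t\<in>{0..1::real}. f t = \<eta> k (Q t)"
    using assms(1) unfolding eta_path_def by blast
  obtain R where R: "\<forall>t\<in>{0..1}. R t \<in> ordered_intervals k" "\<forall>i<k. continuous_on {0..1} (\<lambda>t. R t i)"
    "R 0 = v" "R 1 = w" "\<forall>t\<in>{0..1::real}. g t = \<eta> k (R t)"
    using assms(2) unfolding eta_path_def by blast
  have "continuous_on {0..1} (\<lambda>t. path_join Q R t i)" if "i < k" for i
  proof -
    have "pathin euclidean (path_join (\<lambda>t. Q t i) (\<lambda>t. R t i))"
      by (rule pathin_path_join) (use Q R that in \<open>auto simp: pathin_def\<close>)
    moreover have "path_join (\<lambda>t. Q t i) (\<lambda>t. R t i) = (\<lambda>t. path_join Q R t i)"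
      by (auto simp: path_join_def)
    ultimately show ?thesis by (simp add: pathin_def)
  qed
  then show ?thesis
    unfolding eta_path_def using Q R by (intro exI[of _ "path_join Q R"]) (auto simp: path_join_def)
qed

lemma eta_path_rev:
  assumes "eta_path k u v f"
  shows "eta_path k v u (path_rev f)"
proof -
  obtain Q where Q: "\<forall>t\<in>{0..1}. Q t \<in> ordered_intervals k" "\<forall>i<k. continuous_on {0..1} (\<lambda>t. Q t i)"
    "Q 0 = u" "Q 1 = v" "\<forall>t\<in>{0..1::real}. f t = \<eta> k (Q t)"
    using assms unfolding eta_path_def by blast
  have "continuous_on {0..1} (\<lambda>t. Q (1 - t) i)" if "i < k" for i
    by (rule continuous_on_compose2[of "{0..1}" "\<lambda>t. Q t i"]) (use Q that in \<open>auto intro!: continuous_intros\<close>)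
  then show ?thesis
    unfolding eta_path_def using Q by (intro exI[of _ "path_rev Q"]) (auto simp: path_rev_def)
qed

lemma eta_path_glue:
  assumes f: "eta_path (length ms) u v f"
    and len: "length us = length ms" "length vs = length ms" "length gs = length ms"
    and gs: "\<And>i. i < length ms \<Longrightarrow> eta_path (ms ! i) (us ! i) (vs ! i) (gs ! i)"
  shows "eta_path (sum_list ms) (little_intervals_comp ms u us) (little_intervals_comp ms v vs) (glue ms f gs)"
proof -
  obtain Q where Q: "\<forall>t\<in>{0..1}. Q t \<in> ordered_intervals (length ms)"
    "\<forall>i<length ms. continuous_on {0..1} (\<lambda>t. Q t i)"
    "Q 0 = u" "Q 1 = v" "\<forall>t\<in>{0..1::real}. f t = \<eta> (length ms) (Q t)"
    using f unfolding eta_path_def by blast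
  have "\<forall>i. \<exists>R. i < length ms \<longrightarrow> (\<forall>t\<in>{0..1}. R t \<in> ordered_intervals (ms ! i)) \<and>
    (\<forall>j<ms ! i. continuous_on {0..1} (\<lambda>t. R t j)) \<and> R 0 = us ! i \<and> R 1 = vs ! i \<and>
    (\<forall>t\<in>{0..1::real}. (gs ! i) t = \<eta> (ms ! i) (R t))"
    using gs unfolding eta_path_def by meson
  then obtain R where R: "\<And>i. i < length ms \<Longrightarrow> (\<forall>t\<in>{0..1}. R i t \<in> ordered_intervals (ms ! i)) \<and>
    (\<forall>j<ms ! i. continuous_on {0..1} (\<lambda>t. R i t j)) \<and> R i 0 = us ! i \<and> R i 1 = vs ! i \<and>
    (\<forall>t\<in>{0..1::real}. (gs ! i) t = \<eta> (ms ! i) (R i t))"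
    by metis
  let ?R = "\<lambda>t. map (\<lambda>i. R i t) [0..<length ms]"
  let ?P = "\<lambda>t. little_intervals_comp ms (Q t) (?R t)"
  have Rl: "list_all2 (\<lambda>m r. r \<in> ordered_intervals m) ms (?R t)" if "t \<in> {0..1}" for t
    using R that by (auto simp: list_all2_conv_all_nth)
  show ?thesis
    unfolding eta_path_def
  proof (intro exI conjI ballI allI impI)
    show "?P t \<in> ordered_intervals (sum_list ms)" if "t \<in> {0..1}" for t
      using little_intervals_comp_ordered Q(1) Rl that by blast
    show "continuous_on {0..1} (\<lambda>t. ?P t p)" if p: "p < sum_list ms" for p
    proof -
      obtain i j where ij: "i < length ms" "j < ms ! i" "p = block_pos ms i j" using block_pos_cases[OF p] .
      have c: "continuous_on {0..1} (\<lambda>t. Q t i)" "continuous_on {0..1} (\<lambda>t. R i t j)" using Q(2) R ij by auto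
      show ?thesis
        using ij(1) unfolding ij(3) little_intervals_comp_nth[OF ij(1,2)] affine_of_def
        by (auto intro!: continuous_intros c)
    qed
    have "map (\<lambda>i. R i 0) [0..<length ms] = us" "map (\<lambda>i. R i 1) [0..<length ms] = vs"
      using R len by (auto intro!: nth_equalityI)
    then show "?P 0 = little_intervals_comp ms u us" "?P 1 = little_intervals_comp ms v vs"
      using Q by simp_all
    show "glue ms f gs t = \<eta> (sum_list ms) (?P t)" if t: "t \<in> {0..1}" for t
    proof -
      have "map (\<lambda>i. \<eta> (ms ! i) (?R t ! i)) [0..<length ms] = map (\<lambda>g. g t) gs"
        using R len t by (intro nth_equalityI) auto
      then show ?thesis
        using eta_comp[OF bspec[OF Q(1) t] Rl[OF t]] Q(5) t by simp
    qed
  qed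
qed

lemma list_all2_even: "list_all2 (\<lambda>m u. u \<in> ordered_intervals m) ms (map c\<^sub>0 ms)"
  by (simp add: list_all2_conv_all_nth even_intervals_ordered)

lemma eta_path_base_path:
  "eta_path (sum_list ms) (c\<^sub>0 (sum_list ms)) (little_intervals_comp ms (c\<^sub>0 (length ms)) (map c\<^sub>0 ms)) (base_path \<eta> ms)"
  unfolding base_path_def
  by (intro eta_path_linear even_intervals_ordered little_intervals_comp_ordered list_all2_even)

lemma basepoint_eq: "basepoint \<eta> k = \<eta> k (c\<^sub>0 k)"
  by (simp add: basepoint_def)

lemma basepoint_closed: "basepoint \<eta> k \<in> op_pts C k"
  by (simp add: basepoint_eq eta_closed even_intervals_ordered)

lemma glue_homotopic:
  assumes f: "homotopic_rel Z A (X (length ms)) f f'" and A: "A \<subseteq> Z"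
    and len: "length gs = length ms" "length gs' = length ms"
    and gs: "\<And>i. i < length ms \<Longrightarrow> homotopic_rel Z A (X (ms ! i)) (gs ! i) (gs' ! i)"
  shows "homotopic_rel Z A (X (sum_list ms)) (glue ms f gs) (glue ms f' gs')"
proof -
  obtain F where F: "continuous_map (top_of_set ({0..1::real} \<times> Z)) (X (length ms)) F"
    "\<And>s. F (0, s) = f s" "\<And>s. F (1, s) = f' s" "\<And>t s. t \<in> {0..1} \<Longrightarrow> s \<in> A \<Longrightarrow> F (t, s) = f s"
    using homotopic_relE[OF f] by blast
  have "\<forall>i. \<exists>G. i < length ms \<longrightarrow> continuous_map (top_of_set ({0..1::real} \<times> Z)) (X (ms ! i)) G \<and>
    (\<forall>s. G (0, s) = (gs ! i) s) \<and> (\<forall>s. G (1, s) = (gs' ! i) s) \<and>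
    (\<forall>t s. t \<in> {0..1} \<longrightarrow> s \<in> A \<longrightarrow> G (t, s) = (gs ! i) s)"
    using homotopic_relE[OF gs] by metis
  then obtain G where G: "\<And>i. i < length ms \<Longrightarrow> continuous_map (top_of_set ({0..1::real} \<times> Z)) (X (ms ! i)) (G i) \<and>
    (\<forall>s. G i (0, s) = (gs ! i) s) \<and> (\<forall>s. G i (1, s) = (gs' ! i) s) \<and>
    (\<forall>t s. t \<in> {0..1} \<longrightarrow> s \<in> A \<longrightarrow> G i (t, s) = (gs ! i) s)"
    by metis
  let ?G = "map G [0..<length ms]"
  have "continuous_map (top_of_set ({0..1::real} \<times> Z)) (X (sum_list ms)) (glue ms F ?G)"
    by (rule continuous_map_op_comp[OF operad_C F(1)]) (use G in \<open>auto simp: list_all2_conv_all_nth\<close>)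
  moreover have "map (\<lambda>g. g (0, s)) ?G = map (\<lambda>g. g s) gs" "map (\<lambda>g. g (1, s)) ?G = map (\<lambda>g. g s) gs'" for s
    using G len by (auto intro!: nth_equalityI)
  moreover have "map (\<lambda>g. g (t, s)) ?G = map (\<lambda>g. g s) gs" if "t \<in> {0..1}" "s \<in> A" for t s
    using G len that by (intro nth_equalityI) auto
  ultimately show ?thesis
    using F by (intro homotopic_relI[OF A]) auto
qed

section \<open>Classes of paths between translates of ordered configurations\<close>

abbreviation Q :: "nat \<Rightarrow> 'a set topology" where "Q \<equiv> orbit_space C act"
abbreviation q :: "nat \<Rightarrow> 'a \<Rightarrow> 'a set" where "q \<equiv> orbit_map act"
abbreviation \<pi>\<^sub>1 :: "nat \<Rightarrow> (real \<Rightarrow> 'a set) set set"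
  where "\<pi>\<^sub>1 k \<equiv> fundamental_group_set (orbit_space C act k) (orbit_base act \<eta> k)"

lemma q_eq: "q k = cov.proj k" and Q_eq: "Q k = cov.quot k"
  by (simp_all add: orbit_map_def orbit_space_def)

lemma q_eq_iff: "x \<in> op_pts C k \<Longrightarrow> y \<in> op_pts C k \<Longrightarrow> q k x = q k y \<longleftrightarrow> (\<exists>\<sigma>. \<sigma> permutes {..<k} \<and> y = act k \<sigma> x)"
  using cov.proj_eq_iff[of x k y] by (auto simp: q_eq)

lemma q_act: "\<sigma> permutes {..<k} \<Longrightarrow> x \<in> op_pts C k \<Longrightarrow> q k (act k \<sigma> x) = q k x"
  using cov.proj_act[of \<sigma> k x] by (simp add: q_eq)

lemma continuous_q: "continuous_map (X k) (Q k) (q k)"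
  using cov.continuous_proj by (simp add: q_eq Q_eq)

lemma orbit_base_eq: "orbit_base act \<eta> k = q k (basepoint \<eta> k)"
  by (simp add: orbit_base_def)

lemma in_orbit_base_iff: "x \<in> orbit_base act \<eta> k \<longleftrightarrow> (\<exists>\<sigma>. \<sigma> permutes {..<k} \<and> x = act k \<sigma> (basepoint \<eta> k))"
  by (auto simp: orbit_base_def orbit_map_def orbit_def)

lemma pathin_closed: "pathin (X k) f \<Longrightarrow> t \<in> {0..1} \<Longrightarrow> f t \<in> op_pts C k"
  by (auto simp: pathin_def continuous_map_def)

lemma translate_homotopic:
  "homotopic_rel Z A (X k) f g \<Longrightarrow> \<sigma> permutes {..<k} \<Longrightarrow> homotopic_rel Z A (X k) (translate k \<sigma> f) (translate k \<sigma> g)"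
  using homotopic_rel_compose[OF _ continuous_act] by blast

lemma pathin_translate: "pathin (X k) f \<Longrightarrow> \<sigma> permutes {..<k} \<Longrightarrow> pathin (X k) (translate k \<sigma> f)"
  using continuous_map_compose[of "top_of_set {0..1}" "X k" f "X k" "act k \<sigma>"] continuous_act
  by (simp add: pathin_def o_def)

lemma translate_path_join: "translate k \<sigma> (path_join f g) = path_join (translate k \<sigma> f) (translate k \<sigma> g)"
  by (auto simp: path_join_def)

lemma translate_change_base: "translate k \<sigma> (change_base u f) = change_base (translate k \<sigma> u) (translate k \<sigma> f)"
  by (auto simp: change_base_def Let_def)

lemma glue_path_join:
  "glue ms (path_join f g) (map (\<lambda>i. path_join (fs i) (gs i)) [0..<k]) =
    path_join (glue ms f (map fs [0..<k])) (glue ms g (map gs [0..<k]))"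
  by (auto simp: path_join_def o_def)

lemma glue_change_base:
  "glue ms (change_base u f) (map (\<lambda>i. change_base (us i) (fs i)) [0..<k]) =
    change_base (glue ms u (map us [0..<k])) (glue ms f (map fs [0..<k]))"
  by (auto simp: change_base_def Let_def o_def)

lemma glue_translate:
  assumes "\<sigma> permutes {..<length ms}" "list_all2 (\<lambda>m \<tau>. \<tau> permutes {..<m}) ms \<tau>s"
    and f: "f z \<in> op_pts C (length ms)" and len: "length gs = length ms"
    and gs: "\<And>i. i < length ms \<Longrightarrow> (gs ! i) z \<in> op_pts C (ms ! i)"
  shows "glue ms (translate (length ms) \<sigma> f) (map (\<lambda>i. translate (ms ! i) (\<tau>s ! i) (gs ! i)) [0..<length ms]) z =
    translate (sum_list ms) (symm_comp ms \<sigma> \<tau>s) (glue (permute_by \<sigma> ms) f (permute_by \<sigma> gs)) z"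
proof -
  have "list_all2 (\<lambda>m b. b \<in> op_pts C m) ms (map (\<lambda>g. g z) gs)"
    using len gs by (auto simp: list_all2_conv_all_nth)
  from act_equivariant[OF assms(1,2) f this]
  have "op_comp C ms (act (length ms) \<sigma> (f z)) (map (\<lambda>i. act (ms ! i) (\<tau>s ! i) (map (\<lambda>g. g z) gs ! i)) [0..<length ms]) =
    act (sum_list ms) (symm_comp ms \<sigma> \<tau>s) (op_comp C (permute_by \<sigma> ms) (f z) (map (\<lambda>g. g z) (permute_by \<sigma> gs)))"
    using permute_by_map[of \<sigma> gs "\<lambda>g. g z"] assms(1) len by simp
  moreover have "map (\<lambda>i. act (ms ! i) (\<tau>s ! i) (map (\<lambda>g. g z) gs ! i)) [0..<length ms] =
      map (\<lambda>g. g z) (map (\<lambda>i. translate (ms ! i) (\<tau>s ! i) (gs ! i)) [0..<length ms])"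
    using len by (intro nth_equalityI) auto
  ultimately show ?thesis by simp
qed

lemma pathin_glue:
  assumes "pathin (X (length ms)) f" "length gs = length ms"
    and "\<And>i. i < length ms \<Longrightarrow> pathin (X (ms ! i)) (gs ! i)"
  shows "pathin (X (sum_list ms)) (glue ms f gs)"
  using continuous_map_op_comp[OF operad_C assms(1)[unfolded pathin_def], of gs] assms(2,3)
  by (auto simp: pathin_def list_all2_conv_all_nth)

text \<open>
  The ends carry the configurations \<open>u\<close> and \<open>v\<close> as marks, because the way back to the base point
  depends on them.
\<close>

definition arrow :: "nat \<Rightarrow> (nat \<Rightarrow> real \<times> real) \<Rightarrow> (nat \<Rightarrow> nat) \<Rightarrow> (nat \<Rightarrow> real \<times> real) \<Rightarrow> (real \<Rightarrow> 'a) \<Rightarrow> bool"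
  where "arrow k u \<sigma> v f \<longleftrightarrow> u \<in> ordered_intervals k \<and> v \<in> ordered_intervals k \<and> \<sigma> permutes {..<k} \<and>
    pathin (X k) f \<and> f 0 = \<eta> k u \<and> f 1 = act k \<sigma> (\<eta> k v)"

definition close_up :: "nat \<Rightarrow> (nat \<Rightarrow> real \<times> real) \<Rightarrow> (nat \<Rightarrow> nat) \<Rightarrow> (nat \<Rightarrow> real \<times> real) \<Rightarrow> (real \<Rightarrow> 'a) \<Rightarrow> real \<Rightarrow> 'a"
  where "close_up k u \<sigma> v f =
    path_join (lin k (c\<^sub>0 k) u) (path_join f (translate k \<sigma> (lin k v (c\<^sub>0 k))))"

definition arrow_class :: "nat \<Rightarrow> (nat \<Rightarrow> real \<times> real) \<Rightarrow> (nat \<Rightarrow> nat) \<Rightarrow> (nat \<Rightarrow> real \<times> real) \<Rightarrow> (real \<Rightarrow> 'a) \<Rightarrow> (real \<Rightarrow> 'a set) set"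
  where "arrow_class k u \<sigma> v f = proj_class k (close_up k u \<sigma> v f)"

lemma lin_props:
  assumes "u \<in> ordered_intervals k" "v \<in> ordered_intervals k"
  shows "pathin (X k) (lin k u v)" "lin k u v 0 = \<eta> k u" "lin k u v 1 = \<eta> k v"
  using eta_path_props[OF eta_path_linear[OF assms]] by simp_all

lemma proj_path_class_eq: "proj_class k f = homotopy_class_rel {0..1} {0, 1} (Q k) (\<lambda>t. q k (f t))"
  by (simp add: proj_path_class_def path_class_eq o_def)

lemma proj_path_class_eqI:
  "path_homotopic (X k) f g \<Longrightarrow> proj_class k f = proj_class k g"
  unfolding proj_path_class_eq by (rule homotopy_class_rel_eqI[OF homotopic_rel_compose[OF _ continuous_q]])

text \<open>
  Homotopies in the orbit space lift, so on paths with a common starting point passing to the orbit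
  space loses no information.
\<close>

lemma proj_path_class_eqD:
  assumes eq: "proj_class k f = proj_class k g"
    and "pathin (X k) f" "pathin (X k) g" "f 0 = g 0"
  shows "path_homotopic (X k) f g"
proof -
  have "continuous_map (top_of_set {0..1}) (Q k) (\<lambda>t. q k (g t))"
    using continuous_map_compose[OF assms(3)[unfolded pathin_def] continuous_q] by (simp add: o_def)
  then have "path_homotopic (Q k) (\<lambda>t. q k (f t)) (\<lambda>t. q k (g t))"
    using eq unfolding proj_path_class_eq by (rule homotopy_class_rel_eqD[rotated])
  then have "homotopic_rel (cbox 0 1) {0, 1} (cov.quot k) (\<lambda>t. cov.proj k (f t)) (\<lambda>t. cov.proj k (g t))"
    by (simp add: q_eq Q_eq)
  then have "homotopic_rel (cbox 0 1) {0, 1} (X k) f g"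
    by (rule cov.lift_homotopic_rel[rotated 3, where ?s0.0 = 0]) (use assms in \<open>simp_all add: pathin_def\<close>)
  then show ?thesis by simp
qed

lemma end_perm_eq:
  assumes "\<sigma> permutes {..<k}" "f 1 = act k \<sigma> (basepoint \<eta> k)"
  shows "end_perm act \<eta> k f = \<sigma>"
  unfolding end_perm_def
proof (rule the_equality)
  show "\<tau> = \<sigma>" if "\<tau> \<in> carrier (symm_group k) \<and> f 1 = act k \<tau> (basepoint \<eta> k)" for \<tau>
  proof (rule act_free[OF _ assms(1) basepoint_closed])
    show "\<tau> permutes {..<k}" using that by simp
    show "act k \<tau> (basepoint \<eta> k) = act k \<sigma> (basepoint \<eta> k)" using that assms(2) by metis
  qed
qed (use assms in auto)

lemma arrow_close_up:
  assumes "arrow k u \<sigma> v f"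
  shows "arrow k (c\<^sub>0 k) \<sigma> (c\<^sub>0 k) (close_up k u \<sigma> v f)"
proof -
  have u: "u \<in> ordered_intervals k" "v \<in> ordered_intervals k" "\<sigma> permutes {..<k}" "pathin (X k) f"
    "f 0 = \<eta> k u" "f 1 = act k \<sigma> (\<eta> k v)" using assms by (auto simp: arrow_def)
  note l = lin_props[OF even_intervals_ordered u(1)] lin_props[OF u(2) even_intervals_ordered]
  have "pathin (X k) (close_up k u \<sigma> v f)"
    unfolding close_up_def
    by (intro pathin_path_join pathin_translate) (use l u in simp_all)
  then show ?thesis
    using l u by (simp add: arrow_def close_up_def even_intervals_ordered)
qed

lemma lifted_paths_base:
  assumes "arrow k (c\<^sub>0 k) \<sigma> (c\<^sub>0 k) N"
  shows "N \<in> lifts k (proj_class k N)"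
  using assms by (auto simp: lifted_paths_def arrow_def basepoint_eq in_orbit_base_iff)

lemma lifted_pathsD:
  assumes N: "arrow k (c\<^sub>0 k) \<sigma> (c\<^sub>0 k) N" and F: "F \<in> lifts k (proj_class k N)"
  shows "path_homotopic (X k) F N" "end_perm act \<eta> k F = \<sigma>"
proof -
  show *: "path_homotopic (X k) F N"
    by (rule proj_path_class_eqD) (use F N in \<open>auto simp: lifted_paths_def arrow_def basepoint_eq\<close>)
  have "F 1 = N 1" using homotopic_rel_imp_eq[OF *, of 1] by simp
  then show "end_perm act \<eta> k F = \<sigma>"
    using N by (intro end_perm_eq) (auto simp: arrow_def basepoint_eq)
qed

lemma arrow_class_lifted:
  assumes "arrow k u \<sigma> v f"
  shows "close_up k u \<sigma> v f \<in> lifts k (arrow_class k u \<sigma> v f)"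
    and "F \<in> lifts k (arrow_class k u \<sigma> v f) \<Longrightarrow> path_homotopic (X k) F (close_up k u \<sigma> v f)"
    and "F \<in> lifts k (arrow_class k u \<sigma> v f) \<Longrightarrow> end_perm act \<eta> k F = \<sigma>"
  unfolding arrow_class_def using arrow_close_up[OF assms] lifted_paths_base lifted_pathsD by blast+

lemma arrow_class_perm:
  assumes "arrow k u \<sigma> v f"
  shows "perm1 k (arrow_class k u \<sigma> v f) = \<sigma>"
  unfolding pi1_perm_def
proof (rule the_equality)
  show "\<exists>F\<in>lifts k (arrow_class k u \<sigma> v f). \<sigma> = end_perm act \<eta> k F"
    using arrow_class_lifted(1,3)[OF assms] by metis
qed (use arrow_class_lifted(3)[OF assms] in metis)

lemma arrow_class_cong:
  assumes "arrow k u \<sigma> v f" "path_homotopic (X k) f g"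
  shows "arrow k u \<sigma> v g" "arrow_class k u \<sigma> v f = arrow_class k u \<sigma> v g"
proof -
  have u: "u \<in> ordered_intervals k" "v \<in> ordered_intervals k" "\<sigma> permutes {..<k}" "pathin (X k) f"
    "f 0 = \<eta> k u" "f 1 = act k \<sigma> (\<eta> k v)" using assms by (auto simp: arrow_def)
  note l = lin_props[OF even_intervals_ordered u(1)] lin_props[OF u(2) even_intervals_ordered]
  show "arrow k u \<sigma> v g"
    using assms homotopic_rel_imp_eq[OF assms(2), of 0] homotopic_rel_imp_eq[OF assms(2), of 1]
      homotopic_rel_imp_continuous(2)[OF assms(2)] by (simp add: arrow_def pathin_def)
  show "arrow_class k u \<sigma> v f = arrow_class k u \<sigma> v g"
    unfolding arrow_class_def close_up_def
    by (intro proj_path_class_eqI path_join_homotopic_right path_join_homotopic_left assms(2) pathin_translate)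
       (use l u in simp_all)
qed

lemma arrow_class_eq:
  assumes "arrow k u \<sigma> v f" "\<And>t. t \<in> {0..1} \<Longrightarrow> f t = g t"
  shows "arrow_class k u \<sigma> v f = arrow_class k u \<sigma> v g"
  by (rule arrow_class_cong(2)[OF assms(1)], rule homotopic_rel_eq)
     (use assms in \<open>auto simp: arrow_def pathin_def\<close>)

lemma translate_eta_loop:
  assumes "\<sigma> permutes {..<k}" "eta_path k u v f" "eta_path k v u g"
  shows "path_homotopic (X k) (path_join (translate k \<sigma> f) (translate k \<sigma> g)) (\<lambda>_. act k \<sigma> (\<eta> k u))"
proof -
  have "path_homotopic (X k) (path_join f g) (\<lambda>_. \<eta> k u)"
    by (rule eta_path_unique[OF eta_path_join[OF assms(2,3)] eta_path_const])
       (use assms eta_path_props in blast)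
  from translate_homotopic[OF this assms(1)] show ?thesis by (simp add: translate_path_join)
qed

lemma arrow_class_base:
  assumes "arrow k (c\<^sub>0 k) \<sigma> (c\<^sub>0 k) f"
  shows "arrow_class k (c\<^sub>0 k) \<sigma> (c\<^sub>0 k) f = proj_class k f"
proof -
  have u: "\<sigma> permutes {..<k}" "pathin (X k) f"
    "f 0 = \<eta> k (c\<^sub>0 k)" "f 1 = act k \<sigma> (\<eta> k (c\<^sub>0 k))" using assms by (auto simp: arrow_def)
  note e = even_intervals_ordered[of k]
  note l = lin_props[OF e e]
  have lc: "path_homotopic (X k) (lin k (c\<^sub>0 k) (c\<^sub>0 k)) (\<lambda>_. \<eta> k (c\<^sub>0 k))"
    by (rule eta_path_unique[OF eta_path_linear[OF e e] eta_path_const[OF e]])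
  have c: "pathin (X k) (\<lambda>_. \<eta> k (c\<^sub>0 k))" using eta_path_props(1)[OF eta_path_const[OF e]] .
  have "path_homotopic (X k) (close_up k (c\<^sub>0 k) \<sigma> (c\<^sub>0 k) f)
    (path_join (\<lambda>_. \<eta> k (c\<^sub>0 k)) (path_join f (\<lambda>_. act k \<sigma> (\<eta> k (c\<^sub>0 k)))))"
    unfolding close_up_def
    by (rule path_join_homotopic[OF lc], rule path_join_homotopic_right[OF translate_homotopic[OF lc u(1)]])
       (use l u in simp_all)
  also have "path_homotopic (X k) \<dots> (path_join (\<lambda>_. \<eta> k (c\<^sub>0 k)) f)"
    by (rule path_join_homotopic_right[OF path_join_const_right]) (use u c in simp_all)
  also have "path_homotopic (X k) \<dots> f"
    by (rule path_join_const_left) (use u in simp_all)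
  finally show ?thesis unfolding arrow_class_def by (rule proj_path_class_eqI)
qed

lemma pi1_cases:
  assumes "x \<in> \<pi>\<^sub>1 k"
  obtains \<sigma> f where "arrow k (c\<^sub>0 k) \<sigma> (c\<^sub>0 k) f" "x = arrow_class k (c\<^sub>0 k) \<sigma> (c\<^sub>0 k) f"
proof -
  obtain g where g: "x = path_class (Q k) g" "pathin (Q k) g" "g 0 = orbit_base act \<eta> k" "g 1 = orbit_base act \<eta> k"
    using assms by (auto simp: fundamental_group_set_def)
  obtain f where f: "continuous_map (top_of_set {0..1}) (X k) f" "\<forall>t\<in>{0..1}. q k (f t) = g t" "f 0 = basepoint \<eta> k"
    using cov.lift_map_cbox[of "0::real" 1 k g 0 "basepoint \<eta> k"] g basepoint_closed
    by (auto simp: pathin_def q_eq Q_eq orbit_base_eq)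
  have f1: "f 1 \<in> op_pts C k" using f(1) by (auto simp: continuous_map_def)
  then obtain \<sigma> where "\<sigma> permutes {..<k}" "f 1 = act k \<sigma> (basepoint \<eta> k)"
    using f(2) g(4) q_eq_iff[OF basepoint_closed f1] by (auto simp: orbit_base_eq)
  then have a: "arrow k (c\<^sub>0 k) \<sigma> (c\<^sub>0 k) f"
    using f by (simp add: arrow_def even_intervals_ordered pathin_def basepoint_eq)
  have "path_homotopic (Q k) (\<lambda>t. q k (f t)) g"
    by (rule homotopic_rel_eq) (use f continuous_map_compose[OF f(1) continuous_q] in \<open>auto simp: o_def\<close>)
  then have "x = proj_class k f"
    unfolding g(1) proj_path_class_eq path_class_eq by (rule homotopy_class_rel_eqI[symmetric])
  then show ?thesis using that a arrow_class_base[OF a] by simp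
qed

lemma arrow_class_in_pi1:
  assumes "arrow k u \<sigma> v f"
  shows "arrow_class k u \<sigma> v f \<in> \<pi>\<^sub>1 k"
proof -
  let ?N = "close_up k u \<sigma> v f"
  have N: "\<sigma> permutes {..<k}" "pathin (X k) ?N" "?N 0 = basepoint \<eta> k" "?N 1 = act k \<sigma> (basepoint \<eta> k)"
    using arrow_close_up[OF assms] by (auto simp: arrow_def basepoint_eq)
  have "pathin (Q k) (q k \<circ> ?N)"
    using continuous_map_compose[OF N(2)[unfolded pathin_def] continuous_q] by (simp add: pathin_def)
  then show ?thesis
    unfolding fundamental_group_set_def arrow_class_def proj_path_class_def
    using N q_act[OF N(1) basepoint_closed] by (auto simp: orbit_base_eq)
qed

lemma arrow_const: "u \<in> ordered_intervals k \<Longrightarrow> arrow k u id u (\<lambda>_. \<eta> k u)"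
  using eta_path_props[OF eta_path_const] by (simp add: arrow_def permutes_id eta_closed)

lemma pi1_one_arrow_class: "one1 k = arrow_class k (c\<^sub>0 k) id (c\<^sub>0 k) (\<lambda>_. \<eta> k (c\<^sub>0 k))"
  using arrow_class_base[OF arrow_const[OF even_intervals_ordered]] by (simp add: pi1_one_def basepoint_eq)

lemma arrow_join:
  assumes "arrow k u \<sigma> v f" "arrow k v \<tau> w g"
  shows "arrow k u (\<tau> \<circ> \<sigma>) w (path_join f (translate k \<sigma> g))"
  using assms act_comp[of \<sigma> k \<tau> "\<eta> k w"] eta_closed
  by (auto simp: arrow_def permutes_compose intro!: pathin_path_join pathin_translate)

text \<open>
  The closing paths at the end of \<open>f\<close> and at the beginning of \<open>g\<close> are linear paths from \<open>v\<close> to the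
  even configuration and back, which cancel.
\<close>

lemma arrow_class_mult:
  assumes f: "arrow k u \<sigma> v f" and g: "arrow k v \<tau> w g"
  shows "mul1 k (arrow_class k u \<sigma> v f) (arrow_class k v \<tau> w g) = arrow_class k u (\<tau> \<circ> \<sigma>) w (path_join f (translate k \<sigma> g))"
proof -
  have u: "u \<in> ordered_intervals k" "v \<in> ordered_intervals k" "\<sigma> permutes {..<k}" "pathin (X k) f"
    "f 0 = \<eta> k u" "f 1 = act k \<sigma> (\<eta> k v)" using f by (auto simp: arrow_def)
  have w: "w \<in> ordered_intervals k" "\<tau> permutes {..<k}" "pathin (X k) g"
    "g 0 = \<eta> k v" "g 1 = act k \<tau> (\<eta> k w)" using g by (auto simp: arrow_def)
  note e = even_intervals_ordered[of k]
  note l = lin_props[OF e u(1)] lin_props[OF u(2) e] lin_props[OF e u(2)] lin_props[OF w(1) e]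
  let ?N = "close_up k u \<sigma> v f" and ?M = "close_up k v \<tau> w g"
  have eqc: "translate k \<sigma> (translate k \<tau> (lin k w (c\<^sub>0 k))) t = translate k (\<tau> \<circ> \<sigma>) (lin k w (c\<^sub>0 k)) t" if "t \<in> {0..1}" for t
    using act_comp[OF u(3) w(2)] pathin_closed[OF l(10) that] by simp
  have main: "proj_class k (path_join F (translate k \<sigma> G)) = arrow_class k u (\<tau> \<circ> \<sigma>) w (path_join f (translate k \<sigma> g))"
    if F: "path_homotopic (X k) F ?N" and G: "path_homotopic (X k) G ?M" for F G
  proof -
    have 1: "F 1 = act k \<sigma> (\<eta> k (c\<^sub>0 k))" "G 0 = \<eta> k (c\<^sub>0 k)"
      using homotopic_rel_imp_eq[OF F, of 1] homotopic_rel_imp_eq[OF G, of 0]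
        arrow_close_up[OF f] arrow_close_up[OF g] by (auto simp: arrow_def)
    have "path_homotopic (X k) (path_join F (translate k \<sigma> G)) (path_join ?N (translate k \<sigma> ?M))"
      by (rule path_join_homotopic[OF F translate_homotopic[OF G u(3)]]) (use 1 in simp)
    also have "path_homotopic (X k) (path_join ?N (translate k \<sigma> ?M))
      (path_join (lin k (c\<^sub>0 k) u) (path_join (path_join f (translate k \<sigma> g)) (translate k \<sigma> (translate k \<tau> (lin k w (c\<^sub>0 k))))))"
      unfolding close_up_def translate_path_join
      by (rule path_cancel_middle)
         (use u w l translate_eta_loop[OF u(3) eta_path_linear[OF u(2) e] eta_path_linear[OF e u(2)]]
          in \<open>simp_all add: pathin_translate\<close>)
    also have "path_homotopic (X k) \<dots> (close_up k u (\<tau> \<circ> \<sigma>) w (path_join f (translate k \<sigma> g)))"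
      unfolding close_up_def
      by (intro path_join_homotopic_right homotopic_rel_eq)
         (use u w l eqc pathin_translate[OF pathin_translate[OF l(10) w(2)] u(3)]
          in \<open>auto simp: pathin_def[symmetric] pathin_translate intro!: pathin_path_join\<close>)
    finally show ?thesis unfolding arrow_class_def by (rule proj_path_class_eqI)
  qed
  show ?thesis
    unfolding pi1_mult_def
  proof (rule Union_eq_const)
    show "lifts k (arrow_class k u \<sigma> v f) \<noteq> {}" using arrow_class_lifted(1)[OF f] by blast
    fix F assume F: "F \<in> lifts k (arrow_class k u \<sigma> v f)"
    show "(\<Union>G\<in>lifts k (arrow_class k v \<tau> w g). proj_class k (path_join F (translate k (end_perm act \<eta> k F) G))) =
      arrow_class k u (\<tau> \<circ> \<sigma>) w (path_join f (translate k \<sigma> g))"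
    proof (rule Union_eq_const)
      show "lifts k (arrow_class k v \<tau> w g) \<noteq> {}" using arrow_class_lifted(1)[OF g] by blast
    qed (use main arrow_class_lifted(2,3)[OF f F] arrow_class_lifted(2)[OF g] in auto)
  qed
qed

definition arrows where
  "arrows ms us \<tau>s vs gs \<longleftrightarrow> list_all2 (\<lambda>m \<tau>. \<tau> permutes {..<m}) ms \<tau>s \<and>
    length us = length ms \<and> length vs = length ms \<and> length gs = length ms \<and>
    (\<forall>i<length ms. arrow (ms ! i) (us ! i) (\<tau>s ! i) (vs ! i) (gs ! i))"

definition arrow_classes where
  "arrow_classes ms us \<tau>s vs gs = map (\<lambda>i. arrow_class (ms ! i) (us ! i) (\<tau>s ! i) (vs ! i) (gs ! i)) [0..<length ms]"

lemma arrow_glue: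
  assumes f: "arrow (length ms) u \<sigma> v f" and gs: "arrows ms us \<tau>s vs gs"
  shows "arrow (sum_list ms) (little_intervals_comp ms u us) (symm_comp ms \<sigma> \<tau>s)
    (little_intervals_comp (permute_by \<sigma> ms) v (permute_by \<sigma> vs)) (glue ms f gs)"
proof -
  have u: "u \<in> ordered_intervals (length ms)" "v \<in> ordered_intervals (length ms)" "\<sigma> permutes {..<length ms}"
    "pathin (X (length ms)) f" "f 0 = \<eta> (length ms) u" "f 1 = act (length ms) \<sigma> (\<eta> (length ms) v)"
    using f by (auto simp: arrow_def)
  have len: "length us = length ms" "length vs = length ms" "length gs = length ms"
    and \<tau>s: "list_all2 (\<lambda>m \<tau>. \<tau> permutes {..<m}) ms \<tau>s" using gs by (auto simp: arrows_def)
  have g: "us ! i \<in> ordered_intervals (ms ! i)" "vs ! i \<in> ordered_intervals (ms ! i)" "(\<tau>s ! i) permutes {..<ms ! i}"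
    "pathin (X (ms ! i)) (gs ! i)" "(gs ! i) 0 = \<eta> (ms ! i) (us ! i)" "(gs ! i) 1 = act (ms ! i) (\<tau>s ! i) (\<eta> (ms ! i) (vs ! i))"
    if "i < length ms" for i using gs that by (auto simp: arrows_def arrow_def)
  have us: "list_all2 (\<lambda>m u. u \<in> ordered_intervals m) ms us" and vs: "list_all2 (\<lambda>m u. u \<in> ordered_intervals m) ms vs"
    using g len by (auto simp: list_all2_conv_all_nth)
  have pvs: "list_all2 (\<lambda>m u. u \<in> ordered_intervals m) (permute_by \<sigma> ms) (permute_by \<sigma> vs)"
    by (rule list_all2_permute_by[OF u(3) vs])
  have v: "v \<in> ordered_intervals (length (permute_by \<sigma> ms))" using u(2) by simp
  have s: "sum_list (permute_by \<sigma> ms) = sum_list ms" by (rule sum_list_permute_by[OF u(3)])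
  have "glue ms f gs 0 = \<eta> (sum_list ms) (little_intervals_comp ms u us)"
  proof -
    have "map (\<lambda>g. g 0) gs = map (\<lambda>i. \<eta> (ms ! i) (us ! i)) [0..<length ms]"
      using len g by (intro nth_equalityI) auto
    then show ?thesis using eta_comp[OF u(1) us] u(5) by simp
  qed
  moreover have "glue ms f gs 1 = act (sum_list ms) (symm_comp ms \<sigma> \<tau>s)
      (\<eta> (sum_list ms) (little_intervals_comp (permute_by \<sigma> ms) v (permute_by \<sigma> vs)))"
  proof -
    let ?b = "map (\<lambda>i. \<eta> (ms ! i) (vs ! i)) [0..<length ms]"
    have "list_all2 (\<lambda>m b. b \<in> op_pts C m) ms ?b"
      using g eta_closed by (auto simp: list_all2_conv_all_nth)
    from act_equivariant[OF u(3) \<tau>s eta_closed[OF u(2)] this]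
    have "op_comp C ms (f 1) (map (\<lambda>i. act (ms ! i) (\<tau>s ! i) (?b ! i)) [0..<length ms]) =
      act (sum_list ms) (symm_comp ms \<sigma> \<tau>s) (op_comp C (permute_by \<sigma> ms) (\<eta> (length ms) v) (permute_by \<sigma> ?b))"
      using u(6) by simp
    moreover have "map (\<lambda>i. act (ms ! i) (\<tau>s ! i) (?b ! i)) [0..<length ms] = map (\<lambda>g. g 1) gs"
      using len g by (intro nth_equalityI) auto
    moreover have "op_comp C (permute_by \<sigma> ms) (\<eta> (length ms) v) (permute_by \<sigma> ?b) =
        \<eta> (sum_list ms) (little_intervals_comp (permute_by \<sigma> ms) v (permute_by \<sigma> vs))"
      using eta_comp[OF v pvs] s permute_by_map_index[OF u(3) refl len(2), of \<eta>] by simp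
    ultimately show ?thesis by simp
  qed
  moreover have "pathin (X (sum_list ms)) (glue ms f gs)"
    using pathin_glue[OF u(4) len(3)] g by blast
  moreover have "little_intervals_comp (permute_by \<sigma> ms) v (permute_by \<sigma> vs) \<in> ordered_intervals (sum_list ms)"
    using little_intervals_comp_ordered[OF v pvs] s by simp
  ultimately show ?thesis
    unfolding arrow_def using little_intervals_comp_ordered[OF u(1) us] symm_comp_permutes[OF u(3) \<tau>s] by blast
qed

lemma listset_lifted_paths:
  assumes "arrows ms us \<tau>s vs gs"
  shows "listset (map2 lifts ms (arrow_classes ms us \<tau>s vs gs)) \<noteq> {}"
    and "Gs \<in> listset (map2 lifts ms (arrow_classes ms us \<tau>s vs gs)) \<Longrightarrow> length Gs = length ms"
    and "Gs \<in> listset (map2 lifts ms (arrow_classes ms us \<tau>s vs gs)) \<Longrightarrow> i < length ms \<Longrightarrow>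
      Gs ! i \<in> lifts (ms ! i) (arrow_class (ms ! i) (us ! i) (\<tau>s ! i) (vs ! i) (gs ! i))"
proof -
  have "map (\<lambda>i. close_up (ms ! i) (us ! i) (\<tau>s ! i) (vs ! i) (gs ! i)) [0..<length ms]
      \<in> listset (map2 lifts ms (arrow_classes ms us \<tau>s vs gs))"
    using assms arrow_class_lifted(1) by (auto simp: listset_iff list_all2_conv_all_nth arrow_classes_def arrows_def)
  then show "listset (map2 lifts ms (arrow_classes ms us \<tau>s vs gs)) \<noteq> {}" by blast
qed (auto simp: listset_iff list_all2_conv_all_nth arrow_classes_def)

text \<open>
  Closing up before composing inserts the composites of the closing paths.  At the beginning these
  combine with the linear path \<open>\<delta>\<^sub>1\<close>; at the end, once equivariance has moved the permutations to the
  outside, they combine with \<open>\<delta>\<^sub>2\<close>.  Both combinations are images of paths of ordered configurations,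
  so they are homotopic to the linear paths used in closing up after composing.
\<close>

lemma arrow_class_comp:
  assumes f: "arrow (length ms) u \<sigma> v f" and gs: "arrows ms us \<tau>s vs gs"
  shows "comp1 ms (arrow_class (length ms) u \<sigma> v f) (arrow_classes ms us \<tau>s vs gs) =
    arrow_class (sum_list ms) (little_intervals_comp ms u us) (symm_comp ms \<sigma> \<tau>s)
      (little_intervals_comp (permute_by \<sigma> ms) v (permute_by \<sigma> vs)) (glue ms f gs)"
proof -
  let ?k = "length ms" and ?n = "sum_list ms" and ?\<rho> = "symm_comp ms \<sigma> \<tau>s"
  let ?u = "little_intervals_comp ms u us" and ?v = "little_intervals_comp (permute_by \<sigma> ms) v (permute_by \<sigma> vs)"
  let ?M = "glue ms f gs"
  let ?pm = "permute_by \<sigma> ms"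
  have u: "u \<in> ordered_intervals ?k" "v \<in> ordered_intervals ?k" "\<sigma> permutes {..<?k}" "pathin (X ?k) f"
    using f by (auto simp: arrow_def)
  have len: "length us = ?k" "length vs = ?k" "length gs = ?k" "length \<tau>s = ?k"
    and \<tau>s: "list_all2 (\<lambda>m \<tau>. \<tau> permutes {..<m}) ms \<tau>s"
    using gs by (auto simp: arrows_def dest: list_all2_lengthD)
  have g: "us ! i \<in> ordered_intervals (ms ! i)" "vs ! i \<in> ordered_intervals (ms ! i)" "(\<tau>s ! i) permutes {..<ms ! i}"
    "arrow (ms ! i) (us ! i) (\<tau>s ! i) (vs ! i) (gs ! i)"
    if "i < ?k" for i using gs that by (auto simp: arrows_def arrow_def)
  have M: "?u \<in> ordered_intervals ?n" "?v \<in> ordered_intervals ?n" "?\<rho> permutes {..<?n}" "pathin (X ?n) ?M"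
    "?M 0 = \<eta> ?n ?u" "?M 1 = act ?n ?\<rho> (\<eta> ?n ?v)" using arrow_glue[OF f gs] by (auto simp: arrow_def)
  have s: "sum_list ?pm = ?n" by (rule sum_list_permute_by[OF u(3)])
  note e = even_intervals_ordered
  let ?ls = "map (\<lambda>i. lin (ms ! i) (c\<^sub>0 (ms ! i)) (us ! i)) [0..<?k]"
  let ?rs = "map (\<lambda>i. lin (ms ! i) (vs ! i) (c\<^sub>0 (ms ! i))) [0..<?k]"
  let ?A = "glue ms (lin ?k (c\<^sub>0 ?k) u) ?ls"
  let ?B' = "glue ?pm (lin ?k v (c\<^sub>0 ?k)) (permute_by \<sigma> ?rs)"
  let ?B = "translate ?n ?\<rho> ?B'"
  let ?D = "translate ?n ?\<rho> (path_rev (base_path \<eta> ?pm))"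
  have A: "eta_path ?n (little_intervals_comp ms (c\<^sub>0 ?k) (map c\<^sub>0 ms)) ?u ?A"
    by (rule eta_path_glue) (use eta_path_linear e u g len in auto)
  have pA: "eta_path ?n (c\<^sub>0 ?n) ?u (path_join (base_path \<eta> ms) ?A)"
    by (rule eta_path_join[OF eta_path_base_path A])
  have B': "eta_path ?n ?v (little_intervals_comp ?pm (c\<^sub>0 ?k) (map c\<^sub>0 ?pm)) ?B'"
  proof -
    have "permute_by \<sigma> ?rs = map (\<lambda>i. lin (?pm ! i) (permute_by \<sigma> vs ! i) (c\<^sub>0 (?pm ! i))) [0..<?k]"
      by (rule permute_by_map_index[OF u(3) refl len(2)])
    moreover have "list_all2 (\<lambda>m u. u \<in> ordered_intervals m) ?pm (permute_by \<sigma> vs)"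
      by (rule list_all2_permute_by[OF u(3)]) (use g len in \<open>auto simp: list_all2_conv_all_nth\<close>)
    ultimately have "eta_path (sum_list ?pm) ?v (little_intervals_comp ?pm (c\<^sub>0 ?k) (map c\<^sub>0 ?pm)) ?B'"
      by (intro eta_path_glue) (use eta_path_linear e u len in \<open>auto simp: list_all2_conv_all_nth\<close>)
    then show ?thesis using s by simp
  qed
  have bp: "eta_path ?n (c\<^sub>0 ?n) (little_intervals_comp ?pm (c\<^sub>0 ?k) (map c\<^sub>0 ?pm)) (base_path \<eta> ?pm)"
    using eta_path_base_path[of ?pm] s by simp
  have BD: "eta_path ?n ?v (c\<^sub>0 ?n) (path_join ?B' (path_rev (base_path \<eta> ?pm)))"
    by (rule eta_path_join[OF B' eta_path_rev[OF bp]])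
  have main: "proj_class ?n (path_join (base_path \<eta> ms) (path_join (glue ms F Gs) ?D)) = arrow_class ?n ?u ?\<rho> ?v ?M"
    if F: "path_homotopic (X ?k) F (close_up ?k u \<sigma> v f)" and lG: "length Gs = ?k"
      and G: "\<And>i. i < ?k \<Longrightarrow> path_homotopic (X (ms ! i)) (Gs ! i) (close_up (ms ! i) (us ! i) (\<tau>s ! i) (vs ! i) (gs ! i))"
    for F Gs
  proof -
    have "path_homotopic (X ?n) (glue ms F Gs) (glue ms (close_up ?k u \<sigma> v f)
        (map (\<lambda>i. close_up (ms ! i) (us ! i) (\<tau>s ! i) (vs ! i) (gs ! i)) [0..<?k]))"
      by (rule glue_homotopic[OF F]) (use lG G in auto)
    also have "glue ms (close_up ?k u \<sigma> v f) (map (\<lambda>i. close_up (ms ! i) (us ! i) (\<tau>s ! i) (vs ! i) (gs ! i)) [0..<?k]) =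
      path_join ?A (path_join (glue ms f (map (\<lambda>i. gs ! i) [0..<?k]))
       (glue ms (translate ?k \<sigma> (lin ?k v (c\<^sub>0 ?k))) (map (\<lambda>i. translate (ms ! i) (\<tau>s ! i) (lin (ms ! i) (vs ! i) (c\<^sub>0 (ms ! i)))) [0..<?k])))"
      unfolding close_up_def glue_path_join ..
    also have "map (\<lambda>i. gs ! i) [0..<?k] = gs" using len(3) by (metis map_nth)
    also have "path_homotopic (X ?n) (path_join ?A (path_join ?M
       (glue ms (translate ?k \<sigma> (lin ?k v (c\<^sub>0 ?k))) (map (\<lambda>i. translate (ms ! i) (\<tau>s ! i) (lin (ms ! i) (vs ! i) (c\<^sub>0 (ms ! i)))) [0..<?k]))))
       (path_join ?A (path_join ?M ?B))"
    proof -
      let ?b = "glue ms (translate ?k \<sigma> (lin ?k v (c\<^sub>0 ?k))) (map (\<lambda>i. translate (ms ! i) (\<tau>s ! i) (lin (ms ! i) (vs ! i) (c\<^sub>0 (ms ! i)))) [0..<?k])"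
      have eq: "?b t = ?B t" if t: "t \<in> {0..1}" for t
      proof -
        have eq: "map (\<lambda>i. translate (ms ! i) (\<tau>s ! i) (?rs ! i)) [0..<?k] = map (\<lambda>i. translate (ms ! i) (\<tau>s ! i) (lin (ms ! i) (vs ! i) (c\<^sub>0 (ms ! i)))) [0..<?k]"
          by (intro nth_equalityI) auto
        have "glue ms (translate ?k \<sigma> (lin ?k v (c\<^sub>0 ?k))) (map (\<lambda>i. translate (ms ! i) (\<tau>s ! i) (?rs ! i)) [0..<?k]) t = ?B t"
          by (rule glue_translate[OF u(3) \<tau>s])
             (use pathin_closed[OF lin_props(1)[OF u(2) e] t] pathin_closed[OF lin_props(1)[OF g(2) e] t] in auto)
        then show ?thesis unfolding eq .
      qed
      have B: "pathin (X ?n) ?B" using pathin_translate[OF eta_path_props(1)[OF B'] M(3)] .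
      then have "path_homotopic (X ?n) ?b ?B"
        by (intro homotopic_rel_sym[OF homotopic_rel_eq]) (use eq in \<open>auto simp: pathin_def\<close>)
      then show ?thesis
        by (intro path_join_homotopic_right) (use eq eta_path_props[OF A] eta_path_props[OF B'] M in simp_all)
    qed
    finally have GH: "path_homotopic (X ?n) (glue ms F Gs) (path_join ?A (path_join ?M ?B))" .
    have D: "pathin (X ?n) ?D" by (intro pathin_translate pathin_path_rev eta_path_props(1)[OF bp] M(3))
    have ends: "path_join ?A (path_join ?M ?B) 0 = base_path \<eta> ms 1" "path_join ?A (path_join ?M ?B) 1 = ?D 0"
      using eta_path_props[OF A] eta_path_props[OF eta_path_base_path] eta_path_props[OF B'] eta_path_props[OF bp] by simp_all
    have "path_homotopic (X ?n) (path_join (base_path \<eta> ms) (path_join (glue ms F Gs) ?D))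
        (path_join (base_path \<eta> ms) (path_join (path_join ?A (path_join ?M ?B)) ?D))"
    proof (rule path_join_homotopic_right[OF path_join_homotopic_left[OF GH D]])
      show "pathin (X ?n) (base_path \<eta> ms)" by (rule eta_path_props(1)[OF eta_path_base_path])
      show "glue ms F Gs 1 = ?D 0" "base_path \<eta> ms 1 = path_join (glue ms F Gs) ?D 0"
        using homotopic_rel_imp_eq[OF GH, of 1] homotopic_rel_imp_eq[OF GH, of 0] ends by simp_all
    qed
    also have "path_homotopic (X ?n) \<dots> (path_join (path_join (base_path \<eta> ms) ?A) (path_join ?M (path_join ?B ?D)))"
      by (rule path_regroup)
         (use eta_path_props[OF A] eta_path_props[OF eta_path_base_path] eta_path_props[OF B'] eta_path_props[OF bp] M D
          in \<open>simp_all add: pathin_translate\<close>)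
    also have "path_homotopic (X ?n) \<dots> (close_up ?n ?u ?\<rho> ?v ?M)"
      unfolding close_up_def
    proof (rule path_join_homotopic)
      show "path_homotopic (X ?n) (path_join (base_path \<eta> ms) ?A) (lin ?n (c\<^sub>0 ?n) ?u)"
        by (rule eta_path_unique[OF pA eta_path_linear[OF e M(1)]])
      have "path_homotopic (X ?n) (path_join ?B ?D) (translate ?n ?\<rho> (lin ?n ?v (c\<^sub>0 ?n)))"
        using translate_homotopic[OF eta_path_unique[OF BD eta_path_linear[OF M(2) e]] M(3)]
        by (simp add: translate_path_join)
      then show "path_homotopic (X ?n) (path_join ?M (path_join ?B ?D)) (path_join ?M (translate ?n ?\<rho> (lin ?n ?v (c\<^sub>0 ?n))))"
        by (rule path_join_homotopic_right) (use M eta_path_props[OF B'] in simp_all)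
      show "path_join (base_path \<eta> ms) ?A 1 = path_join ?M (path_join ?B ?D) 0"
        using eta_path_props[OF A] M by simp
    qed
    finally show ?thesis unfolding arrow_class_def by (rule proj_path_class_eqI)
  qed
  show ?thesis
    unfolding pi1_comp_def
  proof (rule Union_eq_const)
    show "lifts ?k (arrow_class ?k u \<sigma> v f) \<noteq> {}" using arrow_class_lifted(1)[OF f] by blast
    fix F assume F: "F \<in> lifts ?k (arrow_class ?k u \<sigma> v f)"
    show "(\<Union>Gs\<in>listset (map2 lifts ms (arrow_classes ms us \<tau>s vs gs)).
       let \<sigma> = end_perm act \<eta> (length ms) F;
           \<rho> = symm_comp ms \<sigma> (map2 (end_perm act \<eta>) ms Gs)
       in proj_class (sum_list ms)
            (path_join (base_path \<eta> ms)
              (path_join (\<lambda>t. op_comp C ms (F t) (map (\<lambda>g. g t) Gs))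
                (\<lambda>t. act (sum_list ms) \<rho> (path_rev (base_path \<eta> (permute_by \<sigma> ms)) t))))) =
       arrow_class ?n ?u ?\<rho> ?v ?M"
    proof (rule Union_eq_const)
      fix Gs assume Gs: "Gs \<in> listset (map2 lifts ms (arrow_classes ms us \<tau>s vs gs))"
      note lG = listset_lifted_paths(2)[OF gs Gs]
      have G: "path_homotopic (X (ms ! i)) (Gs ! i) (close_up (ms ! i) (us ! i) (\<tau>s ! i) (vs ! i) (gs ! i))"
        "end_perm act \<eta> (ms ! i) (Gs ! i) = \<tau>s ! i" if "i < ?k" for i
        using arrow_class_lifted(2,3)[OF g(4)[OF that] listset_lifted_paths(3)[OF gs Gs that]] by auto
      have "map2 (end_perm act \<eta>) ms Gs = \<tau>s"
        using G(2) lG len by (intro nth_equalityI) auto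
      then show "(let \<sigma> = end_perm act \<eta> (length ms) F;
           \<rho> = symm_comp ms \<sigma> (map2 (end_perm act \<eta>) ms Gs)
       in proj_class (sum_list ms)
            (path_join (base_path \<eta> ms)
              (path_join (\<lambda>t. op_comp C ms (F t) (map (\<lambda>g. g t) Gs))
                (\<lambda>t. act (sum_list ms) \<rho> (path_rev (base_path \<eta> (permute_by \<sigma> ms)) t))))) =
       arrow_class ?n ?u ?\<rho> ?v ?M"
        unfolding Let_def using main[OF arrow_class_lifted(2)[OF f F] lG G(1)] arrow_class_lifted(3)[OF f F] by simp
    qed (use listset_lifted_paths(1)[OF gs] in blast)
  qed
qed

section \<open>Classes of spheroids based at ordered configurations\<close>

abbreviation \<pi>\<^sub>l :: "nat \<Rightarrow> (real ^ 'l \<Rightarrow> 'a set) set set"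
  where "\<pi>\<^sub>l k \<equiv> homotopy_group_set (orbit_space C act k) (orbit_base act \<eta> k)"

text \<open>
  As for arrows, the mark \<open>u\<close> determines the way from the base point to the spheroid.
\<close>

definition sph :: "nat \<Rightarrow> (nat \<Rightarrow> real \<times> real) \<Rightarrow> (real ^ 'l \<Rightarrow> 'a) \<Rightarrow> bool"
  where "sph k u f \<longleftrightarrow> u \<in> ordered_intervals k \<and> spheroid (X k) (\<eta> k u) f"

definition sph_class :: "nat \<Rightarrow> (nat \<Rightarrow> real \<times> real) \<Rightarrow> (real ^ 'l \<Rightarrow> 'a) \<Rightarrow> (real ^ 'l \<Rightarrow> 'a set) set"
  where "sph_class k u f = proj_sph_class k (change_base (lin k (c\<^sub>0 k) u) f)"

lemma proj_spheroid_class_eq: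
  "spheroid (X k) (basepoint \<eta> k) f \<Longrightarrow>
    proj_sph_class k f = homotopy_class_rel cube cube_boundary (Q k) (\<lambda>z. q k (f z))"
  unfolding proj_spheroid_class_def by (subst spheroid_class_eq) (auto simp: spheroid_def orbit_base_eq o_def)

lemma spheroid_homotopic:
  "spheroid Y x f \<Longrightarrow> cube_homotopic Y f g \<Longrightarrow> spheroid Y x g"
  using homotopic_rel_imp_eq[of cube cube_boundary Y f g] homotopic_rel_imp_continuous(2)[of cube cube_boundary Y f g]
  unfolding spheroid_iff by metis

lemma proj_spheroid_class_eqI:
  assumes "spheroid (X k) (basepoint \<eta> k) f" "cube_homotopic (X k) f g"
  shows "proj_sph_class k f = proj_sph_class k g"
  unfolding proj_spheroid_class_eq[OF assms(1)] proj_spheroid_class_eq[OF spheroid_homotopic[OF assms]]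
  by (rule homotopy_class_rel_eqI[OF homotopic_rel_compose[OF assms(2) continuous_q]])

lemma proj_spheroid_class_eqD:
  fixes f g :: "real ^ 'l \<Rightarrow> 'a"
  assumes eq: "proj_sph_class k f = proj_sph_class k g"
    and f: "spheroid (X k) (basepoint \<eta> k) f" and g: "spheroid (X k) (basepoint \<eta> k) g"
  shows "cube_homotopic (X k) f g"
proof -
  have "continuous_map (top_of_set cube) (Q k) (\<lambda>t. q k (g t))"
    using continuous_map_compose[OF _ continuous_q, of "top_of_set cube" k g] g by (simp add: spheroid_iff o_def)
  then have "cube_homotopic (cov.quot k) (\<lambda>t. cov.proj k (f t)) (\<lambda>t. cov.proj k (g t))"
    using eq unfolding proj_spheroid_class_eq[OF f] proj_spheroid_class_eq[OF g] q_eq Q_eq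
    by (rule homotopy_class_rel_eqD[rotated])
  moreover have "f 0 = g 0"
    using f g zero_in_cube_boundary unfolding spheroid_iff by metis
  ultimately show ?thesis
    by (intro cov.lift_homotopic_rel[OF box_unit_cube_ne _ _ _ _ zero_in_cube_boundary])
       (use f g in \<open>auto simp: spheroid_iff\<close>)
qed

lemma sph_close_up:
  assumes "sph k u f"
  shows "spheroid (X k) (basepoint \<eta> k) (change_base (lin k (c\<^sub>0 k) u) f)"
  using spheroid_change_base[of "X k" "lin k (c\<^sub>0 k) u" f] assms lin_props[OF even_intervals_ordered, of u k]
  by (simp add: sph_def basepoint_eq)

lemma sph_class_lifted:
  assumes "sph k u f"
  shows "change_base (lin k (c\<^sub>0 k) u) f \<in> sph_lifts k (sph_class k u f)"
    and "F \<in> sph_lifts k (sph_class k u f) \<Longrightarrow> cube_homotopic (X k) F (change_base (lin k (c\<^sub>0 k) u) f)"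
    and "F \<in> sph_lifts k (sph_class k u f) \<Longrightarrow> spheroid (X k) (basepoint \<eta> k) F"
  using sph_close_up[OF assms] proj_spheroid_class_eqD
  unfolding sph_class_def lifted_spheroids_def by blast+

lemma sph_class_cong:
  assumes "sph k u f" "cube_homotopic (X k) f g"
  shows "sph k u g" "sph_class k u f = sph_class k u g"
proof -
  have f: "u \<in> ordered_intervals k" "spheroid (X k) (\<eta> k u) f" using assms by (auto simp: sph_def)
  note l = lin_props[OF even_intervals_ordered f(1)]
  show "sph k u g" using f spheroid_homotopic[OF f(2) assms(2)] by (simp add: sph_def)
  show "sph_class k u f = sph_class k u g"
    unfolding sph_class_def
    by (rule proj_spheroid_class_eqI[OF sph_close_up[OF assms(1)]], rule change_base_homotopic[OF _ assms(2)])
       (use f l in \<open>auto simp: path_homotopic_refl spheroid_iff\<close>)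
qed

lemma sph_class_eq:
  assumes "sph k u f" "\<And>z. z \<in> cube \<Longrightarrow> f z = g z"
  shows "sph_class k u f = sph_class k u g" "sph k u g"
proof -
  have "cube_homotopic (X k) f g"
    by (rule homotopic_rel_eq) (use assms in \<open>auto simp: sph_def spheroid_iff\<close>)
  from sph_class_cong[OF assms(1) this] show "sph_class k u f = sph_class k u g" "sph k u g" by simp_all
qed

lemma sph_class_base:
  assumes "sph k (c\<^sub>0 k) f"
  shows "sph_class k (c\<^sub>0 k) f = proj_sph_class k f"
proof -
  note e = even_intervals_ordered[of k]
  have f: "spheroid (X k) (\<eta> k (c\<^sub>0 k)) f" using assms by (simp add: sph_def)
  have "path_homotopic (X k) (lin k (c\<^sub>0 k) (c\<^sub>0 k)) (\<lambda>_. \<eta> k (c\<^sub>0 k))"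
    by (rule eta_path_unique[OF eta_path_linear[OF e e] eta_path_const[OF e]])
  then have "cube_homotopic (X k) (change_base (lin k (c\<^sub>0 k) (c\<^sub>0 k)) f) (change_base (\<lambda>_. \<eta> k (c\<^sub>0 k)) f)"
    by (rule change_base_homotopic) (use f lin_props[OF e e] in \<open>auto simp: spheroid_iff intro: homotopic_rel_refl\<close>)
  also have "cube_homotopic (X k) \<dots> f" by (rule change_base_const[OF f])
  finally show ?thesis unfolding sph_class_def by (rule proj_spheroid_class_eqI[OF sph_close_up[OF assms]])
qed

text \<open>
  A lift of a spheroid of the orbit space maps the boundary into one fibre, and it is constant there
  by uniqueness of lifts over the boundary of the cube.
\<close>

lemma pi_cases:
  fixes y :: "(real ^ 'l \<Rightarrow> 'a set) set"
  assumes y: "y \<in> \<pi>\<^sub>l k" and l: "CARD('l) > 1"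
  obtains f where "sph k (c\<^sub>0 k) f" "y = sph_class k (c\<^sub>0 k) f"
proof -
  obtain g :: "real ^ 'l \<Rightarrow> 'a set" where g: "y = spheroid_class (Q k) (orbit_base act \<eta> k) g"
    "continuous_map (top_of_set cube) (Q k) g" "\<forall>s\<in>cube_boundary. g s = orbit_base act \<eta> k"
    using y by (auto simp: homotopy_group_set_def spheroid_def)
  note z = zero_in_cube_boundary[where 'l = 'l]
  obtain f where f: "continuous_map (top_of_set cube) (X k) f" "\<forall>s\<in>cube. q k (f s) = g s" "f 0 = basepoint \<eta> k"
    using cov.lift_map_cbox[of "0 :: real ^ 'l" 1 k g 0 "basepoint \<eta> k"] g box_unit_cube_ne basepoint_closed z
    by (auto simp: q_eq Q_eq orbit_base_eq)
  have "f s = basepoint \<eta> k" if s: "s \<in> cube_boundary" for s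
  proof (rule cov.lift_unique[OF connected_cube_boundary[OF l] z _ _ _ _ s])
    show "continuous_map (top_of_set cube_boundary) (X k) f"
      using f(1) by (rule continuous_map_from_subtopology_mono) auto
    show "continuous_map (top_of_set cube_boundary) (X k) (\<lambda>_. basepoint \<eta> k)" using basepoint_closed by simp
    show "cov.proj k (f s) = cov.proj k (basepoint \<eta> k)" if "s \<in> cube_boundary" for s
      using f(2) g(3) that by (simp add: q_eq[symmetric] orbit_base_eq)
  qed (rule f(3))
  then have sp: "spheroid (X k) (basepoint \<eta> k) f" using f(1) by (simp add: spheroid_iff)
  then have s: "sph k (c\<^sub>0 k) f" by (simp add: sph_def even_intervals_ordered basepoint_eq)
  have "cube_homotopic (Q k) (\<lambda>s. q k (f s)) g"
    by (rule homotopic_rel_eq) (use f continuous_map_compose[OF f(1) continuous_q] in \<open>auto simp: o_def\<close>)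
  then have "homotopy_class_rel cube cube_boundary (Q k) g = homotopy_class_rel cube cube_boundary (Q k) (\<lambda>s. q k (f s))"
    by (rule homotopy_class_rel_eqI[symmetric])
  then have "y = proj_sph_class k f"
    unfolding g(1) proj_spheroid_class_eq[OF sp] using g(3) by (subst spheroid_class_eq) simp_all
  then show ?thesis using that s sph_class_base[OF s] by simp
qed

lemma sph_class_in_pi:
  assumes "sph k u f"
  shows "sph_class k u f \<in> \<pi>\<^sub>l k"
proof -
  let ?N = "change_base (lin k (c\<^sub>0 k) u) f"
  have "spheroid (Q k) (orbit_base act \<eta> k) (q k \<circ> ?N)"
    using sph_close_up[OF assms] continuous_map_compose[OF _ continuous_q] by (auto simp: spheroid_iff orbit_base_eq)
  then show ?thesis unfolding homotopy_group_set_def sph_class_def proj_spheroid_class_def by blast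
qed

definition sphs where
  "sphs ms us gs \<longleftrightarrow> length us = length ms \<and> length gs = length ms \<and> (\<forall>i<length ms. sph (ms ! i) (us ! i) (gs ! i))"

definition sph_classes where
  "sph_classes ms us gs = map (\<lambda>i. sph_class (ms ! i) (us ! i) (gs ! i)) [0..<length ms]"

lemma sph_glue:
  fixes f :: "real ^ 'l \<Rightarrow> 'a"
  assumes f: "sph (length ms) u f" and gs: "sphs ms us gs"
  shows "sph (sum_list ms) (little_intervals_comp ms u us) (glue ms f gs)"
proof -
  have u: "u \<in> ordered_intervals (length ms)" and us: "list_all2 (\<lambda>m u. u \<in> ordered_intervals m) ms us"
    and len: "length us = length ms" "length gs = length ms"
    using f gs by (auto simp: sph_def sphs_def list_all2_conv_all_nth)
  have "continuous_map (top_of_set cube) (X (sum_list ms)) (glue ms f gs)"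
    by (rule continuous_map_op_comp[OF operad_C])
       (use f gs in \<open>auto simp: sph_def sphs_def spheroid_iff list_all2_conv_all_nth\<close>)
  moreover have "glue ms f gs s = \<eta> (sum_list ms) (little_intervals_comp ms u us)" if "s \<in> cube_boundary" for s
  proof -
    have "map (\<lambda>g. g s) gs = map (\<lambda>i. \<eta> (ms ! i) (us ! i)) [0..<length ms]"
      using gs that by (intro nth_equalityI) (auto simp: sph_def sphs_def spheroid_iff)
    then show ?thesis using eta_comp[OF u us] f that by (simp add: sph_def spheroid_iff)
  qed
  ultimately show ?thesis
    using little_intervals_comp_ordered[OF u us] by (simp add: sph_def spheroid_iff)
qed

lemma listset_lifted_spheroids:
  assumes "sphs ms us gs"
  shows "listset (map2 sph_lifts ms (sph_classes ms us gs)) \<noteq> {}"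
    and "Gs \<in> listset (map2 sph_lifts ms (sph_classes ms us gs)) \<Longrightarrow> length Gs = length ms"
    and "Gs \<in> listset (map2 sph_lifts ms (sph_classes ms us gs)) \<Longrightarrow> i < length ms \<Longrightarrow>
      Gs ! i \<in> sph_lifts (ms ! i) (sph_class (ms ! i) (us ! i) (gs ! i))"
proof -
  have "map (\<lambda>i. change_base (lin (ms ! i) (c\<^sub>0 (ms ! i)) (us ! i)) (gs ! i)) [0..<length ms]
      \<in> listset (map2 sph_lifts ms (sph_classes ms us gs))"
    using assms sph_class_lifted(1) by (auto simp: listset_iff list_all2_conv_all_nth sph_classes_def sphs_def)
  then show "listset (map2 sph_lifts ms (sph_classes ms us gs)) \<noteq> {}" by blast
qed (auto simp: listset_iff list_all2_conv_all_nth sph_classes_def)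

text \<open>
  As for arrows, the composites of the connecting paths combine with the linear path \<open>\<delta>\<^sub>1\<close> to a path
  of ordered configurations; change of base point commutes with the composition pointwise.
\<close>

lemma sph_class_comp:
  fixes f :: "real ^ 'l \<Rightarrow> 'a"
  assumes f: "sph (length ms) u f" and gs: "sphs ms us gs"
  shows "compl ms (sph_class (length ms) u f) (sph_classes ms us gs) =
    sph_class (sum_list ms) (little_intervals_comp ms u us) (glue ms f gs)"
proof -
  let ?k = "length ms" and ?n = "sum_list ms" and ?u = "little_intervals_comp ms u us"
  let ?M = "glue ms f gs"
  let ?ls = "map (\<lambda>i. lin (ms ! i) (c\<^sub>0 (ms ! i)) (us ! i)) [0..<?k]"
  let ?A = "glue ms (lin ?k (c\<^sub>0 ?k) u) ?ls"
  note e = even_intervals_ordered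
  have u: "u \<in> ordered_intervals ?k" and len: "length us = ?k" "length gs = ?k"
    and g: "\<And>i. i < ?k \<Longrightarrow> us ! i \<in> ordered_intervals (ms ! i)" "\<And>i. i < ?k \<Longrightarrow> sph (ms ! i) (us ! i) (gs ! i)"
    using f gs by (auto simp: sph_def sphs_def)
  have M: "sph ?n ?u ?M" by (rule sph_glue[OF f gs])
  then have M': "?u \<in> ordered_intervals ?n" "spheroid (X ?n) (\<eta> ?n ?u) ?M" by (auto simp: sph_def)
  have A: "eta_path ?n (little_intervals_comp ms (c\<^sub>0 ?k) (map c\<^sub>0 ms)) ?u ?A"
    by (rule eta_path_glue) (use eta_path_linear e u g len in auto)
  note b = eta_path_base_path[of ms]
  have main: "proj_sph_class ?n (change_base (base_path \<eta> ms) (glue ms F Gs)) = sph_class ?n ?u ?M"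
    if F: "cube_homotopic (X ?k) F (change_base (lin ?k (c\<^sub>0 ?k) u) f)" and lG: "length Gs = ?k"
      and G: "\<And>i. i < ?k \<Longrightarrow> cube_homotopic (X (ms ! i)) (Gs ! i) (change_base (lin (ms ! i) (c\<^sub>0 (ms ! i)) (us ! i)) (gs ! i))"
    for F Gs
  proof -
    have "cube_homotopic (X ?n) (glue ms F Gs) (glue ms (change_base (lin ?k (c\<^sub>0 ?k) u) f)
       (map (\<lambda>i. change_base (lin (ms ! i) (c\<^sub>0 (ms ! i)) (us ! i)) (gs ! i)) [0..<?k]))"
      by (rule glue_homotopic[OF F]) (use lG G in auto)
    also have "glue ms (change_base (lin ?k (c\<^sub>0 ?k) u) f)
       (map (\<lambda>i. change_base (lin (ms ! i) (c\<^sub>0 (ms ! i)) (us ! i)) (gs ! i)) [0..<?k]) =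
      change_base ?A (glue ms f (map (\<lambda>i. gs ! i) [0..<?k]))"
      by (rule glue_change_base)
    also have "map (\<lambda>i. gs ! i) [0..<?k] = gs" using len(2) by (metis map_nth)
    finally have GH: "cube_homotopic (X ?n) (glue ms F Gs) (change_base ?A ?M)" .
    have AM: "spheroid (X ?n) (base_path \<eta> ms 1) (change_base ?A ?M)"
      using spheroid_change_base[OF eta_path_props(1)[OF A], of ?M] M'(2)
      unfolding eta_path_props(2,3)[OF A] eta_path_props(3)[OF b] by blast
    then have FG: "spheroid (X ?n) (base_path \<eta> ms 1) (glue ms F Gs)"
      by (rule spheroid_homotopic[OF _ homotopic_rel_sym[OF GH]])
    have b0: "base_path \<eta> ms 0 = basepoint \<eta> ?n" using eta_path_props[OF b] by (simp add: basepoint_eq)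
    have "cube_homotopic (X ?n) (change_base (base_path \<eta> ms) (glue ms F Gs)) (change_base (base_path \<eta> ms) (change_base ?A ?M))"
      by (rule change_base_homotopic[OF path_homotopic_refl GH]) (use eta_path_props[OF b] FG in \<open>auto simp: spheroid_iff\<close>)
    also have "cube_homotopic (X ?n) \<dots> (change_base (path_join (base_path \<eta> ms) ?A) ?M)"
      by (rule change_base_join) (use eta_path_props[OF b] eta_path_props[OF A] M' in simp_all)
    also have "cube_homotopic (X ?n) \<dots> (change_base (lin ?n (c\<^sub>0 ?n) ?u) ?M)"
      by (rule change_base_homotopic[OF eta_path_unique[OF eta_path_join[OF b A] eta_path_linear[OF e M'(1)]]])
         (use M' eta_path_props[OF A] in \<open>auto simp: spheroid_iff intro: homotopic_rel_refl\<close>)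
    finally show ?thesis
      unfolding sph_class_def using spheroid_change_base[OF eta_path_props(1)[OF b] FG]
      by (intro proj_spheroid_class_eqI) (simp_all add: b0)
  qed
  show ?thesis
    unfolding pi_comp_def
  proof (rule Union_eq_const)
    show "sph_lifts ?k (sph_class ?k u f) \<noteq> {}" using sph_class_lifted(1)[OF f] by blast
    fix F assume F: "F \<in> sph_lifts ?k (sph_class ?k u f)"
    show "(\<Union>Gs\<in>listset (map2 sph_lifts ms (sph_classes ms us gs)).
       proj_sph_class (sum_list ms)
         (change_base (base_path \<eta> ms) (\<lambda>z. op_comp C ms (F z) (map (\<lambda>g. g z) Gs)))) = sph_class ?n ?u ?M"
    proof (rule Union_eq_const)
      fix Gs assume Gs: "Gs \<in> listset (map2 sph_lifts ms (sph_classes ms us gs))"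
      show "proj_sph_class (sum_list ms)
         (change_base (base_path \<eta> ms) (\<lambda>z. op_comp C ms (F z) (map (\<lambda>g. g z) Gs))) = sph_class ?n ?u ?M"
        by (rule main[OF sph_class_lifted(2)[OF f F] listset_lifted_spheroids(2)[OF gs Gs]])
           (rule sph_class_lifted(2)[OF g(2) listset_lifted_spheroids(3)[OF gs Gs]])
    qed (use listset_lifted_spheroids(1)[OF gs] in blast)
  qed
qed

lemma spheroid_translate:
  "spheroid (X k) x f \<Longrightarrow> \<sigma> permutes {..<k} \<Longrightarrow> spheroid (X k) (act k \<sigma> x) (translate k \<sigma> f)"
  using continuous_map_compose[of "top_of_set cube" "X k" f "X k" "act k \<sigma>"] continuous_act
  by (simp add: spheroid_iff o_def)

lemma sph_act:
  assumes a: "arrow k u \<sigma> v a" and f: "sph k v f"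
  shows "sph k u (change_base a (translate k \<sigma> f))"
  using spheroid_change_base[of "X k" a "translate k \<sigma> f"] spheroid_translate[of k "\<eta> k v" f \<sigma>] assms
  by (simp add: sph_def arrow_def)

text \<open>
  The closing path of \<open>a\<close> at \<open>v\<close> cancels against the connecting path of \<open>f\<close>, because both are
  linear between \<open>v\<close> and the even configuration, translated by \<open>\<sigma>\<close>.
\<close>

lemma sph_class_act:
  fixes f :: "real ^ 'l \<Rightarrow> 'a"
  assumes a: "arrow k u \<sigma> v a" and f: "sph k v f"
  shows "actl k (arrow_class k u \<sigma> v a) (sph_class k v f) = sph_class k u (change_base a (translate k \<sigma> f))"
proof -
  note e = even_intervals_ordered[of k]
  have u: "u \<in> ordered_intervals k" "v \<in> ordered_intervals k" "\<sigma> permutes {..<k}" "pathin (X k) a"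
    "a 0 = \<eta> k u" "a 1 = act k \<sigma> (\<eta> k v)" using a by (auto simp: arrow_def)
  have sf: "spheroid (X k) (\<eta> k v) f" using f by (simp add: sph_def)
  note tf = spheroid_translate[OF sf u(3)]
  note l = lin_props[OF e u(1)] lin_props[OF u(2) e] lin_props[OF e u(2)]
  let ?a = "lin k (c\<^sub>0 k) u" and ?b = "translate k \<sigma> (lin k v (c\<^sub>0 k))" and ?b' = "translate k \<sigma> (lin k (c\<^sub>0 k) v)"
  note cu = arrow_close_up[OF a]
  have pb: "pathin (X k) ?b" "pathin (X k) ?b'" using l u pathin_translate by simp_all
  have main: "proj_sph_class k (change_base A (translate k \<sigma> F)) = sph_class k u (change_base a (translate k \<sigma> f))"
    if A: "path_homotopic (X k) A (close_up k u \<sigma> v a)" and F: "cube_homotopic (X k) F (change_base (lin k (c\<^sub>0 k) v) f)"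
      and Fs: "spheroid (X k) (basepoint \<eta> k) F" for A F
  proof -
    have A01: "A 0 = basepoint \<eta> k" "A 1 = act k \<sigma> (basepoint \<eta> k)" "pathin (X k) A"
      using homotopic_rel_imp_eq[OF A, of 0] homotopic_rel_imp_eq[OF A, of 1] cu homotopic_rel_imp_continuous(1)[OF A]
      by (auto simp: arrow_def basepoint_eq pathin_def)
    have "cube_homotopic (X k) (change_base A (translate k \<sigma> F)) (change_base (close_up k u \<sigma> v a) (translate k \<sigma> (change_base (lin k (c\<^sub>0 k) v) f)))"
      by (rule change_base_homotopic[OF A translate_homotopic[OF F u(3)]])
         (use Fs A01 in \<open>auto simp: spheroid_iff\<close>)
    also have "cube_homotopic (X k) \<dots> (change_base (path_join (close_up k u \<sigma> v a) ?b') (translate k \<sigma> f))"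
      unfolding translate_change_base
      by (rule change_base_join) (use cu pb l tf in \<open>auto simp: arrow_def basepoint_eq\<close>)
    also have "cube_homotopic (X k) \<dots> (change_base (path_join ?a a) (translate k \<sigma> f))"
    proof (rule change_base_homotopic)
      show "path_homotopic (X k) (path_join (close_up k u \<sigma> v a) ?b') (path_join ?a a)"
        unfolding close_up_def
        by (rule path_cancel_right)
           (use u l pb translate_eta_loop[OF u(3) eta_path_linear[OF u(2) e] eta_path_linear[OF e u(2)]] in simp_all)
    qed (use tf l in \<open>auto simp: spheroid_iff intro: homotopic_rel_refl\<close>)
    also have "cube_homotopic (X k) \<dots> (change_base ?a (change_base a (translate k \<sigma> f)))"
      by (rule homotopic_rel_sym, rule change_base_join) (use u l tf in simp_all)
    finally show ?thesis
      unfolding sph_class_def using spheroid_change_base[OF A01(3), of "translate k \<sigma> F"] spheroid_translate[OF Fs u(3)] A01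
      by (intro proj_spheroid_class_eqI) simp_all
  qed
  show ?thesis
    unfolding pi_act_def
  proof (rule Union_eq_const)
    show "lifts k (arrow_class k u \<sigma> v a) \<noteq> {}" using arrow_class_lifted(1)[OF a] by blast
    fix A assume A: "A \<in> lifts k (arrow_class k u \<sigma> v a)"
    show "(\<Union>f\<in>sph_lifts k (sph_class k v f).
       proj_sph_class k (change_base A (\<lambda>z. act k (end_perm act \<eta> k A) (f z)))) =
       sph_class k u (change_base a (translate k \<sigma> f))"
    proof (rule Union_eq_const)
      show "sph_lifts k (sph_class k v f) \<noteq> {}" using sph_class_lifted(1)[OF f] by blast
    qed (use main[OF arrow_class_lifted(2)[OF a A] sph_class_lifted(2)[OF f] sph_class_lifted(3)[OF f]] arrow_class_lifted(3)[OF a A] in simp)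
  qed
qed

section \<open>The group operad of the fundamental groups\<close>

lemma pi1_list_cases:
  assumes "list_all2 (\<lambda>m b. b \<in> \<pi>\<^sub>1 m) ms bs"
  obtains \<tau>s gs where "arrows ms (map c\<^sub>0 ms) \<tau>s (map c\<^sub>0 ms) gs" "bs = arrow_classes ms (map c\<^sub>0 ms) \<tau>s (map c\<^sub>0 ms) gs"
proof -
  have len: "length bs = length ms" using list_all2_lengthD[OF assms] by simp
  have "\<forall>i. \<exists>\<sigma> f. i < length ms \<longrightarrow> arrow (ms ! i) (c\<^sub>0 (ms ! i)) \<sigma> (c\<^sub>0 (ms ! i)) f \<and>
      bs ! i = arrow_class (ms ! i) (c\<^sub>0 (ms ! i)) \<sigma> (c\<^sub>0 (ms ! i)) f"
    using assms pi1_cases unfolding list_all2_conv_all_nth by metis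
  then obtain \<tau> g where tg: "\<And>i. i < length ms \<Longrightarrow> arrow (ms ! i) (c\<^sub>0 (ms ! i)) (\<tau> i) (c\<^sub>0 (ms ! i)) (g i) \<and>
      bs ! i = arrow_class (ms ! i) (c\<^sub>0 (ms ! i)) (\<tau> i) (c\<^sub>0 (ms ! i)) (g i)"
    by metis
  show ?thesis
  proof (rule that)
    show "arrows ms (map c\<^sub>0 ms) (map \<tau> [0..<length ms]) (map c\<^sub>0 ms) (map g [0..<length ms])"
      using tg by (auto simp: arrows_def list_all2_conv_all_nth arrow_def)
    show "bs = arrow_classes ms (map c\<^sub>0 ms) (map \<tau> [0..<length ms]) (map c\<^sub>0 ms) (map g [0..<length ms])"
      using tg len by (intro nth_equalityI) (auto simp: arrow_classes_def)
  qed
qed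

lemma arrows_lengths:
  assumes "arrows ms us \<tau>s vs gs"
  shows "length us = length ms" "length \<tau>s = length ms" "length vs = length ms" "length gs = length ms"
  using assms by (auto simp: arrows_def dest: list_all2_lengthD)

lemma glue_assoc:
  assumes f: "f z \<in> op_pts C (length nss)" and len: "length gs = length nss" "map length hss = map length nss"
    and g: "\<And>i. i < length nss \<Longrightarrow> (gs ! i) z \<in> op_pts C (length (nss ! i))"
    and h: "\<And>i j. i < length nss \<Longrightarrow> j < length (nss ! i) \<Longrightarrow> (hss ! i ! j) z \<in> op_pts C (nss ! i ! j)"
  shows "glue (concat nss) (glue (map length nss) f gs) (concat hss) z =
    glue (map sum_list nss) f (map (\<lambda>i. glue (nss ! i) (gs ! i) (hss ! i)) [0..<length nss]) z"
proof -
  have lh: "length hss = length nss" using len(2) by (metis length_map)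
  have lhi: "length (hss ! i) = length (nss ! i)" if "i < length nss" for i
    using that len(2) lh by (metis nth_map)
  have 1: "list_all2 (\<lambda>ns b. b \<in> op_pts C (length ns)) nss (map (\<lambda>g. g z) gs)"
    using g len by (auto simp: list_all2_conv_all_nth)
  have 2: "list_all2 (list_all2 (\<lambda>n c. c \<in> op_pts C n)) nss (map (map (\<lambda>h. h z)) hss)"
    using h lh lhi by (auto simp: list_all2_conv_all_nth)
  have "map (\<lambda>i. op_comp C (nss ! i) (map (\<lambda>g. g z) gs ! i) (map (map (\<lambda>h. h z)) hss ! i)) [0..<length nss] =
      map (\<lambda>g. g z) (map (\<lambda>i. glue (nss ! i) (gs ! i) (hss ! i)) [0..<length nss])"
    using len lh by (intro nth_equalityI) auto
  with operad_assoc[OF operad_C f 1 2] show ?thesis by (simp add: map_concat)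
qed

lemma arrow_class_ext:
  assumes "arrow k u \<sigma> v f" "u = u'" "\<sigma> = \<sigma>'" "v = v'" "\<And>t. t \<in> {0..1} \<Longrightarrow> f t = g t"
  shows "arrow_class k u \<sigma> v f = arrow_class k u' \<sigma>' v' g"
  using arrow_class_eq[OF assms(1,5)] assms(2-4) by simp

abbreviation marked :: "nat \<Rightarrow> 'a marked_path \<Rightarrow> bool" where "marked k d \<equiv> arrow k (src d) (prm d) (tgt d) (pth d)"
abbreviation marked_class :: "nat \<Rightarrow> 'a marked_path \<Rightarrow> (real \<Rightarrow> 'a set) set"
  where "marked_class k d \<equiv> arrow_class k (src d) (prm d) (tgt d) (pth d)"

definition marked_comp :: "nat list \<Rightarrow> 'a marked_path \<Rightarrow> 'a marked_path list \<Rightarrow> 'a marked_path"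
  where "marked_comp ms d ds = Marked_Path (little_intervals_comp ms (src d) (map src ds)) (symm_comp ms (prm d) (map prm ds))
    (little_intervals_comp (permute_by (prm d) ms) (tgt d) (permute_by (prm d) (map tgt ds))) (glue ms (pth d) (map pth ds))"

lemma arrows_map:
  assumes "list_all2 marked ms ds"
  shows "arrows ms (map src ds) (map prm ds) (map tgt ds) (map pth ds)"
    and "arrow_classes ms (map src ds) (map prm ds) (map tgt ds) (map pth ds) = map2 marked_class ms ds"
  using assms by (auto simp: arrows_def arrow_classes_def arrow_def list_all2_conv_all_nth intro!: nth_equalityI)

lemma pi1_eq: "\<pi>\<^sub>1 k = {marked_class k d | d. marked k d}"
proof (intro equalityI subsetI)
  fix x assume "x \<in> \<pi>\<^sub>1 k"
  then obtain \<sigma> f where "arrow k (c\<^sub>0 k) \<sigma> (c\<^sub>0 k) f" "x = arrow_class k (c\<^sub>0 k) \<sigma> (c\<^sub>0 k) f" by (rule pi1_cases)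
  then show "x \<in> {marked_class k d | d. marked k d}" by (intro CollectI exI[of _ "Marked_Path (c\<^sub>0 k) \<sigma> (c\<^sub>0 k) f"]) simp
qed (use arrow_class_in_pi1 in blast)

text \<open>
  The four components are compared separately.  Sources and permutations agree by associativity for
  little intervals and permutations, the paths agree pointwise by associativity in \<open>C\<close>, and the
  targets are two ways of permuting nested lists of configurations.
\<close>

lemma marked_comp_assoc:
  assumes d: "marked (length nss) d" and ds: "list_all2 (\<lambda>ns. marked (length ns)) nss ds"
    and dss: "list_all2 (list_all2 marked) nss dss"
  shows "marked_class (sum_list (concat nss)) (marked_comp (concat nss) (marked_comp (map length nss) d ds) (concat dss)) =
    marked_class (sum_list (concat nss)) (marked_comp (map sum_list nss) d (map (\<lambda>i. marked_comp (nss ! i) (ds ! i) (dss ! i)) [0..<length nss]))"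
proof -
  let ?k = "length nss" and ?ms = "map length nss" and ?ss = "map sum_list nss"
  let ?us = "map src ds" and ?uss = "map (map src) dss" and ?vs = "map tgt ds" and ?vss = "map (map tgt) dss"
  let ?\<sigma> = "prm d" and ?\<tau>s = "map prm ds" and ?\<kappa>ss = "map (map prm) dss"
  let ?\<rho> = "symm_comp ?ms ?\<sigma> ?\<tau>s"
  have len: "length ds = ?k" "length dss = ?k" using ds dss by (auto dest: list_all2_lengthD)
  have mlen: "map length dss = ?ms"
    using dss by (intro nth_equalityI) (auto simp: list_all2_conv_all_nth)
  have mlen': "map length (map (map f) dss) = ?ms" for f :: "'a marked_path \<Rightarrow> 'x" using mlen by (simp add: o_def)
  have ds': "list_all2 marked ?ms ds" using ds by (simp add: list_all2_map1)
  have \<sigma>: "?\<sigma> permutes {..<?k}" using d by (simp add: arrow_def)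
  have \<tau>i: "prm (ds ! i) permutes {..<length (nss ! i)}" if "i < ?k" for i
    using ds that by (simp add: list_all2_conv_all_nth arrow_def)
  have \<tau>s: "list_all2 (\<lambda>m \<tau>. \<tau> permutes {..<m}) ?ms ?\<tau>s" using \<tau>i len by (simp add: list_all2_conv_all_nth)
  have \<rho>: "?\<rho> permutes {..<sum_list ?ms}" by (rule symm_comp_permutes) (use \<sigma> \<tau>s in simp_all)
  have eU: "little_intervals_comp (concat nss) (little_intervals_comp ?ms (src d) ?us) (concat ?uss) =
      little_intervals_comp ?ss (src d) (map (\<lambda>i. little_intervals_comp (nss ! i) (?us ! i) (?uss ! i)) [0..<?k])"
    by (rule little_intervals_comp_assoc) (use len mlen' in simp_all)
  have eK: "symm_comp (concat nss) ?\<rho> (concat ?\<kappa>ss) =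
      symm_comp ?ss ?\<sigma> (map (\<lambda>i. symm_comp (nss ! i) (?\<tau>s ! i) (?\<kappa>ss ! i)) [0..<?k])"
    by (rule symm_comp_assoc[OF \<sigma>])
       (use \<tau>i dss len in \<open>auto simp: list_all2_conv_all_nth arrow_def\<close>)
  let ?vs2 = "map (\<lambda>i. little_intervals_comp (permute_by (?\<tau>s ! i) (nss ! i)) (?vs ! i) (permute_by (?\<tau>s ! i) (?vss ! i))) [0..<?k]"
  have eV: "little_intervals_comp (permute_by ?\<rho> (concat nss))
      (little_intervals_comp (permute_by ?\<sigma> ?ms) (tgt d) (permute_by ?\<sigma> ?vs)) (permute_by ?\<rho> (concat ?vss)) =
    little_intervals_comp (permute_by ?\<sigma> ?ss) (tgt d) (permute_by ?\<sigma> ?vs2)"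
  proof -
    let ?nss = "map2 permute_by ?\<tau>s nss" and ?xss = "map2 permute_by ?\<tau>s ?vss"
    let ?nss' = "permute_by ?\<sigma> ?nss" and ?xss' = "permute_by ?\<sigma> ?xss" and ?vs' = "permute_by ?\<sigma> ?vs"
    have l: "length ?nss = ?k" "length ?xss = ?k" using len by simp_all
    have c: "permute_by ?\<rho> (concat nss) = concat ?nss'" "permute_by ?\<rho> (concat ?vss) = concat ?xss'"
      using permute_by_symm_comp[OF refl _ \<tau>s \<rho>] permute_by_symm_comp[OF mlen' _ \<tau>s \<rho>] \<sigma> by simp_all
    have "map length ?nss = ?ms" "map length ?xss = ?ms" "map sum_list ?nss = ?ss"
      using len mlen'[of tgt] \<tau>i sum_list_permute_by by (auto intro!: nth_equalityI dest: map_eq_imp_length_eq simp: list_eq_iff_nth_eq)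
    then have ln: "map length ?nss' = permute_by ?\<sigma> ?ms" "map sum_list ?nss' = permute_by ?\<sigma> ?ss"
        "map length ?xss' = permute_by ?\<sigma> ?ms"
      using permute_by_map[of ?\<sigma> ?nss length] permute_by_map[of ?\<sigma> ?nss sum_list] permute_by_map[of ?\<sigma> ?xss length] \<sigma> l
      by simp_all
    have "little_intervals_comp (concat ?nss') (little_intervals_comp (map length ?nss') (tgt d) ?vs') (concat ?xss') =
      little_intervals_comp (map sum_list ?nss') (tgt d)
        (map (\<lambda>i. little_intervals_comp (?nss' ! i) (?vs' ! i) (?xss' ! i)) [0..<length ?nss'])"
      by (rule little_intervals_comp_assoc) (use len ln in simp_all)
    also have "map (\<lambda>i. little_intervals_comp (?nss' ! i) (?vs' ! i) (?xss' ! i)) [0..<length ?nss'] =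
      permute_by ?\<sigma> (map (\<lambda>i. little_intervals_comp (?nss ! i) (?vs ! i) (?xss ! i)) [0..<?k])"
      using permute_by_map_index3[OF \<sigma> l(1) _ l(2), of ?vs little_intervals_comp] len by simp
    also have "map (\<lambda>i. little_intervals_comp (?nss ! i) (?vs ! i) (?xss ! i)) [0..<?k] = ?vs2"
      using len by (intro nth_equalityI) auto
    finally show ?thesis unfolding c ln .
  qed
  have eW: "glue (concat nss) (glue ?ms (pth d) (map pth ds)) (concat (map (map pth) dss)) t =
      glue ?ss (pth d) (map (\<lambda>i. glue (nss ! i) (map pth ds ! i) (map (map pth) dss ! i)) [0..<?k]) t" if t: "t \<in> {0..1}" for t
  proof (rule glue_assoc)
    have pt: "pth e t \<in> op_pts C n" if "marked n e" for n e
      using that pathin_closed[OF _ t] by (simp add: arrow_def)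
    show "pth d t \<in> op_pts C ?k" by (rule pt[OF d])
    show "(map pth ds ! i) t \<in> op_pts C (length (nss ! i))" if "i < ?k" for i
      using pt list_all2_nthD[OF ds that] len that by simp
    show "(map (map pth) dss ! i ! j) t \<in> op_pts C (nss ! i ! j)" if "i < ?k" "j < length (nss ! i)" for i j
      using pt[OF list_all2_nthD[OF list_all2_nthD[OF dss that(1)] that(2)]] list_all2_lengthD[OF list_all2_nthD[OF dss that(1)]]
        len that by simp
  qed (use len mlen' in simp_all)
  let ?es = "map (\<lambda>i. marked_comp (nss ! i) (ds ! i) (dss ! i)) [0..<?k]"
  have es: "map src ?es = map (\<lambda>i. little_intervals_comp (nss ! i) (?us ! i) (?uss ! i)) [0..<?k]"
    "map prm ?es = map (\<lambda>i. symm_comp (nss ! i) (?\<tau>s ! i) (?\<kappa>ss ! i)) [0..<?k]" "map tgt ?es = ?vs2"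
    "map pth ?es = map (\<lambda>i. glue (nss ! i) (map pth ds ! i) (map (map pth) dss ! i)) [0..<?k]"
    using len by (auto simp: marked_comp_def)
  have "marked (sum_list (concat nss)) (marked_comp (concat nss) (marked_comp ?ms d ds) (concat dss))"
    using arrow_glue[OF _ arrows_map(1)[OF list_all2_concat[OF dss]], of "src (marked_comp ?ms d ds)" "prm (marked_comp ?ms d ds)"]
      arrow_glue[OF _ arrows_map(1)[OF ds'], of "src d" ?\<sigma> "tgt d" "pth d"] d
    by (simp add: marked_comp_def length_concat)
  then show ?thesis
    by (rule arrow_class_ext; unfold marked_comp_def[of ?ss] marked_comp_def[of "concat nss"] marked_comp_def[of ?ms] marked_path.sel es map_concat)
       (rule eU eK eV eW[unfolded map_concat]; assumption?)+
qed

lemma is_set_operad_pi1: "is_set_operad Pi1"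
proof (rule is_set_operad_representatives[where R = marked and c = marked_class and cm = marked_comp])
  let ?G = "Pi1" and ?e = "\<lambda>n. Marked_Path (c\<^sub>0 n) id (c\<^sub>0 n) (\<lambda>_. \<eta> n (c\<^sub>0 n))"
  note e = even_intervals_ordered
  show "op_space ?G n = discrete_topology {marked_class n d | d. marked n d}" for n
    by (simp add: pi1_operad_def pi1_eq[symmetric])
  show "marked 0 (?e 0)" "marked 1 (?e 1)" using arrow_const[OF e] by simp_all
  show "op_unit ?G = marked_class 1 (?e 1)" by (simp add: pi1_operad_def pi1_one_arrow_class)
  show "marked (sum_list ms) (marked_comp ms d ds)"
    and "op_comp ?G ms (marked_class (length ms) d) (map2 marked_class ms ds) = marked_class (sum_list ms) (marked_comp ms d ds)"
    if "marked (length ms) d" "list_all2 marked ms ds" for ms d ds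
    using arrow_glue[OF that(1) arrows_map(1)[OF that(2)]] arrow_class_comp[OF that(1) arrows_map(1)[OF that(2)]]
    unfolding arrows_map(2)[OF that(2)] by (simp_all add: marked_comp_def pi1_operad_def)
  show "marked_class 0 d = marked_class 0 (?e 0)" if d: "marked 0 d" for d
  proof -
    obtain x0 where x0: "op_pts C 0 = {x0}" using operad_C unfolding is_operad_def by (elim conjE exE)
    have o: "u = v" if "u \<in> ordered_intervals 0" "v \<in> ordered_intervals 0" for u v
      using that by (auto simp: ordered_intervals_def)
    show ?thesis
      by (rule arrow_class_ext[OF d])
         (use d o e[of 0] pathin_closed[of 0 "pth d"] eta_closed[OF e, of 0] x0 in \<open>auto simp: arrow_def\<close>)
  qed
  fix n d assume d: "marked n d"
  then have \<sigma>: "prm d permutes {..<n}" and o: "src d \<in> ordered_intervals n" "tgt d \<in> ordered_intervals n"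
    and pt: "\<And>t. t \<in> {0..1} \<Longrightarrow> pth d t \<in> op_pts C n"
    using pathin_closed by (auto simp: arrow_def)
  show "marked_class n (marked_comp [n] (?e 1) [d]) = marked_class n d"
    by (rule arrow_class_ext[OF d, symmetric])
       (use little_intervals_comp_unit_left[OF o(1)] little_intervals_comp_unit_left[OF o(2)] symm_comp_unit(1)[OF \<sigma>]
         operad_unit(2)[OF operad_C pt] in \<open>simp_all add: marked_comp_def eta_unit[simplified]\<close>)
  show "marked_class n (marked_comp (replicate n 1) d (replicate n (?e 1))) = marked_class n d"
    by (rule arrow_class_ext[OF d, symmetric])
       (use little_intervals_comp_unit_right[OF o(1)] little_intervals_comp_unit_right[OF o(2)] symm_comp_unit(2)[OF \<sigma>]
         operad_unit(3)[OF operad_C pt] in \<open>simp_all add: marked_comp_def eta_unit[simplified] permute_by_replicate[OF \<sigma>]\<close>)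
qed (rule marked_comp_assoc)

lemma group_pi1:
  "group \<lparr>carrier = \<pi>\<^sub>1 k, mult = mul1 k, one = one1 k\<rparr>"
proof (rule groupI; simp)
  note e = even_intervals_ordered[of k]
  let ?c = "c\<^sub>0 k"
  note one = arrow_const[OF e]
  have eta: "\<eta> k ?c \<in> op_pts C k" by (rule eta_closed[OF e])
  show "one1 k \<in> \<pi>\<^sub>1 k" unfolding pi1_one_arrow_class by (rule arrow_class_in_pi1[OF one])
  show "mul1 k x y \<in> \<pi>\<^sub>1 k" if xy: "x \<in> \<pi>\<^sub>1 k" "y \<in> \<pi>\<^sub>1 k" for x y
  proof -
    obtain \<sigma> f where f: "arrow k ?c \<sigma> ?c f" "x = arrow_class k ?c \<sigma> ?c f" using pi1_cases[OF xy(1)] .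
    obtain \<tau> g where g: "arrow k ?c \<tau> ?c g" "y = arrow_class k ?c \<tau> ?c g" using pi1_cases[OF xy(2)] .
    show ?thesis unfolding f(2) g(2) arrow_class_mult[OF f(1) g(1)] by (rule arrow_class_in_pi1[OF arrow_join[OF f(1) g(1)]])
  qed
  show "mul1 k (mul1 k x y) z = mul1 k x (mul1 k y z)"
    if xyz: "x \<in> \<pi>\<^sub>1 k" "y \<in> \<pi>\<^sub>1 k" "z \<in> \<pi>\<^sub>1 k" for x y z
  proof -
    obtain \<sigma> f where f: "arrow k ?c \<sigma> ?c f" "x = arrow_class k ?c \<sigma> ?c f" using pi1_cases[OF xyz(1)] .
    obtain \<tau> g where g: "arrow k ?c \<tau> ?c g" "y = arrow_class k ?c \<tau> ?c g" using pi1_cases[OF xyz(2)] .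
    obtain \<kappa> h where h: "arrow k ?c \<kappa> ?c h" "z = arrow_class k ?c \<kappa> ?c h" using pi1_cases[OF xyz(3)] .
    note fg = arrow_join[OF f(1) g(1)] and gh = arrow_join[OF g(1) h(1)]
    note fgh = arrow_join[OF fg h(1)] and fgh' = arrow_join[OF f(1) gh]
    have perms: "\<sigma> permutes {..<k}" "\<tau> permutes {..<k}" using f(1) g(1) by (auto simp: arrow_def)
    have p: "pathin (X k) f" "pathin (X k) g" "pathin (X k) h" using f g h by (auto simp: arrow_def)
    have "path_homotopic (X k) (path_join (path_join f (translate k \<sigma> g)) (translate k \<sigma> (translate k \<tau> h)))
        (path_join f (path_join (translate k \<sigma> g) (translate k \<sigma> (translate k \<tau> h))))"
      by (rule path_join_assoc) (use p perms f(1) g(1) h(1) in \<open>simp_all add: pathin_translate arrow_def\<close>)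
    then have hom: "path_homotopic (X k) (path_join (path_join f (translate k \<sigma> g)) (translate k \<sigma> (translate k \<tau> h)))
        (path_join f (translate k \<sigma> (path_join g (translate k \<tau> h))))"
      by (simp add: translate_path_join)
    have eq: "path_join (path_join f (translate k \<sigma> g)) (translate k (\<tau> \<circ> \<sigma>) h) t =
        path_join (path_join f (translate k \<sigma> g)) (translate k \<sigma> (translate k \<tau> h)) t" if "t \<in> {0..1}" for t
      using act_comp[OF perms] pathin_closed[OF p(3), of "2 * t - 1"] that by (auto simp: path_join_def)
    have "arrow_class k ?c (\<kappa> \<circ> (\<tau> \<circ> \<sigma>)) ?c (path_join (path_join f (translate k \<sigma> g)) (translate k (\<tau> \<circ> \<sigma>) h)) =
      arrow_class k ?c (\<kappa> \<circ> (\<tau> \<circ> \<sigma>)) ?c (path_join (path_join f (translate k \<sigma> g)) (translate k \<sigma> (translate k \<tau> h)))"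
      by (rule arrow_class_eq[OF fgh eq])
    also have "\<dots> = arrow_class k ?c (\<kappa> \<circ> (\<tau> \<circ> \<sigma>)) ?c (path_join f (translate k \<sigma> (path_join g (translate k \<tau> h))))"
    proof (rule arrow_class_cong(2)[symmetric])
      show "arrow k ?c (\<kappa> \<circ> (\<tau> \<circ> \<sigma>)) ?c (path_join f (translate k \<sigma> (path_join g (translate k \<tau> h))))"
        using fgh' by (simp add: o_assoc)
    qed (rule homotopic_rel_sym[OF hom])
    finally show ?thesis
      unfolding f(2) g(2) h(2) arrow_class_mult[OF f(1) g(1)] arrow_class_mult[OF g(1) h(1)] arrow_class_mult[OF fg h(1)] arrow_class_mult[OF f(1) gh]
      by (simp add: o_assoc)
  qed
  show "mul1 k (one1 k) x = x" if x: "x \<in> \<pi>\<^sub>1 k" for x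
  proof -
    obtain \<sigma> f where f: "arrow k ?c \<sigma> ?c f" "x = arrow_class k ?c \<sigma> ?c f" using pi1_cases[OF x] .
    have p: "pathin (X k) f" "f 0 = \<eta> k ?c" using f by (auto simp: arrow_def)
    have j: "arrow k ?c \<sigma> ?c (path_join (\<lambda>_. \<eta> k ?c) (translate k id f))" using arrow_join[OF one f(1)] by simp
    have eq: "path_join (\<lambda>_. \<eta> k ?c) (translate k id f) t = path_join (\<lambda>_. \<eta> k ?c) f t" if "t \<in> {0..1}" for t
      using pathin_closed[OF p(1), of "2 * t - 1"] that by (auto simp: path_join_def)
    have "arrow_class k ?c \<sigma> ?c (path_join (\<lambda>_. \<eta> k ?c) (translate k id f)) = arrow_class k ?c \<sigma> ?c (path_join (\<lambda>_. \<eta> k ?c) f)"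
      by (rule arrow_class_eq[OF j eq])
    also have "\<dots> = arrow_class k ?c \<sigma> ?c f"
      by (rule arrow_class_cong(2)[symmetric, OF f(1)], rule homotopic_rel_sym, rule path_join_const_left) (use p in auto)
    finally show ?thesis unfolding f(2) pi1_one_arrow_class arrow_class_mult[OF one f(1)] by simp
  qed
  show "\<exists>y\<in>\<pi>\<^sub>1 k. mul1 k y x = one1 k" if x: "x \<in> \<pi>\<^sub>1 k" for x
  proof -
    obtain \<sigma> f where f: "arrow k ?c \<sigma> ?c f" "x = arrow_class k ?c \<sigma> ?c f" using pi1_cases[OF x] .
    have p: "pathin (X k) f" "f 0 = \<eta> k ?c" "f 1 = act k \<sigma> (\<eta> k ?c)" "\<sigma> permutes {..<k}" using f by (auto simp: arrow_def)
    let ?i = "inv_into UNIV \<sigma>"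
    have i: "?i permutes {..<k}" by (rule permutes_inv[OF p(4)])
    have si: "\<sigma> \<circ> ?i = id" "?i \<circ> \<sigma> = id" using permutes_inv_o[OF p(4)] by auto
    have if1: "act k ?i (f 1) = \<eta> k ?c"
      using act_comp[OF i p(4) eta] eta by (simp add: p(3) si)
    have g: "arrow k ?c ?i ?c (translate k ?i (path_rev f))"
      unfolding arrow_def using e i p if1 pathin_translate[OF pathin_path_rev[OF p(1)] i] by simp
    have "path_homotopic (X k) (translate k ?i (path_join (path_rev f) f)) (translate k ?i (\<lambda>_. f 1))"
      by (rule translate_homotopic[OF path_join_rev_left[OF p(1)] i])
    then have "path_homotopic (X k) (path_join (translate k ?i (path_rev f)) (translate k ?i f)) (\<lambda>_. \<eta> k ?c)"
      by (simp add: translate_path_join if1)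
    then have "arrow_class k ?c id ?c (path_join (translate k ?i (path_rev f)) (translate k ?i f)) = one1 k"
      unfolding pi1_one_arrow_class by (rule arrow_class_cong(2)[symmetric, OF one homotopic_rel_sym])
    then have "mul1 k (arrow_class k ?c ?i ?c (translate k ?i (path_rev f))) x = one1 k"
      unfolding f(2) arrow_class_mult[OF g f(1)] si by simp
    then show ?thesis using arrow_class_in_pi1[OF g] by blast
  qed
qed

lemma arrow_classes_permute:
  assumes gs: "arrows ms us \<tau>s vs gs" and \<sigma>: "\<sigma> permutes {..<length ms}"
  shows "arrows (permute_by \<sigma> ms) (permute_by \<sigma> us) (permute_by \<sigma> \<tau>s) (permute_by \<sigma> vs) (permute_by \<sigma> gs)"
    and "permute_by \<sigma> (arrow_classes ms us \<tau>s vs gs) =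
      arrow_classes (permute_by \<sigma> ms) (permute_by \<sigma> us) (permute_by \<sigma> \<tau>s) (permute_by \<sigma> vs) (permute_by \<sigma> gs)"
proof -
  have i: "inv_into UNIV \<sigma> i < length ms" if "i < length ms" for i
    using permutes_in_image[OF permutes_inv[OF \<sigma>]] that by auto
  note l = arrows_lengths[OF gs]
  show "arrows (permute_by \<sigma> ms) (permute_by \<sigma> us) (permute_by \<sigma> \<tau>s) (permute_by \<sigma> vs) (permute_by \<sigma> gs)"
    using gs i l by (auto simp: arrows_def list_all2_conv_all_nth permute_by_nth)
  show "permute_by \<sigma> (arrow_classes ms us \<tau>s vs gs) =
      arrow_classes (permute_by \<sigma> ms) (permute_by \<sigma> us) (permute_by \<sigma> \<tau>s) (permute_by \<sigma> vs) (permute_by \<sigma> gs)"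
    using i l by (intro nth_equalityI) (auto simp: arrow_classes_def permute_by_nth)
qed

text \<open>
  Composition commutes with concatenation pointwise, and equivariance moves the translations of the
  second halves to the outside, which permutes the second factors.
\<close>

lemma pi1_product_formula:
  assumes a: "a \<in> \<pi>\<^sub>1 (length ms)" and a': "a' \<in> \<pi>\<^sub>1 (length ms)"
    and bs: "list_all2 (\<lambda>m b. b \<in> \<pi>\<^sub>1 m) ms bs" and bs': "list_all2 (\<lambda>m b. b \<in> \<pi>\<^sub>1 m) ms bs'"
  shows "comp1 ms (mul1 (length ms) a a')
      (map (\<lambda>(m, b, b'). mul1 m b b') (zip ms (zip bs bs'))) =
    mul1 (sum_list ms) (comp1 ms a bs)
      (comp1 (permute_by (perm1 (length ms) a) ms) a' (permute_by (perm1 (length ms) a) bs'))"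
proof -
  let ?k = "length ms" and ?n = "sum_list ms"
  let ?us = "map c\<^sub>0 ms"
  obtain \<sigma> f where f: "arrow ?k (c\<^sub>0 ?k) \<sigma> (c\<^sub>0 ?k) f" "a = arrow_class ?k (c\<^sub>0 ?k) \<sigma> (c\<^sub>0 ?k) f" using pi1_cases[OF a] .
  obtain \<sigma>' f' where f': "arrow ?k (c\<^sub>0 ?k) \<sigma>' (c\<^sub>0 ?k) f'" "a' = arrow_class ?k (c\<^sub>0 ?k) \<sigma>' (c\<^sub>0 ?k) f'" using pi1_cases[OF a'] .
  obtain \<tau>s gs where gs: "arrows ms ?us \<tau>s ?us gs" "bs = arrow_classes ms ?us \<tau>s ?us gs" using pi1_list_cases[OF bs] .
  obtain \<tau>s' gs' where gs': "arrows ms ?us \<tau>s' ?us gs'" "bs' = arrow_classes ms ?us \<tau>s' ?us gs'" using pi1_list_cases[OF bs'] .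
  note l = arrows_lengths[OF gs(1)] arrows_lengths[OF gs'(1)]
  have \<sigma>: "\<sigma> permutes {..<?k}" and \<sigma>': "\<sigma>' permutes {..<?k}" using f(1) f'(1) by (auto simp: arrow_def)
  have \<tau>s: "list_all2 (\<lambda>m \<tau>. \<tau> permutes {..<m}) ms \<tau>s" and \<tau>s': "list_all2 (\<lambda>m \<tau>. \<tau> permutes {..<m}) ms \<tau>s'"
    using gs(1) gs'(1) by (auto simp: arrows_def)
  have perm: "perm1 ?k a = \<sigma>" unfolding f(2) by (rule arrow_class_perm[OF f(1)])
  have s: "sum_list (permute_by \<sigma> ms) = ?n" by (rule sum_list_permute_by[OF \<sigma>])
  note ff' = arrow_join[OF f(1) f'(1)]
  let ?\<tau>s2 = "map (\<lambda>i. \<tau>s' ! i \<circ> \<tau>s ! i) [0..<?k]"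
  let ?gs2 = "map (\<lambda>i. path_join (gs ! i) (translate (ms ! i) (\<tau>s ! i) (gs' ! i))) [0..<?k]"
  have ggi: "arrow (ms ! i) (?us ! i) (?\<tau>s2 ! i) (?us ! i) (?gs2 ! i)" if "i < ?k" for i
    using arrow_join[of "ms ! i" "?us ! i" "\<tau>s ! i" "?us ! i" "gs ! i" "\<tau>s' ! i" "?us ! i" "gs' ! i"] gs(1) gs'(1) that
    by (simp add: arrows_def)
  have gg: "arrows ms ?us ?\<tau>s2 ?us ?gs2"
    using ggi by (auto simp: arrows_def list_all2_conv_all_nth arrow_def)
  have mm: "map (\<lambda>(m, b, b'). mul1 m b b') (zip ms (zip bs bs')) = arrow_classes ms ?us ?\<tau>s2 ?us ?gs2"
  proof (rule nth_equalityI)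
    show "length (map (\<lambda>(m, b, b'). mul1 m b b') (zip ms (zip bs bs'))) = length (arrow_classes ms ?us ?\<tau>s2 ?us ?gs2)"
      by (simp add: gs(2) gs'(2) arrow_classes_def)
    fix i assume "i < length (map (\<lambda>(m, b, b'). mul1 m b b') (zip ms (zip bs bs')))"
    then have i: "i < ?k" by simp
    then show "map (\<lambda>(m, b, b'). mul1 m b b') (zip ms (zip bs bs')) ! i = arrow_classes ms ?us ?\<tau>s2 ?us ?gs2 ! i"
      using arrow_class_mult[of "ms ! i" "?us ! i" "\<tau>s ! i" "?us ! i" "gs ! i" "\<tau>s' ! i" "?us ! i" "gs' ! i"] gs(1) gs'(1)
      by (simp add: gs(2) gs'(2) arrow_classes_def arrows_def)
  qed
  have L: "comp1 ms (mul1 ?k a a')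
      (map (\<lambda>(m, b, b'). mul1 m b b') (zip ms (zip bs bs'))) =
    arrow_class ?n (little_intervals_comp ms (c\<^sub>0 ?k) ?us) (symm_comp ms (\<sigma>' \<circ> \<sigma>) ?\<tau>s2)
      (little_intervals_comp (permute_by (\<sigma>' \<circ> \<sigma>) ms) (c\<^sub>0 ?k) (permute_by (\<sigma>' \<circ> \<sigma>) ?us))
      (glue ms (path_join f (translate ?k \<sigma> f')) ?gs2)"
    unfolding mm f(2) f'(2) arrow_class_mult[OF f(1) f'(1)] by (rule arrow_class_comp[OF ff' gg])
  note LA = arrow_glue[OF ff' gg]
  let ?pm = "permute_by \<sigma> ms" and ?pu = "permute_by \<sigma> ?us" and ?pg = "permute_by \<sigma> gs'" and ?pt = "permute_by \<sigma> \<tau>s'"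
  have f'': "arrow (length ?pm) (c\<^sub>0 ?k) \<sigma>' (c\<^sub>0 ?k) f'" using f'(1) by simp
  note pg = arrow_classes_permute[OF gs'(1) \<sigma>]
  have R1: "comp1 ms a bs = arrow_class ?n (little_intervals_comp ms (c\<^sub>0 ?k) ?us) (symm_comp ms \<sigma> \<tau>s)
      (little_intervals_comp ?pm (c\<^sub>0 ?k) ?pu) (glue ms f gs)"
    unfolding f(2) gs(2) by (rule arrow_class_comp[OF f(1) gs(1)])
  have R2: "comp1 ?pm a' (permute_by \<sigma> bs') = arrow_class ?n (little_intervals_comp ?pm (c\<^sub>0 ?k) ?pu) (symm_comp ?pm \<sigma>' ?pt)
      (little_intervals_comp (permute_by \<sigma>' ?pm) (c\<^sub>0 ?k) (permute_by \<sigma>' ?pu)) (glue ?pm f' ?pg)"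
    unfolding f'(2) gs'(2) pg(2) using arrow_class_comp[OF f'' pg(1)] s by simp
  have A2: "arrow ?n (little_intervals_comp ?pm (c\<^sub>0 ?k) ?pu) (symm_comp ?pm \<sigma>' ?pt)
      (little_intervals_comp (permute_by \<sigma>' ?pm) (c\<^sub>0 ?k) (permute_by \<sigma>' ?pu)) (glue ?pm f' ?pg)"
    using arrow_glue[OF f'' pg(1)] s by simp
  have glue_eq: "glue ms (path_join f (translate ?k \<sigma> f')) ?gs2 t =
      path_join (glue ms f gs) (translate ?n (symm_comp ms \<sigma> \<tau>s) (glue ?pm f' ?pg)) t" if t: "t \<in> {0..1}" for t
  proof -
    have "map (\<lambda>i. gs ! i) [0..<?k] = gs" using l by (metis map_nth)
    then have e1: "glue ms (path_join f (translate ?k \<sigma> f')) ?gs2 =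
      path_join (glue ms f gs) (glue ms (translate ?k \<sigma> f') (map (\<lambda>i. translate (ms ! i) (\<tau>s ! i) (gs' ! i)) [0..<?k]))"
      using glue_path_join[of ms f "translate ?k \<sigma> f'" "\<lambda>i. gs ! i"
          "\<lambda>i. translate (ms ! i) (\<tau>s ! i) (gs' ! i)" ?k] by (simp only:)
    have e2: "glue ms (translate ?k \<sigma> f') (map (\<lambda>i. translate (ms ! i) (\<tau>s ! i) (gs' ! i)) [0..<?k]) (2 * t - 1) =
      translate ?n (symm_comp ms \<sigma> \<tau>s) (glue ?pm f' ?pg) (2 * t - 1)" if "\<not> t \<le> 1/2"
    proof (rule glue_translate[OF \<sigma> \<tau>s])
      have t': "2 * t - 1 \<in> {0..1}" using t that by simp
      show "f' (2 * t - 1) \<in> op_pts C ?k" using f'(1) pathin_closed[OF _ t'] by (simp add: arrow_def)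
      show "(gs' ! i) (2 * t - 1) \<in> op_pts C (ms ! i)" if "i < ?k" for i
        using gs'(1) that pathin_closed[OF _ t'] by (simp add: arrows_def arrow_def)
    qed (use l in simp)
    show ?thesis
      by (rule trans[OF fun_cong[OF e1]]) (use e2 in \<open>simp add: path_join_def\<close>)
  qed
  have "arrow_class ?n (little_intervals_comp ms (c\<^sub>0 ?k) ?us) (symm_comp ms (\<sigma>' \<circ> \<sigma>) ?\<tau>s2)
      (little_intervals_comp (permute_by (\<sigma>' \<circ> \<sigma>) ms) (c\<^sub>0 ?k) (permute_by (\<sigma>' \<circ> \<sigma>) ?us))
      (glue ms (path_join f (translate ?k \<sigma> f')) ?gs2) =
    arrow_class ?n (little_intervals_comp ms (c\<^sub>0 ?k) ?us) (symm_comp ?pm \<sigma>' ?pt \<circ> symm_comp ms \<sigma> \<tau>s)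
      (little_intervals_comp (permute_by \<sigma>' ?pm) (c\<^sub>0 ?k) (permute_by \<sigma>' ?pu))
      (path_join (glue ms f gs) (translate ?n (symm_comp ms \<sigma> \<tau>s) (glue ?pm f' ?pg)))"
    by (rule arrow_class_ext[OF LA refl symm_comp_mult[OF \<sigma> \<sigma>' \<tau>s \<tau>s'] _ glue_eq])
       (use permute_by_comp[of \<sigma> ms \<sigma>'] permute_by_comp[of \<sigma> ?us \<sigma>'] \<sigma> \<sigma>' in simp)
  then show ?thesis
    unfolding L perm R1 R2 arrow_class_mult[OF arrow_glue[OF f(1) gs(1)] A2] .
qed

lemma pi1_operad_simps [simp]:
  "op_space Pi1 = (\<lambda>k. discrete_topology (\<pi>\<^sub>1 k))"
  "op_comp Pi1 = comp1"
  "op_unit Pi1 = one1 1"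
  "go_group Pi1 = (\<lambda>k. \<lparr>carrier = \<pi>\<^sub>1 k, mult = mul1 k, one = one1 k\<rparr>)"
  "go_perm Pi1 = perm1"
  by (simp_all add: pi1_operad_def)

lemma pi1_perm_permutes: "x \<in> \<pi>\<^sub>1 k \<Longrightarrow> perm1 k x permutes {..<k}"
  using pi1_cases[of x k] arrow_class_perm by (metis arrow_def)

lemma pi1_perm_morphism: "operad_morphism Pi1 symm_operad perm1"
  unfolding operad_morphism_def
proof (intro conjI allI ballI)
  have sym: "op_space symm_operad = (\<lambda>n. discrete_topology (carrier (symm_group n)))"
    "op_comp symm_operad = symm_comp" "op_unit symm_operad = id"
    by (simp_all add: symm_operad_def)
  show "continuous_map (op_space Pi1 n) (op_space symm_operad n) (perm1 n)" for n
    using pi1_perm_permutes by (auto simp: sym)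
  show "perm1 1 (op_unit Pi1) = op_unit symm_operad"
    using arrow_class_perm[OF arrow_const[OF even_intervals_ordered], of 1] by (simp add: sym pi1_one_arrow_class)
  fix ms a bs assume "a \<in> op_pts Pi1 (length ms)" "bs \<in> op_tuples Pi1 ms"
  then have a: "a \<in> \<pi>\<^sub>1 (length ms)" and bs: "list_all2 (\<lambda>m b. b \<in> \<pi>\<^sub>1 m) ms bs" by (simp_all add: op_tuples_iff)
  obtain \<sigma> f where f: "arrow (length ms) (c\<^sub>0 (length ms)) \<sigma> (c\<^sub>0 (length ms)) f"
    "a = arrow_class (length ms) (c\<^sub>0 (length ms)) \<sigma> (c\<^sub>0 (length ms)) f" using pi1_cases[OF a] .
  obtain \<tau>s gs where gs: "arrows ms (map c\<^sub>0 ms) \<tau>s (map c\<^sub>0 ms) gs" "bs = arrow_classes ms (map c\<^sub>0 ms) \<tau>s (map c\<^sub>0 ms) gs"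
    using pi1_list_cases[OF bs] .
  have "map2 perm1 ms bs = \<tau>s"
    using gs arrow_class_perm arrows_lengths[OF gs(1)] by (intro nth_equalityI) (auto simp: arrow_classes_def arrows_def)
  then show "perm1 (sum_list ms) (op_comp Pi1 ms a bs) =
      op_comp symm_operad ms (perm1 (length ms) a) (map2 perm1 ms bs)"
    using arrow_class_perm[OF arrow_glue[OF f(1) gs(1)]] arrow_class_perm[OF f(1)]
    unfolding f(2) gs(2) by (simp add: sym arrow_class_comp[OF f(1) gs(1)])
qed

lemma is_group_operad_pi1: "is_group_operad Pi1"
  unfolding is_group_operad_def
proof (intro conjI allI ballI)
  show "is_set_operad Pi1" by (rule is_set_operad_pi1)
  show "operad_morphism Pi1 symm_operad (go_perm Pi1)"
    using pi1_perm_morphism by simp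
  show "group (go_group Pi1 n)" for n using group_pi1 by simp
  show "go_perm Pi1 n \<in> hom (go_group Pi1 n) (symm_group n)" for n
  proof (rule homI)
    fix x y assume "x \<in> carrier (go_group Pi1 n)" "y \<in> carrier (go_group Pi1 n)"
    then have xy: "x \<in> \<pi>\<^sub>1 n" "y \<in> \<pi>\<^sub>1 n" by simp_all
    obtain \<sigma> f where f: "arrow n (c\<^sub>0 n) \<sigma> (c\<^sub>0 n) f" "x = arrow_class n (c\<^sub>0 n) \<sigma> (c\<^sub>0 n) f" using pi1_cases[OF xy(1)] .
    obtain \<tau> g where g: "arrow n (c\<^sub>0 n) \<tau> (c\<^sub>0 n) g" "y = arrow_class n (c\<^sub>0 n) \<tau> (c\<^sub>0 n) g" using pi1_cases[OF xy(2)] .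
    show "go_perm Pi1 n (x \<otimes>\<^bsub>go_group Pi1 n\<^esub> y) =
      go_perm Pi1 n x \<otimes>\<^bsub>symm_group n\<^esub> go_perm Pi1 n y"
      unfolding f(2) g(2) using arrow_class_mult[OF f(1) g(1)] arrow_class_perm[OF arrow_join[OF f(1) g(1)]] arrow_class_perm[OF f(1)] arrow_class_perm[OF g(1)]
      by simp
  qed (simp add: pi1_perm_permutes)
  fix ms a a' bs bs'
  assume "a \<in> op_pts Pi1 (length ms)" "a' \<in> op_pts Pi1 (length ms)"
    "bs \<in> op_tuples Pi1 ms" "bs' \<in> op_tuples Pi1 ms"
  then have "a \<in> \<pi>\<^sub>1 (length ms)" "a' \<in> \<pi>\<^sub>1 (length ms)" "list_all2 (\<lambda>m b. b \<in> \<pi>\<^sub>1 m) ms bs" "list_all2 (\<lambda>m b. b \<in> \<pi>\<^sub>1 m) ms bs'"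
    by (simp_all add: op_tuples_iff)
  from pi1_product_formula[OF this]
  show "op_comp Pi1 ms (mult (go_group Pi1 (length ms)) a a')
         (map (\<lambda>(m, b, b'). mult (go_group Pi1 m) b b') (zip ms (zip bs bs'))) =
       mult (go_group Pi1 (sum_list ms)) (op_comp Pi1 ms a bs)
         (let \<sigma> = go_perm Pi1 (length ms) a
          in op_comp Pi1 (permute_by \<sigma> ms) a' (permute_by \<sigma> bs'))"
    by (simp add: Let_def)
next
  show "carrier (go_group Pi1 n) = op_pts Pi1 n" for n by simp
  show "one (go_group Pi1 1) = op_unit Pi1" by simp
qed

section \<open>The operad of the higher homotopy groups\<close>

lemma pi_operad_simps [simp]:
  "op_space (pi_operad C act \<eta>) = (\<lambda>k. discrete_topology (\<pi>\<^sub>l k))"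
  "op_comp (pi_operad C act \<eta>) = compl"
  "op_unit (pi_operad C act \<eta>) = proj_sph_class 1 (\<lambda>z. basepoint \<eta> 1)"
  by (simp_all add: pi_operad_def)

lemma sph_const: "sph k (c\<^sub>0 k) (\<lambda>_. \<eta> k (c\<^sub>0 k))"
  by (simp add: sph_def spheroid_iff even_intervals_ordered eta_closed)

lemma sph_closed: "sph k u f \<Longrightarrow> z \<in> cube \<Longrightarrow> f z \<in> op_pts C k"
  by (auto simp: sph_def spheroid_iff continuous_map_def)

lemma op_unit_pi_eq:
  "op_unit (pi_operad C act \<eta> :: (real ^ 'l \<Rightarrow> 'a set) set operad) = sph_class 1 (c\<^sub>0 1) (\<lambda>_. \<eta> 1 (c\<^sub>0 1))"
  by (simp add: sph_class_base[OF sph_const] basepoint_eq)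

lemma pi_list_cases:
  fixes bs :: "(real ^ 'l \<Rightarrow> 'a set) set list"
  assumes "list_all2 (\<lambda>m b. b \<in> \<pi>\<^sub>l m) ms bs" "CARD('l) > 1"
  obtains gs where "sphs ms (map c\<^sub>0 ms) gs" "bs = sph_classes ms (map c\<^sub>0 ms) gs"
proof -
  have len: "length bs = length ms" using list_all2_lengthD[OF assms(1)] by simp
  have "\<forall>i. \<exists>f. i < length ms \<longrightarrow> sph (ms ! i) (c\<^sub>0 (ms ! i)) f \<and> bs ! i = sph_class (ms ! i) (c\<^sub>0 (ms ! i)) f"
    using assms pi_cases unfolding list_all2_conv_all_nth by metis
  then obtain g where tg: "\<And>i. i < length ms \<Longrightarrow> sph (ms ! i) (c\<^sub>0 (ms ! i)) (g i) \<and> bs ! i = sph_class (ms ! i) (c\<^sub>0 (ms ! i)) (g i)"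
    by metis
  show ?thesis
  proof (rule that)
    show "sphs ms (map c\<^sub>0 ms) (map g [0..<length ms])" using tg by (auto simp: sphs_def)
    show "bs = sph_classes ms (map c\<^sub>0 ms) (map g [0..<length ms])"
      using tg len by (intro nth_equalityI) (auto simp: sph_classes_def)
  qed
qed

lemma sphs_lengths:
  assumes "sphs ms us gs"
  shows "length us = length ms" "length gs = length ms"
  using assms by (auto simp: sphs_def)

abbreviation marked_sph :: "nat \<Rightarrow> (nat \<Rightarrow> real \<times> real) \<times> (real ^ 'l \<Rightarrow> 'a) \<Rightarrow> bool" where "marked_sph k d \<equiv> sph k (fst d) (snd d)"
abbreviation marked_sph_class :: "nat \<Rightarrow> (nat \<Rightarrow> real \<times> real) \<times> (real ^ 'l \<Rightarrow> 'a) \<Rightarrow> (real ^ 'l \<Rightarrow> 'a set) set"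
  where "marked_sph_class k d \<equiv> sph_class k (fst d) (snd d)"

definition marked_sph_comp :: "nat list \<Rightarrow> (nat \<Rightarrow> real \<times> real) \<times> (real ^ 'l \<Rightarrow> 'a) \<Rightarrow>
    ((nat \<Rightarrow> real \<times> real) \<times> (real ^ 'l \<Rightarrow> 'a)) list \<Rightarrow> (nat \<Rightarrow> real \<times> real) \<times> (real ^ 'l \<Rightarrow> 'a)"
  where "marked_sph_comp ms d ds = (little_intervals_comp ms (fst d) (map fst ds), glue ms (snd d) (map snd ds))"

lemma sphs_map:
  assumes "list_all2 marked_sph ms ds"
  shows "sphs ms (map fst ds) (map snd ds)" and "sph_classes ms (map fst ds) (map snd ds) = map2 marked_sph_class ms ds"
  using assms by (auto simp: sphs_def sph_classes_def list_all2_conv_all_nth intro!: nth_equalityI)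

lemma sph_class_ext:
  assumes "sph k u f" "u = u'" "\<And>z. z \<in> cube \<Longrightarrow> f z = g z"
  shows "sph_class k u f = sph_class k u' g"
  using sph_class_eq(1)[OF assms(1,3)] assms(2) by simp

lemma marked_sph_comp_assoc:
  fixes d :: "(nat \<Rightarrow> real \<times> real) \<times> (real ^ 'l \<Rightarrow> 'a)"
  assumes d: "marked_sph (length nss) d" and ds: "list_all2 (\<lambda>ns. marked_sph (length ns)) nss ds"
    and dss: "list_all2 (list_all2 marked_sph) nss dss"
  shows "marked_sph_class (sum_list (concat nss)) (marked_sph_comp (concat nss) (marked_sph_comp (map length nss) d ds) (concat dss)) =
    marked_sph_class (sum_list (concat nss)) (marked_sph_comp (map sum_list nss) d (map (\<lambda>i. marked_sph_comp (nss ! i) (ds ! i) (dss ! i)) [0..<length nss]))"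
proof -
  let ?k = "length nss" and ?ms = "map length nss" and ?ss = "map sum_list nss"
  have len: "length ds = ?k" "length dss = ?k" using ds dss by (auto dest: list_all2_lengthD)
  have "map length dss = ?ms"
    using dss by (intro nth_equalityI) (auto simp: list_all2_conv_all_nth)
  then have mlen: "map length (map (map f) dss) = ?ms" for f :: "_ \<Rightarrow> 'x" by (simp add: o_def)
  have ds': "list_all2 marked_sph ?ms ds" using ds by (simp add: list_all2_map1)
  have eU: "little_intervals_comp (concat nss) (little_intervals_comp ?ms (fst d) (map fst ds)) (concat (map (map fst) dss)) =
      little_intervals_comp ?ss (fst d) (map (\<lambda>i. little_intervals_comp (nss ! i) (map fst ds ! i) (map (map fst) dss ! i)) [0..<?k])"
    by (rule little_intervals_comp_assoc) (use len mlen in simp_all)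
  have eW: "glue (concat nss) (glue ?ms (snd d) (map snd ds)) (concat (map (map snd) dss)) z =
      glue ?ss (snd d) (map (\<lambda>i. glue (nss ! i) (map snd ds ! i) (map (map snd) dss ! i)) [0..<?k]) z" if z: "z \<in> cube" for z
  proof (rule glue_assoc)
    show "snd d z \<in> op_pts C ?k" by (rule sph_closed[OF d z])
    show "(map snd ds ! i) z \<in> op_pts C (length (nss ! i))" if "i < ?k" for i
      using sph_closed[OF list_all2_nthD[OF ds that] z] len that by simp
    show "(map (map snd) dss ! i ! j) z \<in> op_pts C (nss ! i ! j)" if "i < ?k" "j < length (nss ! i)" for i j
      using sph_closed[OF list_all2_nthD[OF list_all2_nthD[OF dss that(1)] that(2)] z]
        list_all2_lengthD[OF list_all2_nthD[OF dss that(1)]] len that by simp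
  qed (use len mlen in simp_all)
  let ?es = "map (\<lambda>i. marked_sph_comp (nss ! i) (ds ! i) (dss ! i)) [0..<?k]"
  have es: "map fst ?es = map (\<lambda>i. little_intervals_comp (nss ! i) (map fst ds ! i) (map (map fst) dss ! i)) [0..<?k]"
    "map snd ?es = map (\<lambda>i. glue (nss ! i) (map snd ds ! i) (map (map snd) dss ! i)) [0..<?k]"
    using len by (auto simp: marked_sph_comp_def)
  have "marked_sph (sum_list (concat nss)) (marked_sph_comp (concat nss) (marked_sph_comp ?ms d ds) (concat dss))"
    using sph_glue[OF _ sphs_map(1)[OF list_all2_concat[OF dss]], of "fst (marked_sph_comp ?ms d ds)"]
      sph_glue[OF _ sphs_map(1)[OF ds'], of "fst d" "snd d"] d
    by (simp add: marked_sph_comp_def length_concat)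
  then show ?thesis
    by (rule sph_class_ext; unfold marked_sph_comp_def[of ?ss] marked_sph_comp_def[of "concat nss"] marked_sph_comp_def[of ?ms] fst_conv snd_conv es map_concat)
       (rule eU eW[unfolded map_concat]; assumption?)+
qed

lemma pi_eq:
  assumes "CARD('l) > 1"
  shows "(\<pi>\<^sub>l k :: (real ^ 'l \<Rightarrow> 'a set) set set) = {marked_sph_class k d | d. marked_sph k d}"
proof (intro equalityI subsetI)
  fix x :: "(real ^ 'l \<Rightarrow> 'a set) set" assume "x \<in> \<pi>\<^sub>l k"
  then obtain f where "sph k (c\<^sub>0 k) f" "x = sph_class k (c\<^sub>0 k) f" using pi_cases assms by blast
  then show "x \<in> {marked_sph_class k d | d. marked_sph k d}" by (intro CollectI exI[of _ "(c\<^sub>0 k, f)"]) simp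
qed (use sph_class_in_pi in blast)

lemma is_set_operad_pi:
  assumes l: "CARD('l) > 1"
  shows "is_set_operad (pi_operad C act \<eta> :: (real ^ 'l \<Rightarrow> 'a set) set operad)"
proof (rule is_set_operad_representatives[where R = marked_sph and c = marked_sph_class and cm = marked_sph_comp])
  let ?D = "pi_operad C act \<eta> :: (real ^ 'l \<Rightarrow> 'a set) set operad"
  let ?e = "\<lambda>n. (c\<^sub>0 n, \<lambda>_ :: real ^ 'l. \<eta> n (c\<^sub>0 n))"
  note e = even_intervals_ordered
  show "op_space ?D n = discrete_topology {marked_sph_class n d | d. marked_sph n d}" for n
    by (simp only: pi_operad_simps pi_eq[OF l, symmetric])
  show "marked_sph 0 (?e 0)" "marked_sph 1 (?e 1)" using sph_const by simp_all
  show "op_unit ?D = marked_sph_class 1 (?e 1)" by (simp only: op_unit_pi_eq fst_conv snd_conv)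
  show "marked_sph (sum_list ms) (marked_sph_comp ms d ds)"
    and "op_comp ?D ms (marked_sph_class (length ms) d) (map2 marked_sph_class ms ds) = marked_sph_class (sum_list ms) (marked_sph_comp ms d ds)"
    if "marked_sph (length ms) d" "list_all2 marked_sph ms ds" for ms d ds
    using sph_glue[OF that(1) sphs_map(1)[OF that(2)]] sph_class_comp[OF that(1) sphs_map(1)[OF that(2)]]
    unfolding sphs_map(2)[OF that(2)] by (simp_all add: marked_sph_comp_def)
  show "marked_sph_class 0 d = marked_sph_class 0 (?e 0)" if d: "marked_sph 0 d" for d
  proof -
    obtain x0 where x0: "op_pts C 0 = {x0}" using operad_C unfolding is_operad_def by (elim conjE exE)
    have o: "u = v" if "u \<in> ordered_intervals 0" "v \<in> ordered_intervals 0" for u v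
      using that by (auto simp: ordered_intervals_def)
    show ?thesis
      by (rule sph_class_ext[OF d])
         (use d o e[of 0] sph_closed[OF d] eta_closed[OF e, of 0] x0 in \<open>auto simp: sph_def\<close>)
  qed
  fix n and d :: "(nat \<Rightarrow> real \<times> real) \<times> (real ^ 'l \<Rightarrow> 'a)" assume d: "marked_sph n d"
  then have o: "fst d \<in> ordered_intervals n" by (simp add: sph_def)
  show "marked_sph_class n (marked_sph_comp [n] (?e 1) [d]) = marked_sph_class n d"
    by (rule sph_class_ext[OF d, symmetric])
       (use little_intervals_comp_unit_left[OF o] operad_unit(2)[OF operad_C sph_closed[OF d]]
         in \<open>simp_all add: marked_sph_comp_def eta_unit[simplified]\<close>)
  show "marked_sph_class n (marked_sph_comp (replicate n 1) d (replicate n (?e 1))) = marked_sph_class n d"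
    by (rule sph_class_ext[OF d, symmetric])
       (use little_intervals_comp_unit_right[OF o] operad_unit(3)[OF operad_C sph_closed[OF d]]
         in \<open>simp_all add: marked_sph_comp_def eta_unit[simplified]\<close>)
qed (rule marked_sph_comp_assoc)

lemma group_action_pi:
  assumes l: "CARD('l) > 1"
  shows "group_action (go_group Pi1 k) (\<pi>\<^sub>l k :: (real ^ 'l \<Rightarrow> 'a set) set set)
    (\<lambda>x. restrict (actl k x) (\<pi>\<^sub>l k))"
proof (rule group_actionI)
  let ?c = "c\<^sub>0 k"
  note e = even_intervals_ordered[of k]
  show "group (go_group Pi1 k)" using group_pi1 by simp
  show "actl k x y \<in> \<pi>\<^sub>l k"
    if x: "x \<in> carrier (go_group Pi1 k)" and y: "y \<in> \<pi>\<^sub>l k" for x and y :: "(real ^ 'l \<Rightarrow> 'a set) set"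
  proof -
    obtain \<sigma> a where a: "arrow k ?c \<sigma> ?c a" "x = arrow_class k ?c \<sigma> ?c a" using pi1_cases[of x k] x by auto
    obtain f where f: "sph k ?c f" "y = sph_class k ?c f" using pi_cases[OF y l] .
    show ?thesis unfolding a(2) f(2) sph_class_act[OF a(1) f(1)] by (rule sph_class_in_pi[OF sph_act[OF a(1) f(1)]])
  qed
  show "actl k \<one>\<^bsub>go_group Pi1 k\<^esub> y = y" if y: "y \<in> \<pi>\<^sub>l k" for y :: "(real ^ 'l \<Rightarrow> 'a set) set"
  proof -
    obtain f where f: "sph k ?c f" "y = sph_class k ?c f" using pi_cases[OF y l] .
    let ?o = "\<lambda>_::real. \<eta> k ?c"
    have fs: "spheroid (X k) (\<eta> k ?c) f" using f(1) by (simp add: sph_def)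
    have "cube_homotopic (X k) (translate k id f) f"
      by (rule homotopic_rel_sym, rule homotopic_rel_eq) (use fs sph_closed[OF f(1)] in \<open>auto simp: spheroid_iff\<close>)
    then have "cube_homotopic (X k) (change_base ?o (translate k id f)) (change_base ?o f)"
      by (rule change_base_homotopic[OF path_homotopic_refl[OF eta_path_props(1)[OF eta_path_const[OF e]]]])
         (use fs eta_closed[OF e] in \<open>simp add: spheroid_iff\<close>)
    also have "cube_homotopic (X k) \<dots> f" by (rule change_base_const[OF fs])
    finally have "sph_class k ?c (change_base ?o (translate k id f)) = sph_class k ?c f"
      by (rule sph_class_cong(2)[OF sph_act[OF arrow_const[OF e] f(1)]])
    then show ?thesis using sph_class_act[OF arrow_const[OF e] f(1)] by (simp add: pi1_one_arrow_class f(2))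
  qed
  show "actl k (x \<otimes>\<^bsub>go_group Pi1 k\<^esub> x') y = actl k x (actl k x' y)"
    if x: "x \<in> carrier (go_group Pi1 k)" and x': "x' \<in> carrier (go_group Pi1 k)"
      and y: "y \<in> \<pi>\<^sub>l k" for x x' and y :: "(real ^ 'l \<Rightarrow> 'a set) set"
  proof -
    obtain \<sigma> a where a: "arrow k ?c \<sigma> ?c a" "x = arrow_class k ?c \<sigma> ?c a" using pi1_cases[of x k] x by auto
    obtain \<tau> b where b: "arrow k ?c \<tau> ?c b" "x' = arrow_class k ?c \<tau> ?c b" using pi1_cases[of x' k] x' by auto
    obtain f where f: "sph k ?c f" "y = sph_class k ?c f" using pi_cases[OF y l] .
    have perms: "\<sigma> permutes {..<k}" "\<tau> permutes {..<k}" using a(1) b(1) by (auto simp: arrow_def)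
    have fs: "spheroid (X k) (\<eta> k ?c) f" using f(1) by (simp add: sph_def)
    note ab = arrow_join[OF a(1) b(1)]
    note bf = sph_act[OF b(1) f(1)]
    have ab': "path_join a (translate k \<sigma> b) 1 = act k (\<tau> \<circ> \<sigma>) (\<eta> k ?c)" using ab by (simp add: arrow_def)
    have eq: "act k (\<tau> \<circ> \<sigma>) (f z) = act k \<sigma> (act k \<tau> (f z))" if "z \<in> cube" for z
      using act_comp[OF perms sph_closed[OF f(1) that]] .
    have pj: "pathin (X k) (path_join a (translate k \<sigma> b))" using ab by (simp add: arrow_def)
    note tf = spheroid_translate[OF fs permutes_compose[OF perms]]
    have "cube_homotopic (X k) (change_base (path_join a (translate k \<sigma> b)) (translate k (\<tau> \<circ> \<sigma>) f))
        (change_base (path_join a (translate k \<sigma> b)) (translate k \<sigma> (translate k \<tau> f)))"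
    proof (rule change_base_homotopic[OF path_homotopic_refl[OF pj]])
      show "cube_homotopic (X k) (translate k (\<tau> \<circ> \<sigma>) f) (translate k \<sigma> (translate k \<tau> f))"
        by (rule homotopic_rel_eq) (use tf eq in \<open>auto simp: spheroid_iff\<close>)
      show "act k (\<tau> \<circ> \<sigma>) (f s) = path_join a (translate k \<sigma> b) 1" if "s \<in> cube_boundary" for s
        using tf that unfolding ab' spheroid_iff by blast
    qed
    also have "cube_homotopic (X k) \<dots> (change_base a (change_base (translate k \<sigma> b) (translate k \<sigma> (translate k \<tau> f))))"
    proof (rule homotopic_rel_sym, rule change_base_join)
      show "spheroid (X k) (act k \<sigma> (b 1)) (translate k \<sigma> (translate k \<tau> f))"
        using spheroid_translate[OF spheroid_translate[OF fs perms(2)] perms(1)] b(1) by (simp add: arrow_def)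
    qed (use a(1) b(1) perms in \<open>auto simp: arrow_def pathin_translate\<close>)
    finally have "sph_class k ?c (change_base (path_join a (translate k \<sigma> b)) (translate k (\<tau> \<circ> \<sigma>) f)) =
        sph_class k ?c (change_base a (translate k \<sigma> (change_base b (translate k \<tau> f))))"
      unfolding translate_change_base by (rule sph_class_cong(2)[OF sph_act[OF ab f(1)]])
    then show ?thesis
      using sph_class_act[OF ab f(1)] sph_class_act[OF b(1) f(1)] sph_class_act[OF a(1) bf] arrow_class_mult[OF a(1) b(1)]
      by (simp add: a(2) b(2) f(2))
  qed
qed

lemma sph_classes_permute:
  fixes gs :: "(real ^ 'l \<Rightarrow> 'a) list"
  assumes gs: "sphs ms us gs" and \<sigma>: "\<sigma> permutes {..<length ms}"
  shows "sphs (permute_by \<sigma> ms) (permute_by \<sigma> us) (permute_by \<sigma> gs)"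
    and "permute_by \<sigma> (sph_classes ms us gs) = sph_classes (permute_by \<sigma> ms) (permute_by \<sigma> us) (permute_by \<sigma> gs)"
proof -
  have i: "inv_into UNIV \<sigma> i < length ms" if "i < length ms" for i
    using permutes_in_image[OF permutes_inv[OF \<sigma>]] that by auto
  note l = sphs_lengths[OF gs]
  show "sphs (permute_by \<sigma> ms) (permute_by \<sigma> us) (permute_by \<sigma> gs)"
    using gs i l by (auto simp: sphs_def permute_by_nth)
  show "permute_by \<sigma> (sph_classes ms us gs) = sph_classes (permute_by \<sigma> ms) (permute_by \<sigma> us) (permute_by \<sigma> gs)"
    using i l by (intro nth_equalityI) (auto simp: sph_classes_def permute_by_nth)
qed

text \<open>
  The argument for the product formula applies again, with change of base point in place of
  concatenation.
\<close>

lemma pi_act_comp: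
  fixes a :: "(real ^ 'l \<Rightarrow> 'a set) set"
  assumes s: "s \<in> \<pi>\<^sub>1 (length ms)" and ts: "list_all2 (\<lambda>m t. t \<in> \<pi>\<^sub>1 m) ms ts"
    and a: "a \<in> \<pi>\<^sub>l (length ms)" and bs: "list_all2 (\<lambda>m b. b \<in> \<pi>\<^sub>l m) ms bs" and l: "CARD('l) > 1"
  shows "compl ms (actl (length ms) s a)
      (map (\<lambda>(m, t, b). actl m t b) (zip ms (zip ts bs))) =
    actl (sum_list ms) (comp1 ms s ts)
      (compl (permute_by (perm1 (length ms) s) ms) a (permute_by (perm1 (length ms) s) bs))"
proof -
  let ?k = "length ms" and ?n = "sum_list ms"
  let ?us = "map c\<^sub>0 ms"
  obtain \<sigma> p where p: "arrow ?k (c\<^sub>0 ?k) \<sigma> (c\<^sub>0 ?k) p" "s = arrow_class ?k (c\<^sub>0 ?k) \<sigma> (c\<^sub>0 ?k) p" using pi1_cases[OF s] .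
  obtain \<tau>s qs where qs: "arrows ms ?us \<tau>s ?us qs" "ts = arrow_classes ms ?us \<tau>s ?us qs" using pi1_list_cases[OF ts] .
  obtain f where f: "sph ?k (c\<^sub>0 ?k) f" "a = sph_class ?k (c\<^sub>0 ?k) f" using pi_cases[OF a l] .
  obtain gs where gs: "sphs ms ?us gs" "bs = sph_classes ms ?us gs" using pi_list_cases[OF bs l] .
  note len = arrows_lengths[OF qs(1)] sphs_lengths[OF gs(1)]
  have \<sigma>: "\<sigma> permutes {..<?k}" using p(1) by (simp add: arrow_def)
  have \<tau>s: "list_all2 (\<lambda>m \<tau>. \<tau> permutes {..<m}) ms \<tau>s" using qs(1) by (simp add: arrows_def)
  have perm: "perm1 ?k s = \<sigma>" unfolding p(2) by (rule arrow_class_perm[OF p(1)])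
  have sum: "sum_list (permute_by \<sigma> ms) = ?n" by (rule sum_list_permute_by[OF \<sigma>])
  let ?\<rho> = "symm_comp ms \<sigma> \<tau>s"
  let ?gs2 = "map (\<lambda>i. change_base (qs ! i) (translate (ms ! i) (\<tau>s ! i) (gs ! i))) [0..<?k]"
  note pf = sph_act[OF p(1) f(1)]
  have qgi: "sph (ms ! i) (?us ! i) (?gs2 ! i)"
    "actl (ms ! i) (ts ! i) (bs ! i) = sph_class (ms ! i) (?us ! i) (?gs2 ! i)" if i: "i < ?k" for i
  proof -
    have q: "arrow (ms ! i) (?us ! i) (\<tau>s ! i) (?us ! i) (qs ! i)" and g: "sph (ms ! i) (?us ! i) (gs ! i)"
      using qs(1) gs(1) i by (auto simp: arrows_def sphs_def)
    show "sph (ms ! i) (?us ! i) (?gs2 ! i)" using sph_act[OF q g] i by simp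
    show "actl (ms ! i) (ts ! i) (bs ! i) = sph_class (ms ! i) (?us ! i) (?gs2 ! i)"
      using sph_class_act[OF q g] i by (simp add: qs(2) gs(2) arrow_classes_def sph_classes_def)
  qed
  have qg: "sphs ms ?us ?gs2" using qgi(1) by (auto simp: sphs_def)
  have mm: "map (\<lambda>(m, t, b). actl m t b) (zip ms (zip ts bs)) = sph_classes ms ?us ?gs2"
  proof (rule nth_equalityI)
    show "length (map (\<lambda>(m, t, b). actl m t b) (zip ms (zip ts bs))) = length (sph_classes ms ?us ?gs2)"
      by (simp add: qs(2) gs(2) arrow_classes_def sph_classes_def)
    fix i assume "i < length (map (\<lambda>(m, t, b). actl m t b) (zip ms (zip ts bs)))"
    then show "map (\<lambda>(m, t, b). actl m t b) (zip ms (zip ts bs)) ! i = sph_classes ms ?us ?gs2 ! i"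
      using qgi(2)[of i] by (simp add: sph_classes_def)
  qed
  have L: "compl ms (actl ?k s a) (map (\<lambda>(m, t, b). actl m t b) (zip ms (zip ts bs))) =
    sph_class ?n (little_intervals_comp ms (c\<^sub>0 ?k) ?us) (glue ms (change_base p (translate ?k \<sigma> f)) ?gs2)"
    unfolding mm p(2) f(2) sph_class_act[OF p(1) f(1)] by (rule sph_class_comp[OF pf qg])
  note LA = sph_glue[OF pf qg]
  let ?pm = "permute_by \<sigma> ms" and ?pu = "permute_by \<sigma> ?us" and ?pg = "permute_by \<sigma> gs"
  have f'': "sph (length ?pm) (c\<^sub>0 ?k) f" using f(1) by simp
  note pg = sph_classes_permute[OF gs(1) \<sigma>]
  note pq = arrow_glue[OF p(1) qs(1)]
  have R1: "comp1 ms s ts = arrow_class ?n (little_intervals_comp ms (c\<^sub>0 ?k) ?us) ?\<rho>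
      (little_intervals_comp ?pm (c\<^sub>0 ?k) ?pu) (glue ms p qs)"
    unfolding p(2) qs(2) by (rule arrow_class_comp[OF p(1) qs(1)])
  have R2: "compl ?pm a (permute_by \<sigma> bs) = sph_class ?n (little_intervals_comp ?pm (c\<^sub>0 ?k) ?pu) (glue ?pm f ?pg)"
    unfolding f(2) gs(2) pg(2) using sph_class_comp[OF f'' pg(1)] sum by simp
  have A2: "sph ?n (little_intervals_comp ?pm (c\<^sub>0 ?k) ?pu) (glue ?pm f ?pg)"
    using sph_glue[OF f'' pg(1)] sum by simp
  have glue_eq: "glue ms (change_base p (translate ?k \<sigma> f)) ?gs2 z =
      change_base (glue ms p qs) (translate ?n ?\<rho> (glue ?pm f ?pg)) z" if z: "z \<in> cube" for z
  proof -
    have "map (\<lambda>i. qs ! i) [0..<?k] = qs" using len by (metis map_nth)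
    then have e1: "glue ms (change_base p (translate ?k \<sigma> f)) ?gs2 =
      change_base (glue ms p qs) (glue ms (translate ?k \<sigma> f) (map (\<lambda>i. translate (ms ! i) (\<tau>s ! i) (gs ! i)) [0..<?k]))"
      using glue_change_base[of ms p "translate ?k \<sigma> f" "\<lambda>i. qs ! i"
          "\<lambda>i. translate (ms ! i) (\<tau>s ! i) (gs ! i)" ?k] by (simp only:)
    have e2: "glue ms (translate ?k \<sigma> f) (map (\<lambda>i. translate (ms ! i) (\<tau>s ! i) (gs ! i)) [0..<?k]) w =
      translate ?n ?\<rho> (glue ?pm f ?pg) w" if w: "w \<in> cube" for w
    proof (rule glue_translate[OF \<sigma> \<tau>s])
      show "f w \<in> op_pts C ?k" by (rule sph_closed[OF f(1) w])
      show "(gs ! i) w \<in> op_pts C (ms ! i)" if "i < ?k" for i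
        by (rule sph_closed[OF _ w, of _ "?us ! i"]) (use gs(1) that in \<open>simp add: sphs_def\<close>)
    qed (use len in simp)
    show ?thesis
    proof (cases "radius z \<le> 1/2")
      case True
      let ?w = "(1/2) *\<^sub>R ((1 / (1/2)) *\<^sub>R (2 *\<^sub>R z - 1) + 1)"
      have "radius ?w = radius z / (1/2)" by (rule radius_scaled) simp
      then have "?w \<in> cube" unfolding mem_cube_iff using True by simp
      from e2[OF this] show ?thesis
        by (intro trans[OF fun_cong[OF e1]]) (simp only: change_base_eq True if_True)
    next
      case False
      then show ?thesis
        by (intro trans[OF fun_cong[OF e1]]) (simp only: change_base_eq if_False)
    qed
  qed
  show ?thesis
    unfolding L perm R1 R2 sph_class_act[OF pq A2] by (rule sph_class_eq(1)[OF LA glue_eq])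
qed

end

theorem theorem3p6:
  fixes C :: "'a operad"
    and act :: "nat \<Rightarrow> (nat \<Rightarrow> nat) \<Rightarrow> 'a \<Rightarrow> 'a"
    and \<eta> :: "nat \<Rightarrow> (nat \<Rightarrow> real \<times> real) \<Rightarrow> 'a"
  assumes "covering_symmetric_operad C act"
    and "path_connected_operad C"
    and "good_basepoint C \<eta>"
    and "CARD('l::finite) > 1"
  shows "is_operad_over (pi1_operad C act \<eta>)
           (pi_operad C act \<eta> :: (real ^ 'l \<Rightarrow> 'a set) set operad)
           (pi_act C act \<eta>)"
proof -
  interpret based_covering_operad C act \<eta>
    using assms(1,3) by unfold_locales
  let ?G = "pi1_operad C act \<eta>" and ?D = "pi_operad C act \<eta> :: (real ^ 'l \<Rightarrow> 'a set) set operad"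
  have action: "group_action (go_group ?G n) (op_pts ?D n) (\<lambda>g. restrict (pi_act C act \<eta> n g) (op_pts ?D n))" for n
    using group_action_pi[OF assms(4), of n] by simp
  show ?thesis
    unfolding is_operad_over_def
  proof (intro conjI allI ballI)
    show "is_group_operad ?G" by (rule is_group_operad_pi1)
    show "is_operad ?D" using is_set_operad_pi[OF assms(4)] by (simp add: is_set_operad_def)
    show "group_action (go_group ?G n) (op_pts ?D n) (\<lambda>g. restrict (pi_act C act \<eta> n g) (op_pts ?D n))" for n
      by (rule action)
    show "continuous_map (op_space ?D n) (op_space ?D n) (pi_act C act \<eta> n g)" if g: "g \<in> op_pts ?G n" for n g
      using group_action.element_image[OF action, of g n] g by auto
    fix ms s ts a bs
    assume "s \<in> op_pts ?G (length ms)" "ts \<in> op_tuples ?G ms" "a \<in> op_pts ?D (length ms)" "bs \<in> op_tuples ?D ms"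
    then have "s \<in> \<pi>\<^sub>1 (length ms)" "list_all2 (\<lambda>m t. t \<in> \<pi>\<^sub>1 m) ms ts" "a \<in> \<pi>\<^sub>l (length ms)" "list_all2 (\<lambda>m b. b \<in> \<pi>\<^sub>l m) ms bs"
      by (simp_all add: op_tuples_iff)
    from pi_act_comp[OF this assms(4)]
    show "op_comp ?D ms (pi_act C act \<eta> (length ms) s a)
         (map (\<lambda>(m, t, b). pi_act C act \<eta> m t b) (zip ms (zip ts bs))) =
       pi_act C act \<eta> (sum_list ms) (op_comp ?G ms s ts)
         (let \<sigma> = go_perm ?G (length ms) s
          in op_comp ?D (permute_by \<sigma> ms) a (permute_by \<sigma> bs))"
      by (simp add: Let_def)
  qed
qed

end
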